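(* Let $\beta^*$ be the unique real root of the polynomial $36\beta^3+111\beta^2+77\beta-58$ and let $\alpha^*=\sqrt{\dfrac{6(2-\beta^* )}{4+\beta^*}}$. Let $\alpha\in(0,\alpha^* )$, let $J$ be a nonempty open subset of $\mathcal I$ and let $k\ge2$. There exist $c_0>0$, $\mu_0\ge1$ and $s_0\ge1$ such that for all $\mu\ge\mu_0$ and all $\lambda\ge\mu$, for all $T>0$ and for all $s\ge s_0(T^k+T^{k-1})$, the following inequality holds for all functions $\eta\in C^2([0,T];C^4(\mathcal I))$: $$ \begin{aligned} &\iint_{(0,T)\times\mathcal I}e^{2s\varphi_0}\Big(s^7\mu^8\xi_0^7|\eta|^2+s^5\mu^6\xi_0^5|\partial_{x_1}\eta|^2+s^3\mu^4\xi_0^3|\partial_{x_1}^2\eta|^2+s^3\mu^4\xi_0^3|\partial_t\eta|^2+s\mu^2\xi_0|\partial_{x_1}^3\eta|^2+s\mu^2\xi_0|\partial_t\partial_{x_1}\eta|^2\Big)\\ &+\frac1s\iint_{(0,T)\times\mathcal I}\frac1{\xi_0}e^{2s\varphi_0}\left(|\partial_{x_1}^4\eta|^2+|\partial_t^2\eta|^2+|\partial_t\partial_{x_1}^2\eta|^2\right)\\ &\le c_0\Big(\iint_{(0,T)\times J}s^7\mu^8\xi_0^7e^{2s\varphi_0}|\eta|^2+\iint_{(0,T)\times\mathcal I}e^{2s\varphi_0}\left|\partial_t^2\eta-\alpha\partial_{x_1}^2\partial_t\eta+\partial_{x_1}^4\eta\right|^2\Big). \end{aligned} $$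
   Context: $\mathcal I=\mathbb R/2\pi\mathbb Z$ is the one-dimensional torus and $\Omega=\mathcal I\times(0,1)$; $\omega$ is a fixed nonempty open subset of $\Omega$ and $\partial_n$ is the outward normal derivative on $\partial\Omega$. (Numerically $\beta^*\approx0.4378$, $\alpha^*\approx1.4533$.) Weights: $\ell(t)=t(T-t)$ for $t\in(0,T)$. Fix nonempty open sets $\omega_0\Subset\omega$, $J_0\Subset J$, and smooth functions $\psi_\Omega$ (on $\overline\Omega$) and $\psi_{\mathcal I}$ (on $\mathcal I$) such that $\psi_\Omega>0$ in $\Omega$, $\psi_\Omega=0$ and $\partial_n\psi_\Omega=-1$ on $\partial\Omega$, $\nabla\psi_\Omega(x)=0\Rightarrow x\in\omega_0$; and $\psi_{\mathcal I}>0$ on $\mathcal I$, $\psi_{\mathcal I}'(x_1)=0\Rightarrow x_1\in J_0$ (such functions exist). These are fixed once and for all, independently of $\alpha,\lambda,\mu,s,T$. Let $\Psi=\|\psi_\Omega\|_{L^\infty(\Omega)}+\|\psi_{\mathcal I}\|_{L^\infty(\mathcal I)}$. For $\lambda\ge\mu>0$ set $$\varphi_0(t,x_1)=\frac{e^{\mu\psi_{\mathcal I}(x_1)+8\lambda\Psi}-e^{10\lambda\Psi}}{\ell(t)^{k/2}},\qquad \xi_0(t,x_1)=\frac{e^{\mu\psi_{\mathcal I}(x_1)+8\lambda\Psi}}{\ell(t)^{k/2}}.$$ *)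

theory Defs
  imports "HOL-Analysis.Analysis" "HOL-Probability.Essential_Supremum"
begin

text \<open>
  Conventions. The torus \<open>I = R / 2 pi Z\<close> is handled through its universal cover: functions on \<open>I\<close>
  are \<open>2 pi\<close>-periodic functions on the real line, and subsets of \<open>I\<close> (of \<open>I \<times> [0,1]\<close>) are identified
  with their preimages, i.e. with sets invariant under \<open>x \<mapsto> x + 2 pi\<close> in the first variable. Under
  this identification, open sets and closures on the torus correspond to open sets and closures
  upstairs. Integrals and essential suprema over \<open>I\<close> are taken over the fundamental
  domain \<open>[0, 2 pi)\<close>.
\<close>


section \<open>The constants \<open>\<beta>\<^sup>*\<close> and \<open>\<alpha>\<^sup>*\<close>\<close>

definition beta_star :: real where
  "beta_star = (THE \<beta>. 36 * \<beta> ^ 3 + 111 * \<beta> ^ 2 + 77 * \<beta> - 58 = 0)"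

lemma beta_star_ex1: "\<exists>!\<beta>::real. 36 * \<beta> ^ 3 + 111 * \<beta> ^ 2 + 77 * \<beta> - 58 = 0"
proof -
  let ?p = "\<lambda>\<beta>::real. 36 * \<beta> ^ 3 + 111 * \<beta> ^ 2 + 77 * \<beta> - 58"
  have neg: "?p x < 0" if "x \<le> 0" for x
  proof -
    have 1: "?p x = 36 * x * (x + 37/24)\<^sup>2 - (137/16) * x - 58"
      by (simp add: power2_eq_square power3_eq_cube algebra_simps)
    have 2: "?p x = x\<^sup>2 * (36 * x + 111) + 77 * x - 58"
      by (simp add: power2_eq_square power3_eq_cube algebra_simps)
    show ?thesis
    proof (cases "x \<ge> -6")
      case True
      have "36 * x * (x + 37/24)\<^sup>2 \<le> 0"
        using that by (simp add: mult_nonpos_nonneg)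
      with True show ?thesis unfolding 1 by linarith
    next
      case False
      have "x\<^sup>2 * (36 * x + 111) \<le> 0"
        using False by (intro mult_nonneg_nonpos) auto
      with False show ?thesis unfolding 2 by linarith
    qed
  qed
  have mono: "?p x < ?p y" if "0 < x" "x < y" for x y
  proof -
    have "x ^ 3 < y ^ 3" "x ^ 2 < y ^ 2"
      using that by (simp_all add: power_strict_mono)
    with that show ?thesis by linarith
  qed
  have "\<exists>x\<ge>0. x \<le> 1 \<and> ?p x = 0"
    by (rule IVT') (auto intro!: continuous_intros)
  then obtain b where b: "?p b = 0" by blast
  moreover have "y = b" if y: "?p y = 0" for y
  proof -
    have "b > 0" "y > 0" using neg[of b] neg[of y] b y by (force simp: not_le[symmetric])+
    then show ?thesis
      using mono[of b y] mono[of y b] b y by (cases b y rule: linorder_cases) auto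
  qed
  ultimately show ?thesis by blast
qed

definition alpha_star :: real where
  "alpha_star = sqrt (6 * (2 - beta_star) / (4 + beta_star))"


section \<open>Domains\<close>

definition torus_fund :: "real set" where
  "torus_fund = {0..<2 * pi}"

definition strip :: "(real \<times> real) set" where
  "strip = UNIV \<times> {0<..<1}"

definition closed_strip :: "(real \<times> real) set" where
  "closed_strip = UNIV \<times> {0..1}"

definition torus_invariant :: "real set \<Rightarrow> bool" where
  "torus_invariant J \<longleftrightarrow> (\<forall>x. x + 2 * pi \<in> J \<longleftrightarrow> x \<in> J)"

definition strip_invariant :: "(real \<times> real) set \<Rightarrow> bool" where
  "strip_invariant U \<longleftrightarrow> (\<forall>x y. (x + 2 * pi, y) \<in> U \<longleftrightarrow> (x, y) \<in> U)"

text \<open>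
  Relative compactness \<open>A \<Subset> B\<close>. All sets to which this is applied are bounded subsets of
  \<open>I\<close> or \<open>I \<times> R\<close>, so the closure of \<open>A\<close> downstairs is automatically compact.
\<close>
definition compactly_in :: "'a::topological_space set \<Rightarrow> 'a set \<Rightarrow> bool" where
  "compactly_in A B \<longleftrightarrow> closure A \<subseteq> B"


section \<open>Smooth functions\<close>

text \<open>
  \<open>Ck_on n S f\<close>: \<open>f\<close> is \<open>n\<close> times continuously differentiable on \<open>S\<close>. It is used only for \<open>S\<close> the real
  line and for \<open>S\<close> the closed strip; on the latter, derivatives at boundary points are taken within
  the strip (one-sided), and they are unique.
\<close>
primrec Ck_on :: "nat \<Rightarrow> 'a::euclidean_space set \<Rightarrow> ('a \<Rightarrow> real) \<Rightarrow> bool" where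
  "Ck_on 0 S f \<longleftrightarrow> continuous_on S f"
| "Ck_on (Suc n) S f \<longleftrightarrow>
     (\<exists>f'. (\<forall>x\<in>S. (f has_derivative f' x) (at x within S)) \<and>
           (\<forall>b\<in>Basis. Ck_on n S (\<lambda>x. f' x b)))"

definition smooth_on :: "'a::euclidean_space set \<Rightarrow> ('a \<Rightarrow> real) \<Rightarrow> bool" where
  "smooth_on S f \<longleftrightarrow> (\<forall>n. Ck_on n S f)"

definition periodic :: "(real \<Rightarrow> real) \<Rightarrow> bool" where
  "periodic f \<longleftrightarrow> (\<forall>x. f (x + 2 * pi) = f x)"


section \<open>The space \<open>C\<^sup>2([0,T]; C\<^sup>4(I))\<close>\<close>

definition C4_torus :: "(real \<Rightarrow> real) set" where
  "C4_torus = {f. periodic f \<and> Ck_on 4 UNIV f}"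

definition C4_norm :: "(real \<Rightarrow> real) \<Rightarrow> real" where
  "C4_norm f = (\<Sum>i\<le>4. SUP x. \<bar>(deriv ^^ i) f x\<bar>)"

text \<open>Differentiability and continuity of curves \<open>[0,T] \<rightarrow> C\<^sup>4(I)\<close> with respect to the \<open>C\<^sup>4\<close> norm.\<close>

definition C4_has_deriv :: "real \<Rightarrow> (real \<Rightarrow> real \<Rightarrow> real) \<Rightarrow> (real \<Rightarrow> real \<Rightarrow> real) \<Rightarrow> bool" where
  "C4_has_deriv T \<eta> \<eta>' \<longleftrightarrow> (\<forall>t\<in>{0..T}.
     ((\<lambda>r. C4_norm (\<lambda>x. (\<eta> r x - \<eta> t x) / (r - t) - \<eta>' t x)) \<longlongrightarrow> 0) (at t within {0..T}))"

definition C4_continuous :: "real \<Rightarrow> (real \<Rightarrow> real \<Rightarrow> real) \<Rightarrow> bool" where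
  "C4_continuous T \<eta> \<longleftrightarrow> (\<forall>t\<in>{0..T}.
     ((\<lambda>r. C4_norm (\<lambda>x. \<eta> r x - \<eta> t x)) \<longlongrightarrow> 0) (at t within {0..T}))"

definition C2_C4 :: "real \<Rightarrow> (real \<Rightarrow> real \<Rightarrow> real) set" where
  "C2_C4 T = {\<eta>. \<exists>\<eta>' \<eta>''.
     (\<forall>t\<in>{0..T}. \<eta> t \<in> C4_torus \<and> \<eta>' t \<in> C4_torus \<and> \<eta>'' t \<in> C4_torus) \<and>
     C4_has_deriv T \<eta> \<eta>' \<and> C4_has_deriv T \<eta>' \<eta>'' \<and> C4_continuous T \<eta>''}"

definition dt :: "(real \<Rightarrow> real \<Rightarrow> real) \<Rightarrow> real \<Rightarrow> real \<Rightarrow> real" where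
  "dt \<eta> = (\<lambda>t x. deriv (\<lambda>r. \<eta> r x) t)"

definition dx :: "(real \<Rightarrow> real \<Rightarrow> real) \<Rightarrow> real \<Rightarrow> real \<Rightarrow> real" where
  "dx \<eta> = (\<lambda>t x. deriv (\<eta> t) x)"


section \<open>Weights\<close>

definition Linf_norm :: "'a::euclidean_space set \<Rightarrow> ('a \<Rightarrow> real) \<Rightarrow> real" where
  "Linf_norm A f = real_of_ereal (esssup (restrict_space lborel A) (\<lambda>x. ereal \<bar>f x\<bar>))"

text \<open>
  The outward unit normal is \<open>(0,-1)\<close> on \<open>y = 0\<close> and \<open>(0,1)\<close> on \<open>y = 1\<close>, so that \<open>\<partial>\<^sub>n \<psi> = -1\<close> means
  \<open>\<partial>\<^sub>y \<psi> = 1\<close> on \<open>y = 0\<close> and \<open>\<partial>\<^sub>y \<psi> = -1\<close> on \<open>y = 1\<close>.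
\<close>
definition weight_Omega :: "(real \<times> real) set \<Rightarrow> (real \<times> real \<Rightarrow> real) \<Rightarrow> bool" where
  "weight_Omega \<omega>0 \<psi> \<longleftrightarrow>
     (\<forall>x. \<forall>y\<in>{0..1}. \<psi> (x + 2 * pi, y) = \<psi> (x, y)) \<and>
     smooth_on closed_strip \<psi> \<and>
     (\<forall>p\<in>strip. \<psi> p > 0) \<and>
     (\<forall>x. \<psi> (x, 0) = 0 \<and> \<psi> (x, 1) = 0) \<and>
     (\<forall>x. ((\<lambda>y. \<psi> (x, y)) has_real_derivative 1) (at 0 within {0..1}) \<and>
          ((\<lambda>y. \<psi> (x, y)) has_real_derivative -1) (at 1 within {0..1})) \<and>
     (\<forall>p\<in>closed_strip. (\<psi> has_derivative (\<lambda>_. 0)) (at p within closed_strip) \<longrightarrow> p \<in> \<omega>0)"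

definition weight_torus :: "real set \<Rightarrow> (real \<Rightarrow> real) \<Rightarrow> bool" where
  "weight_torus J0 \<psi> \<longleftrightarrow>
     periodic \<psi> \<and> smooth_on UNIV \<psi> \<and> (\<forall>x. \<psi> x > 0) \<and> (\<forall>x. deriv \<psi> x = 0 \<longrightarrow> x \<in> J0)"

definition Psi :: "(real \<times> real \<Rightarrow> real) \<Rightarrow> (real \<Rightarrow> real) \<Rightarrow> real" where
  "Psi \<psi>\<Omega> \<psi>I = Linf_norm (torus_fund \<times> {0<..<1}) \<psi>\<Omega> + Linf_norm torus_fund \<psi>I"

definition ell :: "real \<Rightarrow> real \<Rightarrow> real" where
  "ell T t = t * (T - t)"

definition phi0 :: "(real \<Rightarrow> real) \<Rightarrow> real \<Rightarrow> real \<Rightarrow> real \<Rightarrow> real \<Rightarrow> real \<Rightarrow> real \<Rightarrow> real \<Rightarrow> real" where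
  "phi0 \<psi>I \<Psi> k T lam \<mu> t x =
     (exp (\<mu> * \<psi>I x + 8 * lam * \<Psi>) - exp (10 * lam * \<Psi>)) / ell T t powr (k / 2)"

definition xi0 :: "(real \<Rightarrow> real) \<Rightarrow> real \<Rightarrow> real \<Rightarrow> real \<Rightarrow> real \<Rightarrow> real \<Rightarrow> real \<Rightarrow> real \<Rightarrow> real" where
  "xi0 \<psi>I \<Psi> k T lam \<mu> t x = exp (\<mu> * \<psi>I x + 8 * lam * \<Psi>) / ell T t powr (k / 2)"

text \<open>Integral over \<open>(0,T) \<times> J\<close> for \<open>J\<close> a subset of the torus.\<close>
definition cyl_integral :: "real \<Rightarrow> real set \<Rightarrow> (real \<Rightarrow> real \<Rightarrow> real) \<Rightarrow> real" where
  "cyl_integral T J f =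
     set_lebesgue_integral lborel ({0<..<T} \<times> (J \<inter> torus_fund)) (\<lambda>(t, x). f t x)"

end

theory Submission
  imports Defs
begin

text \<open>
  With \<open>\<alpha> = 2 r\<close>, \<open>0 < r < 1\<close>, \<open>\<sigma> = sqrt (1 - r\<^sup>2)\<close> and \<open>a = r + \<i> \<sigma>\<close>, the operator factors as
  \<open>\<partial>\<^sub>t\<^sup>2 - \<alpha> \<partial>\<^sub>x\<^sup>2 \<partial>\<^sub>t + \<partial>\<^sub>x\<^sup>4 = (\<partial>\<^sub>t - a \<partial>\<^sub>x\<^sup>2) (\<partial>\<^sub>t - cnj a \<partial>\<^sub>x\<^sup>2)\<close>. As \<open>\<eta>\<close> is real, one Carleman estimate for
  \<open>\<partial>\<^sub>t - a \<partial>\<^sub>x\<^sup>2\<close> applied to \<open>U + \<i> V = (\<partial>\<^sub>t - cnj a \<partial>\<^sub>x\<^sup>2) \<eta>\<close>, where \<open>U = \<partial>\<^sub>t \<eta> - r \<partial>\<^sub>x\<^sup>2 \<eta>\<close> and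
  \<open>V = \<sigma> \<partial>\<^sub>x\<^sup>2 \<eta>\<close>, controls \<open>\<partial>\<^sub>t \<eta>\<close> and \<open>\<partial>\<^sub>x\<^sup>2 \<eta>\<close> separately; applying two such estimates one
  after the other would lose a power of \<open>s \<xi>\<close>. For the factor, multiply by \<open>cnj a\<close>, conjugate with
  \<open>exp (s \<phi>)\<close> and split into a symmetric and a skew-symmetric part: the commutator is positive except
  near the critical points of \<open>\<psi>\<close>. The terms in \<open>\<eta>\<close> and \<open>\<partial>\<^sub>x \<eta>\<close> follow from a weighted Poincare inequality
  in \<open>x\<close>. The remaining local terms carry powers of a cutoff \<open>q\<close> built from \<open>\<psi>'\<close>, and integrations
  by parts reduce them to \<open>q\<^sup>2 (s \<xi>)\<^sup>7 \<mu>\<^sup>8 \<bar>\<eta>\<bar>\<^sup>2\<close>, two powers of \<open>q\<close> being spent at each step.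
  The argument works for all \<open>\<alpha> < 2\<close>, and \<open>\<alpha>\<^sup>* < 2\<close>.
\<close>

section \<open>Integration over the cylinder\<close>

text \<open>A periodic \<psi> has a maximum, and there \<theta>x, the source of positivity in the
  commutator, is not positive; local terms and a cutoff are therefore unavoidable. Since |a| = 1,
  multiplication by cnj a leaves the second space derivative with coefficient -1 and splits the time
  derivative: - \<i> \<sigma> \<partial>_t goes to the symmetric part and r \<partial>_t to the skew
  one. The skew part then returns the time derivative at the price of 1 / r, and the symmetric part
  returns the second space derivative. Reading off \<partial>_x^2 \<eta> from V costs 1 / \<sigma>,
  which is where \<alpha> < 2 enters. The final constant has to be fixed before \<mu>, \<lambda>, T,
  s and \<eta>. For this reason the weights enter only through inequalities with a parameter
  \<epsilon> determined by K and \<delta>, and the last absorption is a statement about real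
  numbers.\<close>

definition cyl_continuous :: "real \<Rightarrow> (real \<Rightarrow> real \<Rightarrow> real) \<Rightarrow> bool" where
  "cyl_continuous T F \<longleftrightarrow> continuous_on ({0<..<T} \<times> UNIV) (\<lambda>p. F (fst p) (snd p))"

text \<open>A relation between two functions, so that derivatives can be supplied in closed form.
  Only times strictly inside (0,T) count, because the weights are singular at both ends.\<close>

definition x_deriv :: "real \<Rightarrow> (real \<Rightarrow> real \<Rightarrow> real) \<Rightarrow> (real \<Rightarrow> real \<Rightarrow> real) \<Rightarrow> bool" where
  "x_deriv T F F' \<longleftrightarrow> (\<forall>t\<in>{0<..<T}. \<forall>x. ((\<lambda>y. F t y) has_real_derivative F' t x) (at x))"

definition t_deriv :: "real \<Rightarrow> (real \<Rightarrow> real \<Rightarrow> real) \<Rightarrow> (real \<Rightarrow> real \<Rightarrow> real) \<Rightarrow> bool" where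
  "t_deriv T F F' \<longleftrightarrow> (\<forall>t\<in>{0<..<T}. \<forall>x. ((\<lambda>r. F r x) has_real_derivative F' t x) (at t))"

section \<open>Fubini and integrals of exact derivatives\<close>

lemma torus_fund_sets [measurable]: "torus_fund \<in> sets borel" "torus_fund \<in> sets lborel"
  by (auto simp: torus_fund_def)

lemma cyl_borel:
  assumes "A \<in> sets borel" shows "{0<..<T} \<times> A \<in> sets (borel :: (real \<times> real) measure)"
proof -
  have "{0<..<T} \<times> A \<in> sets ((borel :: real measure) \<Otimes>\<^sub>M (borel :: real measure))"
    using assms by (intro pair_measureI) auto
  then show ?thesis unfolding borel_prod .
qed

lemma cyl_set_integrable:
  assumes c: "cyl_continuous T F" and b: "\<And>t x. 0 < t \<Longrightarrow> t < T \<Longrightarrow> \<bar>F t x\<bar> \<le> B"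
    and A: "A \<in> sets borel"
  shows "set_integrable lborel ({0<..<T} \<times> (A \<inter> torus_fund)) (\<lambda>(t, x). F t x)"
proof -
  have S: "{0<..<T} \<times> (A \<inter> torus_fund) \<in> sets (borel :: (real \<times> real) measure)"
    using A by (intro cyl_borel) auto
  have sub: "{0<..<T} \<times> (A \<inter> torus_fund) \<subseteq> cbox (0, 0) (T, 2 * pi)"
    by (auto simp: torus_fund_def cbox_Pair_eq)
  have "emeasure lborel ({0<..<T} \<times> (A \<inter> torus_fund)) \<le> emeasure lborel (cbox (0::real, 0::real) (T, 2 * pi))"
    using sub by (intro emeasure_mono) auto
  then have fin: "emeasure lborel ({0<..<T} \<times> (A \<inter> torus_fund)) < \<infinity>"
    using emeasure_lborel_cbox_finite le_less_trans by blast
  have meas: "set_borel_measurable lborel ({0<..<T} \<times> (A \<inter> torus_fund)) (\<lambda>(t, x). F t x)"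
  proof -
    have "continuous_on ({0<..<T} \<times> (A \<inter> torus_fund)) (\<lambda>p. F (fst p) (snd p))"
      using c unfolding cyl_continuous_def by (rule continuous_on_subset) auto
    from borel_measurable_continuous_on_indicator[OF S this] show ?thesis
      by (simp add: set_borel_measurable_def case_prod_unfold)
  qed
  show ?thesis
    unfolding set_integrable_def
  proof (rule integrableI_bounded_set[where A = "{0<..<T} \<times> (A \<inter> torus_fund)" and B = "\<bar>B\<bar>"])
    show "(\<lambda>p. indicat_real ({0<..<T} \<times> (A \<inter> torus_fund)) p *\<^sub>R (case p of (t, x) \<Rightarrow> F t x)) \<in> borel_measurable lborel"
      using meas by (simp add: set_borel_measurable_def)
    show "AE p in lborel. p \<in> {0<..<T} \<times> (A \<inter> torus_fund) \<longrightarrow>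
        norm (indicat_real ({0<..<T} \<times> (A \<inter> torus_fund)) p *\<^sub>R (case p of (t, x) \<Rightarrow> F t x)) \<le> \<bar>B\<bar>"
      using b by (intro AE_I2) (auto intro: order_trans[OF _ abs_ge_self])
  qed (use S fin in \<open>auto simp: indicator_def\<close>)
qed

text \<open>Both orders are recorded because an exact derivative in x, or in t, is integrated first
  in its own variable.\<close>

lemma cyl_fubini:
  assumes c: "cyl_continuous T F" and b: "\<And>t x. 0 < t \<Longrightarrow> t < T \<Longrightarrow> \<bar>F t x\<bar> \<le> B"
  shows "cyl_integral T UNIV F = (LBINT t:{0<..<T}. (LBINT x:torus_fund. F t x))"
    and "cyl_integral T UNIV F = (LBINT x:torus_fund. (LBINT t:{0<..<T}. F t x))"
proof -
  let ?g = "\<lambda>t x. indicat_real {0<..<T} t * (indicat_real torus_fund x * F t x)"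
  have int: "integrable (lborel \<Otimes>\<^sub>M lborel) (case_prod ?g)"
    using cyl_set_integrable[OF c b, of UNIV]
    by (simp add: set_integrable_def lborel_prod indicator_times case_prod_unfold mult.assoc)
  have eq: "cyl_integral T UNIV F = integral\<^sup>L (lborel \<Otimes>\<^sub>M lborel) (case_prod ?g)"
    by (simp add: cyl_integral_def set_lebesgue_integral_def lborel_prod indicator_times case_prod_unfold mult.assoc)
  show "cyl_integral T UNIV F = (LBINT t:{0<..<T}. (LBINT x:torus_fund. F t x))"
    unfolding eq lborel_pair.integral_fst'[OF int, symmetric] set_lebesgue_integral_def by simp
  show "cyl_integral T UNIV F = (LBINT x:torus_fund. (LBINT t:{0<..<T}. F t x))"
    unfolding eq lborel_pair.integral_snd[OF int, symmetric] set_lebesgue_integral_def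
    by (simp add: mult.left_commute)
qed

text \<open>Periodicity makes the two boundary values of each time slice cancel.\<close>

lemma cyl_integral_x_deriv:
  assumes c: "cyl_continuous T F'" and b: "\<And>t x. 0 < t \<Longrightarrow> t < T \<Longrightarrow> \<bar>F' t x\<bar> \<le> B"
    and d: "x_deriv T F F'" and per: "\<And>t x. 0 < t \<Longrightarrow> t < T \<Longrightarrow> F t (x + 2 * pi) = F t x"
  shows "cyl_integral T UNIV F' = 0"
proof -
  have "(LBINT x:torus_fund. F' t x) = 0" if t: "0 < t" "t < T" for t
  proof -
    have cont: "continuous_on UNIV (F' t)"
    proof -
      have "continuous_on UNIV (\<lambda>x. (t, x))" by (intro continuous_intros)
      then have "continuous_on UNIV ((\<lambda>p. F' (fst p) (snd p)) \<circ> (\<lambda>x. (t, x)))"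
        using c t unfolding cyl_continuous_def
        by (intro continuous_on_compose) (auto elim: continuous_on_subset)
      then show ?thesis by (simp add: o_def)
    qed
    \<comment> \<open>The fundamental domain is half open; adding the null set {2 pi} permits the
      fundamental theorem on a closed interval.\<close>
    have "(LBINT x:torus_fund. F' t x) = (LBINT x:{0..2*pi}. F' t x)"
    proof (rule set_integral_cong_set)
      have [measurable]: "F' t \<in> borel_measurable borel"
        using cont by (rule borel_measurable_continuous_onI)
      show "set_borel_measurable lborel {0..2*pi} (F' t)" "set_borel_measurable lborel torus_fund (F' t)"
        unfolding set_borel_measurable_def by measurable
      show "AE x in lborel. x \<in> {0..2*pi} \<longleftrightarrow> x \<in> torus_fund"
        using AE_lborel_singleton[of "2 * pi"] by eventually_elim (auto simp: torus_fund_def)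
    qed
    also have "\<dots> = F t (2 * pi) - F t 0"
      using integral_FTC_Icc_real[of 0 "2 * pi" "F t" "F' t"] d t cont
      by (auto simp: x_deriv_def set_lebesgue_integral_def mult.commute continuous_on_eq_continuous_at)
    also have "\<dots> = 0" using per[of t 0] t by simp
    finally show ?thesis .
  qed
  then have "(LBINT t:{0<..<T}. (LBINT x:torus_fund. F' t x)) = (LBINT t:{0<..<T}. (0::real))"
    by (intro set_lebesgue_integral_cong) auto
  then show ?thesis using cyl_fubini(1)[OF c b] by (simp add: set_lebesgue_integral_def)
qed

text \<open>Nothing is assumed at t = 0 and t = T themselves: \<open>ell T t\<close> vanishes at
  both ends, so the bound on F supplies the limits 0 that the fundamental theorem on an open
  interval requires.\<close>

lemma cyl_integral_t_deriv:
  assumes T: "0 < T" and c: "cyl_continuous T F'" and b: "\<And>t x. 0 < t \<Longrightarrow> t < T \<Longrightarrow> \<bar>F' t x\<bar> \<le> B"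
    and d: "t_deriv T F F'" and z: "\<And>t x. 0 < t \<Longrightarrow> t < T \<Longrightarrow> \<bar>F t x\<bar> \<le> D * ell T t"
  shows "cyl_integral T UNIV F' = 0"
proof -
  have "(LBINT t:{0<..<T}. F' t x) = 0" for x
  proof -
    have cont: "continuous_on {0<..<T} (\<lambda>t. F' t x)"
    proof -
      have "continuous_on {0<..<T} (\<lambda>t. (t, x))" by (intro continuous_intros)
      then have "continuous_on {0<..<T} ((\<lambda>p. F' (fst p) (snd p)) \<circ> (\<lambda>t. (t, x)))"
        using c unfolding cyl_continuous_def
        by (intro continuous_on_compose) (auto elim: continuous_on_subset)
      then show ?thesis by (simp add: o_def)
    qed
    have int: "set_integrable lborel {0<..<T} (\<lambda>t. F' t x)"
      unfolding set_integrable_def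
    proof (rule integrableI_bounded_set[where A = "{0<..<T}" and B = "\<bar>B\<bar>"])
      show "(\<lambda>t. indicat_real {0<..<T} t *\<^sub>R F' t x) \<in> borel_measurable lborel"
        using borel_measurable_continuous_on_indicator[OF _ cont] by simp
    qed (use b T in \<open>auto intro!: AE_I2 intro: order_trans[OF _ abs_ge_self] simp: indicator_def\<close>)
    have lim: "((\<lambda>t. F t x) \<longlongrightarrow> 0) (at u within S)"
      if "ell T u = 0" "\<forall>\<^sub>F t in at u within S. 0 < t \<and> t < T" for u S
    proof (rule Lim_null_comparison)
      show "\<forall>\<^sub>F t in at u within S. norm (F t x) \<le> D * ell T t"
        using that(2) by eventually_elim (use z in auto)
      have "((\<lambda>t. D * ell T t) \<longlongrightarrow> D * ell T u) (at u within S)"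
        unfolding ell_def by (intro tendsto_intros)
      then show "((\<lambda>t. D * ell T t) \<longlongrightarrow> 0) (at u within S)" using that by simp
    qed
    have e: "einterval (ereal 0) (ereal T) = {0<..<T}" by (auto simp: einterval_def)
    have near: "\<forall>\<^sub>F t in at_right 0. 0 < t \<and> t < T" "\<forall>\<^sub>F t in at_left T. 0 < t \<and> t < T"
      using T by (auto intro: eventually_at_rightI[of 0 T] eventually_at_leftI[of 0 T])
    have "(LBINT t=ereal 0..ereal T. F' t x) = 0 - 0"
    proof (rule interval_integral_FTC_integrable)
      show "set_integrable lborel (einterval (ereal 0) (ereal T)) (\<lambda>t. F' t x)" using int e by simp
      show "((\<lambda>t. F t x) has_vector_derivative F' t x) (at t)" if "ereal 0 < ereal t" "ereal t < ereal T" for t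
        using d that by (auto simp: t_deriv_def has_real_derivative_iff_has_vector_derivative[symmetric])
      show "isCont (\<lambda>t. F' t x) t" if "ereal 0 < ereal t" "ereal t < ereal T" for t
        using cont that by (auto simp: continuous_on_eq_continuous_at)
      show "(((\<lambda>t. F t x) \<circ> real_of_ereal) \<longlongrightarrow> 0) (at_right (ereal 0))"
        unfolding ereal_tendsto_simps1(2) using lim[OF _ near(1)] by (simp add: ell_def)
      show "(((\<lambda>t. F t x) \<circ> real_of_ereal) \<longlongrightarrow> 0) (at_left (ereal T))"
        unfolding ereal_tendsto_simps1(1) using lim[OF _ near(2)] by (simp add: ell_def)
    qed (use T in auto)
    then show ?thesis using T by (simp add: interval_lebesgue_integral_def e)
  qed
  then show ?thesis using cyl_fubini(2)[OF c b] by (simp add: set_lebesgue_integral_def)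
qed

section \<open>Functions of moderate growth and the weighted integral\<close>

text \<open>
  Growth that is absorbed by the factor \<open>exp (2 s \<phi>)\<close>, so that all boundary terms at \<open>t = 0\<close> and
  \<open>t = T\<close> vanish.
\<close>
definition moderate :: "real \<Rightarrow> (real \<Rightarrow> real \<Rightarrow> real) \<Rightarrow> bool" where
  "moderate T F \<longleftrightarrow> cyl_continuous T F \<and> (\<forall>t\<in>{0<..<T}. \<forall>x. F t (x + 2 * pi) = F t x) \<and>
     (\<exists>C m. \<forall>t\<in>{0<..<T}. \<forall>x. \<bar>F t x\<bar> \<le> C * (1 + 1 / ell T t) ^ m)"

lemma ell_pos: "0 < t \<Longrightarrow> t < T \<Longrightarrow> 0 < ell T t"
  by (simp add: ell_def)

lemma moderate_bound:
  assumes "moderate T F"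
  shows "\<exists>C m. 0 \<le> C \<and> (\<forall>t x. 0 < t \<longrightarrow> t < T \<longrightarrow> \<bar>F t x\<bar> \<le> C * (1 + 1 / ell T t) ^ m)"
proof -
  from assms obtain C m where C: "\<forall>t\<in>{0<..<T}. \<forall>x. \<bar>F t x\<bar> \<le> C * (1 + 1 / ell T t) ^ m"
    by (auto simp: moderate_def)
  have "\<bar>F t x\<bar> \<le> \<bar>C\<bar> * (1 + 1 / ell T t) ^ m" if t: "0 < t" "t < T" for t x
  proof -
    have "\<bar>F t x\<bar> \<le> C * (1 + 1 / ell T t) ^ m" using C t by auto
    also have "\<dots> \<le> \<bar>C\<bar> * (1 + 1 / ell T t) ^ m"
      using ell_pos[OF t] by (intro mult_right_mono) auto
    finally show ?thesis .
  qed
  then show ?thesis by (intro exI[of _ "\<bar>C\<bar>"] exI[of _ m]) auto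
qed

lemma moderateI:
  assumes "cyl_continuous T F" "\<And>t x. 0 < t \<Longrightarrow> t < T \<Longrightarrow> F t (x + 2 * pi) = F t x"
    and "\<And>t x. 0 < t \<Longrightarrow> t < T \<Longrightarrow> \<bar>F t x\<bar> \<le> C * (1 + 1 / ell T t) ^ m"
  shows "moderate T F"
  unfolding moderate_def using assms by (intro conjI exI[of _ C] exI[of _ m]) auto

text \<open>Meant for weights such as \<tau> and \<rho>, whose growth is known only through powers
  of N.\<close>

lemma moderate_dominated:
  assumes "cyl_continuous T F" "\<And>t x. 0 < t \<Longrightarrow> t < T \<Longrightarrow> F t (x + 2 * pi) = F t x"
    and "\<And>t x. 0 < t \<Longrightarrow> t < T \<Longrightarrow> \<bar>F t x\<bar> \<le> \<bar>G t x\<bar>" "moderate T G"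
  shows "moderate T F"
proof -
  obtain C m where "0 \<le> C" "\<forall>t x. 0 < t \<longrightarrow> t < T \<longrightarrow> \<bar>G t x\<bar> \<le> C * (1 + 1 / ell T t) ^ m"
    using moderate_bound[OF assms(4)] by blast
  note C = this(1) this(2)[rule_format]
  show ?thesis
  proof (rule moderateI[OF assms(1)])
    show "\<bar>F t x\<bar> \<le> C * (1 + 1 / ell T t) ^ m" if "0 < t" "t < T" for t x
      using assms(3)[OF that, of x] C(2)[OF that, of x] by linarith
  qed (rule assms(2))
qed

lemma moderate_const [intro!, simp]: "moderate T (\<lambda>t x. c)"
  by (rule moderateI[where C = "\<bar>c\<bar>" and m = 0]) (auto simp: cyl_continuous_def)

lemma moderate_add [intro!]:
  assumes "moderate T F" "moderate T G"
  shows "moderate T (\<lambda>t x. F t x + G t x)"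
proof -
  obtain C m where "0 \<le> C" "\<forall>t x. 0 < t \<longrightarrow> t < T \<longrightarrow> \<bar>F t x\<bar> \<le> C * (1 + 1 / ell T t) ^ m"
    using moderate_bound[OF assms(1)] by blast
  note C = this(1) this(2)[rule_format]
  obtain D n where "0 \<le> D" "\<forall>t x. 0 < t \<longrightarrow> t < T \<longrightarrow> \<bar>G t x\<bar> \<le> D * (1 + 1 / ell T t) ^ n"
    using moderate_bound[OF assms(2)] by blast
  note D = this(1) this(2)[rule_format]
  show ?thesis
  proof (rule moderateI[where C = "C + D" and m = "m + n"])
    show "cyl_continuous T (\<lambda>t x. F t x + G t x)"
      using assms by (auto simp: moderate_def cyl_continuous_def intro!: continuous_on_add)
    fix t x assume t: "0 < t" "t < T"
    show "F t (x + 2 * pi) + G t (x + 2 * pi) = F t x + G t x"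
      using assms t by (auto simp: moderate_def)
    let ?w = "1 + 1 / ell T t"
    have w: "1 \<le> ?w" using ell_pos[OF t] by simp
    have "\<bar>F t x + G t x\<bar> \<le> C * ?w ^ m + D * ?w ^ n"
      using C(2)[OF t, of x] D(2)[OF t, of x] by linarith
    also have "\<dots> \<le> C * ?w ^ (m + n) + D * ?w ^ (m + n)"
      by (intro add_mono mult_left_mono power_increasing) (use w C D in auto)
    finally show "\<bar>F t x + G t x\<bar> \<le> (C + D) * ?w ^ (m + n)" by (simp add: algebra_simps)
  qed
qed

lemma moderate_mult [intro!]:
  assumes "moderate T F" "moderate T G"
  shows "moderate T (\<lambda>t x. F t x * G t x)"
proof -
  obtain C m where "0 \<le> C" "\<forall>t x. 0 < t \<longrightarrow> t < T \<longrightarrow> \<bar>F t x\<bar> \<le> C * (1 + 1 / ell T t) ^ m"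
    using moderate_bound[OF assms(1)] by blast
  note C = this(1) this(2)[rule_format]
  obtain D n where "0 \<le> D" "\<forall>t x. 0 < t \<longrightarrow> t < T \<longrightarrow> \<bar>G t x\<bar> \<le> D * (1 + 1 / ell T t) ^ n"
    using moderate_bound[OF assms(2)] by blast
  note D = this(1) this(2)[rule_format]
  show ?thesis
  proof (rule moderateI[where C = "C * D" and m = "m + n"])
    show "cyl_continuous T (\<lambda>t x. F t x * G t x)"
      using assms by (auto simp: moderate_def cyl_continuous_def intro!: continuous_on_mult)
    fix t x assume t: "0 < t" "t < T"
    show "F t (x + 2 * pi) * G t (x + 2 * pi) = F t x * G t x"
      using assms t by (auto simp: moderate_def)
    have "\<bar>F t x * G t x\<bar> \<le> (C * (1 + 1 / ell T t) ^ m) * (D * (1 + 1 / ell T t) ^ n)"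
      unfolding abs_mult using C(2)[OF t, of x] D(2)[OF t, of x] by (intro mult_mono) auto
    then show "\<bar>F t x * G t x\<bar> \<le> C * D * (1 + 1 / ell T t) ^ (m + n)"
      by (simp add: power_add algebra_simps)
  qed
qed

lemma moderate_minus [intro!]: "moderate T F \<Longrightarrow> moderate T (\<lambda>t x. - F t x)"
  using moderate_mult[OF moderate_const[of T "-1"], of F] by simp

lemma moderate_diff [intro!]:
  "moderate T F \<Longrightarrow> moderate T G \<Longrightarrow> moderate T (\<lambda>t x. F t x - G t x)"
  using moderate_add[of T F "\<lambda>t x. - G t x"] by auto

lemma moderate_power [intro!]: "moderate T F \<Longrightarrow> moderate T (\<lambda>t x. F t x ^ n)"
  by (induction n) auto

lemma moderate_divide_const [intro!]: "moderate T F \<Longrightarrow> moderate T (\<lambda>t x. F t x / c)"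
  using moderate_mult[OF _ moderate_const[of T "1 / c"], of F] by simp

lemmas moderate_intros = moderate_const moderate_add moderate_mult moderate_minus moderate_diff
  moderate_power moderate_divide_const

section \<open>Periodic functions and reduction to one period\<close>

lemma periodic_int:
  assumes "periodic g"
  shows "g (x + 2 * pi * of_int n) = g x"
proof -
  have nat: "g (x + 2 * pi * of_nat m) = g x" for m x
  proof (induction m)
    case (Suc m)
    have "g (x + 2 * pi * of_nat (Suc m)) = g ((x + 2 * pi * of_nat m) + 2 * pi)"
      by (simp add: algebra_simps)
    then show ?case using Suc assms by (simp add: periodic_def)
  qed simp
  show ?thesis
  proof (cases n)
    case (nonneg m) then show ?thesis using nat by simp
  next
    case (neg m)
    have "g (x + 2 * pi * of_int n) = g ((x + 2 * pi * of_int n) + 2 * pi * of_nat (Suc m))"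
      by (rule nat[symmetric])
    also have "(x + 2 * pi * of_int n) + 2 * pi * of_nat (Suc m) = x"
    proof -
      have "of_int n = - (of_nat (Suc m) :: real)" using neg by simp
      then show ?thesis by (simp only: mult_minus_right)
    qed
    finally show ?thesis .
  qed
qed

lemma torus_representative:
  obtains n :: int where "x + 2 * pi * of_int n \<in> {0..<2 * pi}"
proof
  let ?n = "- \<lfloor>x / (2 * pi)\<rfloor>"
  have "of_int \<lfloor>x / (2 * pi)\<rfloor> \<le> x / (2 * pi)" "x / (2 * pi) < of_int \<lfloor>x / (2 * pi)\<rfloor> + 1"
    by linarith+
  then have "of_int \<lfloor>x / (2 * pi)\<rfloor> * (2 * pi) \<le> x" "x < (of_int \<lfloor>x / (2 * pi)\<rfloor> + 1) * (2 * pi)"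
    by (simp_all only: pos_le_divide_eq pos_divide_less_eq pi_gt_zero mult_pos_pos zero_less_numeral)
  then show "x + 2 * pi * of_int ?n \<in> {0..<2 * pi}" by (simp add: algebra_simps)
qed

lemma periodic_bounded:
  assumes "periodic g" "continuous_on UNIV g"
  shows "\<exists>B. \<forall>x. \<bar>g x\<bar> \<le> B"
proof -
  have "compact (g ` {0..2 * pi})"
    using assms(2) by (intro compact_continuous_image) (auto elim: continuous_on_subset)
  then obtain B where B: "\<And>y. y \<in> g ` {0..2*pi} \<Longrightarrow> norm y \<le> B"
    using compact_imp_bounded bounded_iff by metis
  have "\<bar>g x\<bar> \<le> B" for x
  proof -
    obtain n where n: "x + 2 * pi * of_int n \<in> {0..<2 * pi}" using torus_representative .
    then have "\<bar>g (x + 2 * pi * of_int n)\<bar> \<le> B" using B[of "g (x + 2 * pi * of_int n)"] by auto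
    then show ?thesis by (simp only: periodic_int[OF assms(1)])
  qed
  then show ?thesis by blast
qed

lemma cyl_continuous_x: "continuous_on UNIV g \<Longrightarrow> cyl_continuous T (\<lambda>t. g)"
  unfolding cyl_continuous_def
  by (rule continuous_on_compose2[OF _ continuous_on_snd[OF continuous_on_id]]) auto

lemma moderate_x:
  assumes "periodic g" "continuous_on UNIV g"
  shows "moderate T (\<lambda>t. g)"
proof -
  obtain B where "\<forall>x. \<bar>g x\<bar> \<le> B" using periodic_bounded[OF assms] by blast
  then show ?thesis
    using assms(1) by (intro moderateI[where C = B and m = 0] cyl_continuous_x assms(2)) (auto simp: periodic_def)
qed

section \<open>Rules for the two derivative relations\<close>

lemma x_deriv_const: "x_deriv T (\<lambda>t x. c t) (\<lambda>t x. 0)"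
  by (simp add: x_deriv_def)

lemma t_deriv_const: "t_deriv T (\<lambda>t x. c x) (\<lambda>t x. 0)"
  by (simp add: t_deriv_def)

lemma x_deriv_mult:
  "x_deriv T F F' \<Longrightarrow> x_deriv T G G' \<Longrightarrow>
    x_deriv T (\<lambda>t x. F t x * G t x) (\<lambda>t x. F' t x * G t x + F t x * G' t x)"
  unfolding x_deriv_def by (auto intro!: DERIV_cong[OF DERIV_mult])

lemma t_deriv_mult:
  "t_deriv T F F' \<Longrightarrow> t_deriv T G G' \<Longrightarrow>
    t_deriv T (\<lambda>t x. F t x * G t x) (\<lambda>t x. F' t x * G t x + F t x * G' t x)"
  unfolding t_deriv_def by (auto intro!: DERIV_cong[OF DERIV_mult])

lemma x_deriv_add:
  "x_deriv T F F' \<Longrightarrow> x_deriv T G G' \<Longrightarrow> x_deriv T (\<lambda>t x. F t x + G t x) (\<lambda>t x. F' t x + G' t x)"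
  unfolding x_deriv_def by (auto intro!: DERIV_add)

lemma t_deriv_add:
  "t_deriv T F F' \<Longrightarrow> t_deriv T G G' \<Longrightarrow> t_deriv T (\<lambda>t x. F t x + G t x) (\<lambda>t x. F' t x + G' t x)"
  unfolding t_deriv_def by (auto intro!: DERIV_add)

lemma x_deriv_diff:
  "x_deriv T F F' \<Longrightarrow> x_deriv T G G' \<Longrightarrow> x_deriv T (\<lambda>t x. F t x - G t x) (\<lambda>t x. F' t x - G' t x)"
  unfolding x_deriv_def by (auto intro!: DERIV_diff)

lemma t_deriv_diff:
  "t_deriv T F F' \<Longrightarrow> t_deriv T G G' \<Longrightarrow> t_deriv T (\<lambda>t x. F t x - G t x) (\<lambda>t x. F' t x - G' t x)"
  unfolding t_deriv_def by (auto intro!: DERIV_diff)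

lemma x_deriv_power:
  "x_deriv T F F' \<Longrightarrow> x_deriv T (\<lambda>t x. F t x ^ n) (\<lambda>t x. of_nat n * F t x ^ (n - 1) * F' t x)"
  unfolding x_deriv_def by (auto intro!: DERIV_cong[OF DERIV_power])

lemma t_deriv_power:
  "t_deriv T F F' \<Longrightarrow> t_deriv T (\<lambda>t x. F t x ^ n) (\<lambda>t x. of_nat n * F t x ^ (n - 1) * F' t x)"
  unfolding t_deriv_def by (auto intro!: DERIV_cong[OF DERIV_power])

lemma x_deriv_x: "(\<And>x. (g has_real_derivative g' x) (at x)) \<Longrightarrow> x_deriv T (\<lambda>t. g) (\<lambda>t. g')"
  by (simp add: x_deriv_def)

lemma x_deriv_cong:
  "x_deriv T F F' \<Longrightarrow> (\<And>t x. 0 < t \<Longrightarrow> t < T \<Longrightarrow> F' t x = G' t x) \<Longrightarrow> x_deriv T F G'"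
  by (simp add: x_deriv_def)

lemma t_deriv_cong:
  "t_deriv T F F' \<Longrightarrow> (\<And>t x. 0 < t \<Longrightarrow> t < T \<Longrightarrow> F' t x = G' t x) \<Longrightarrow> t_deriv T F G'"
  by (simp add: t_deriv_def)

text \<open>Data attached to \<psi> alone, independent of all parameters. The cutoff q is the
  positive part of a smooth function whose derivative is q'; q itself may have corners, so
  \<open>q_deriv\<close> speaks of powers n \<ge> 2 only. In \<open>p1_lower\<close> the factor 256
  is 2^8: where q \<ge> 1/2 the left side is at most 0, and elsewhere (p1)^2 is bounded below by
  \<delta>.\<close>

locale spatial_cutoff =
  fixes K \<delta> :: real and p1 p2 p3 q q' :: "real \<Rightarrow> real"
  assumes K1: "1 \<le> K"
    and p_cont: "continuous_on UNIV p1" "continuous_on UNIV p2" "continuous_on UNIV p3"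
    and p_per: "periodic p1" "periodic p2" "periodic p3"
    and p_deriv: "\<And>x. (p1 has_real_derivative p2 x) (at x)" "\<And>x. (p2 has_real_derivative p3 x) (at x)"
    and p_le: "\<And>x. \<bar>p1 x\<bar> \<le> K" "\<And>x. \<bar>p2 x\<bar> \<le> K" "\<And>x. \<bar>p3 x\<bar> \<le> K"
    and q01: "\<And>x. 0 \<le> q x" "\<And>x. q x \<le> 1"
    and q_cont: "continuous_on UNIV q" "continuous_on UNIV q'"
    and q_per: "periodic q" "periodic q'"
    and q_deriv: "\<And>n x. 2 \<le> n \<Longrightarrow> ((\<lambda>y. q y ^ n) has_real_derivative of_nat n * q x ^ (n - 1) * q' x) (at x)"
    and q'_le: "\<And>x. \<bar>q' x\<bar> \<le> K"
    and delta: "0 < \<delta>" "\<delta> \<le> 1"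
    and p1_lower: "\<And>x. \<delta> * (1 - 256 * q x ^ 8) \<le> (p1 x)\<^sup>2"

text \<open>
  Here \<open>e = exp (2 s \<phi>)\<close>, \<open>N = s \<xi>\<close>, \<open>\<rho> = s \<partial>\<^sub>t \<phi>\<close>, \<open>\<rho>' = s \<partial>\<^sub>t\<^sup>2 \<phi>\<close> and \<open>\<tau> = \<partial>\<^sub>t \<xi> / \<xi>\<close>; the functions
  \<open>p1\<close>, \<open>p2\<close>, \<open>p3\<close> are the derivatives of \<open>\<psi>\<close>. The small parameter \<open>\<epsilon>\<close> replaces the largeness of
  \<open>\<mu>\<close> and \<open>s\<close>; one time derivative of a weight costs two powers of \<open>N\<close>.
\<close>
locale carleman_weight = spatial_cutoff K \<delta> p1 p2 p3 q q'
  for K \<delta> :: real and p1 p2 p3 q q' :: "real \<Rightarrow> real" +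
  fixes T \<mu> \<epsilon> :: real
    and e N \<tau> \<rho> \<rho>' :: "real \<Rightarrow> real \<Rightarrow> real"
  assumes T_pos: "0 < T"
    and eps: "0 < \<epsilon>" "\<epsilon> \<le> 1" and mu: "1 \<le> \<epsilon> * \<mu>" "0 < \<mu>"
    and eps_small: "10 * K ^ 3 * \<epsilon> \<le> \<delta> ^ 2"
    and e_pos: "\<And>t x. 0 < t \<Longrightarrow> t < T \<Longrightarrow> 0 < e t x"
    and e_cont: "cyl_continuous T e"
    and e_per: "\<And>t x. 0 < t \<Longrightarrow> t < T \<Longrightarrow> e t (x + 2 * pi) = e t x"
    and e_decay: "\<And>m. \<exists>C. \<forall>t\<in>{0<..<T}. \<forall>x. e t x * (1 + 1 / ell T t) ^ m \<le> C"
    and N_ge: "\<And>t x. 0 < t \<Longrightarrow> t < T \<Longrightarrow> 1 \<le> \<epsilon> * N t x" and N_pos: "\<And>t x. 0 < t \<Longrightarrow> t < T \<Longrightarrow> 0 < N t x"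
    and N_mod: "moderate T N"
    and tau_cont: "cyl_continuous T \<tau>"
    and tau_per: "\<And>t x. 0 < t \<Longrightarrow> t < T \<Longrightarrow> \<tau> t (x + 2 * pi) = \<tau> t x"
    and tau_le: "\<And>t x. 0 < t \<Longrightarrow> t < T \<Longrightarrow> \<bar>\<tau> t x\<bar> \<le> \<epsilon> * N t x"
    and rho_cont: "cyl_continuous T \<rho>" "cyl_continuous T \<rho>'"
    and rho_per: "\<And>t x. 0 < t \<Longrightarrow> t < T \<Longrightarrow> \<rho> t (x + 2 * pi) = \<rho> t x"
      "\<And>t x. 0 < t \<Longrightarrow> t < T \<Longrightarrow> \<rho>' t (x + 2 * pi) = \<rho>' t x"
    and rho_le: "\<And>t x. 0 < t \<Longrightarrow> t < T \<Longrightarrow> \<bar>\<rho> t x\<bar> \<le> \<epsilon> * N t x ^ 2"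
      "\<And>t x. 0 < t \<Longrightarrow> t < T \<Longrightarrow> \<bar>\<rho>' t x\<bar> \<le> \<epsilon> * N t x ^ 3"
    and e_x: "x_deriv T e (\<lambda>t x. 2 * (\<mu> * p1 x * N t x) * e t x)"
    and e_t: "t_deriv T e (\<lambda>t x. 2 * \<rho> t x * e t x)"
    and N_x: "x_deriv T N (\<lambda>t x. \<mu> * p1 x * N t x)"
    and N_t: "t_deriv T N (\<lambda>t x. \<tau> t x * N t x)"
    and rho_t: "t_deriv T \<rho> \<rho>'"
    and rho_x: "x_deriv T \<rho> (\<lambda>t x. \<mu> * p1 x * \<tau> t x * N t x)"
begin

section \<open>Growth of the weights, and the integral against e\<close>

lemma p_moderate: "moderate T (\<lambda>t. p1)" "moderate T (\<lambda>t. p2)" "moderate T (\<lambda>t. p3)"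
  "moderate T (\<lambda>t. q)" "moderate T (\<lambda>t. q')"
  by (intro moderate_x p_cont p_per q_cont q_per)+

lemma mu_ge1: "1 \<le> \<mu>"
proof -
  have "\<epsilon> * \<mu> \<le> 1 * \<mu>" using mu eps by (intro mult_right_mono) auto
  then show ?thesis using mu by linarith
qed

lemma N_ge1: "0 < t \<Longrightarrow> t < T \<Longrightarrow> 1 \<le> N t x"
proof -
  assume t: "0 < t" "t < T"
  have "\<epsilon> * N t x \<le> 1 * N t x" using N_pos[OF t, of x] eps by (intro mult_right_mono) auto
  then show ?thesis using N_ge[OF t, of x] by simp
qed

lemma tau_mod: "moderate T \<tau>"
proof (rule moderate_dominated[OF tau_cont])
  show "\<bar>\<tau> t x\<bar> \<le> \<bar>\<epsilon> * N t x\<bar>" if "0 < t" "t < T" for t x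
    by (rule order_trans[OF tau_le[OF that] abs_ge_self])
  show "moderate T (\<lambda>t x. \<epsilon> * N t x)" by (intro moderate_intros N_mod)
qed (rule tau_per)

lemma rho_mod: "moderate T \<rho>"
proof (rule moderate_dominated[OF rho_cont(1)])
  show "\<bar>\<rho> t x\<bar> \<le> \<bar>\<epsilon> * N t x ^ 2\<bar>" if "0 < t" "t < T" for t x
    by (rule order_trans[OF rho_le(1)[OF that] abs_ge_self])
  show "moderate T (\<lambda>t x. \<epsilon> * N t x ^ 2)" by (intro moderate_intros N_mod)
qed (rule rho_per(1))

lemma rho'_mod: "moderate T \<rho>'"
proof (rule moderate_dominated[OF rho_cont(2)])
  show "\<bar>\<rho>' t x\<bar> \<le> \<bar>\<epsilon> * N t x ^ 3\<bar>" if "0 < t" "t < T" for t x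
    by (rule order_trans[OF rho_le(2)[OF that] abs_ge_self])
  show "moderate T (\<lambda>t x. \<epsilon> * N t x ^ 3)" by (intro moderate_intros N_mod)
qed (rule rho_per(2))

text \<open>Moderate growth is not preserved by division in general; here N \<ge> 1 bounds the
  reciprocal by 1.\<close>

lemma moderate_divide_N:
  assumes "moderate T F" shows "moderate T (\<lambda>t x. F t x / N t x)"
proof -
  have "moderate T (\<lambda>t x. 1 / N t x)"
  proof (rule moderate_dominated[where G = "\<lambda>t x. 1"])
    have "continuous_on ({0<..<T} \<times> UNIV) (\<lambda>p. N (fst p) (snd p))"
      using N_mod unfolding moderate_def cyl_continuous_def by blast
    moreover have "\<forall>p\<in>{0<..<T} \<times> UNIV. N (fst p) (snd p) \<noteq> 0"
    proof
      fix p :: "real \<times> real" assume "p \<in> {0<..<T} \<times> UNIV"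
      then have "0 < N (fst p) (snd p)" by (intro N_pos) auto
      then show "N (fst p) (snd p) \<noteq> 0" by simp
    qed
    ultimately show "cyl_continuous T (\<lambda>t x. 1 / N t x)"
      unfolding cyl_continuous_def by (rule continuous_on_divide[OF continuous_on_const])
    show "1 / N t (x + 2 * pi) = 1 / N t x" if "0 < t" "t < T" for t x
      using N_mod that by (simp add: moderate_def)
    show "\<bar>1 / N t x\<bar> \<le> \<bar>1\<bar>" if "0 < t" "t < T" for t x
      using N_ge1[OF that, of x] by simp
  qed (rule moderate_const)
  from moderate_mult[OF assms this] show ?thesis by simp
qed

lemmas weight_intros = moderate_intros moderate_divide_N N_mod tau_mod rho_mod rho'_mod p_moderate

lemma e_moderate_cont: "moderate T F \<Longrightarrow> cyl_continuous T (\<lambda>t x. e t x * F t x)"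
  using e_cont unfolding moderate_def cyl_continuous_def by (auto intro!: continuous_on_mult)

text \<open>One spare power of 1 + 1 / ell in \<open>e_decay\<close> yields both bounds at once: the
  summand 1 gives boundedness, hence integrability, and the summand 1 / ell gives the factor
  \<open>ell T t\<close> that removes boundary terms in time.\<close>

lemma e_moderate_decay:
  assumes "moderate T F"
  shows "\<exists>C. \<forall>t x. 0 < t \<longrightarrow> t < T \<longrightarrow> \<bar>e t x * F t x\<bar> \<le> C \<and> \<bar>e t x * F t x\<bar> \<le> C * ell T t"
proof -
  obtain C m where "0 \<le> C" "\<forall>t x. 0 < t \<longrightarrow> t < T \<longrightarrow> \<bar>F t x\<bar> \<le> C * (1 + 1 / ell T t) ^ m"
    using moderate_bound[OF assms] by blast
  note C = this(1) this(2)[rule_format]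
  obtain D where D: "\<forall>t\<in>{0<..<T}. \<forall>x. e t x * (1 + 1 / ell T t) ^ Suc m \<le> D"
    using e_decay[of "Suc m"] by blast
  have *: "\<bar>e t x * F t x\<bar> * (1 + 1 / ell T t) \<le> C * D" if t: "0 < t" "t < T" for t x
  proof -
    let ?w = "1 + 1 / ell T t"
    have "\<bar>e t x * F t x\<bar> * ?w = e t x * \<bar>F t x\<bar> * ?w"
      using e_pos[OF t, of x] by (simp add: abs_mult)
    also have "\<dots> \<le> e t x * (C * ?w ^ m) * ?w"
      using C(2)[OF t, of x] e_pos[OF t, of x] ell_pos[OF t]
      by (intro mult_right_mono mult_left_mono) auto
    also have "\<dots> = C * (e t x * ?w ^ Suc m)" by simp
    also have "\<dots> \<le> C * D" using D t C(1) by (intro mult_left_mono) auto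
    finally show ?thesis .
  qed
  show ?thesis
  proof (intro exI[of _ "C * D"] allI impI)
    fix t x assume t: "0 < t" "t < T"
    have l: "0 < ell T t" using ell_pos[OF t] .
    have "0 \<le> \<bar>e t x * F t x\<bar>" "0 \<le> \<bar>e t x * F t x\<bar> / ell T t" using l by auto
    moreover have "\<bar>e t x * F t x\<bar> + \<bar>e t x * F t x\<bar> / ell T t \<le> C * D"
      using *[OF t, of x] by (simp add: algebra_simps)
    ultimately have 1: "\<bar>e t x * F t x\<bar> \<le> C * D" and 2: "\<bar>e t x * F t x\<bar> / ell T t \<le> C * D" by linarith+
    show "\<bar>e t x * F t x\<bar> \<le> C * D \<and> \<bar>e t x * F t x\<bar> \<le> C * D * ell T t"
      using 1 2 l by (simp add: pos_divide_le_eq)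
  qed
qed

definition I :: "(real \<Rightarrow> real \<Rightarrow> real) \<Rightarrow> real" where
  "I F = cyl_integral T UNIV (\<lambda>t x. e t x * F t x)"

lemma I_integrable:
  assumes "moderate T F" "A \<in> sets borel"
  shows "set_integrable lborel ({0<..<T} \<times> (A \<inter> torus_fund)) (\<lambda>(t, x). e t x * F t x)"
proof -
  obtain C where "\<forall>t x. 0 < t \<longrightarrow> t < T \<longrightarrow> \<bar>e t x * F t x\<bar> \<le> C"
    using e_moderate_decay[OF assms(1)] by blast
  note C = this[rule_format]
  from cyl_set_integrable[OF e_moderate_cont[OF assms(1)] C assms(2)] show ?thesis .
qed

lemma I_integrable':
  "moderate T F \<Longrightarrow> set_integrable lborel ({0<..<T} \<times> torus_fund) (\<lambda>p. e (fst p) (snd p) * F (fst p) (snd p))"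
  using I_integrable[of F UNIV] by (simp add: case_prod_unfold)

lemma I_eq: "I F = set_lebesgue_integral lborel ({0<..<T} \<times> torus_fund) (\<lambda>p. e (fst p) (snd p) * F (fst p) (snd p))"
  by (simp add: I_def cyl_integral_def case_prod_unfold)

lemma I_add: "moderate T F \<Longrightarrow> moderate T G \<Longrightarrow> I (\<lambda>t x. F t x + G t x) = I F + I G"
  unfolding I_eq by (simp add: distrib_left I_integrable')

lemma I_diff: "moderate T F \<Longrightarrow> moderate T G \<Longrightarrow> I (\<lambda>t x. F t x - G t x) = I F - I G"
  unfolding I_eq by (simp add: right_diff_distrib I_integrable')

lemma I_cmult: "I (\<lambda>t x. c * F t x) = c * I F"
  unfolding I_eq by (simp add: mult.left_commute)

lemma I_cong: "(\<And>t x. 0 < t \<Longrightarrow> t < T \<Longrightarrow> F t x = G t x) \<Longrightarrow> I F = I G"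
  unfolding I_eq set_lebesgue_integral_def
  by (rule Bochner_Integration.integral_cong) (auto simp: indicator_def)

lemma I_mono:
  assumes "moderate T F" "moderate T G" "\<And>t x. 0 < t \<Longrightarrow> t < T \<Longrightarrow> F t x \<le> G t x"
  shows "I F \<le> I G"
  unfolding I_eq
proof (rule set_integral_mono[OF I_integrable'[OF assms(1)] I_integrable'[OF assms(2)]])
  fix p :: "real \<times> real" assume "p \<in> {0<..<T} \<times> torus_fund"
  then have "0 < fst p" "fst p < T" by auto
  then show "e (fst p) (snd p) * F (fst p) (snd p) \<le> e (fst p) (snd p) * G (fst p) (snd p)"
    using assms(3) e_pos by (simp add: less_imp_le mult_left_mono)
qed

lemma I_nonneg:
  assumes "\<And>t x. 0 < t \<Longrightarrow> t < T \<Longrightarrow> 0 \<le> F t x"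
  shows "0 \<le> I F"
  unfolding I_eq set_lebesgue_integral_def
proof (rule Bochner_Integration.integral_nonneg)
  fix p :: "real \<times> real"
  show "0 \<le> indicat_real ({0<..<T} \<times> torus_fund) p *\<^sub>R (e (fst p) (snd p) * F (fst p) (snd p))"
    using assms[of "fst p" "snd p"] e_pos[of "fst p" "snd p"]
    by (cases "p \<in> {0<..<T} \<times> torus_fund") auto
qed

abbreviation \<theta> :: "real \<Rightarrow> real \<Rightarrow> real" where
  "\<theta> t x \<equiv> \<mu> * p1 x * N t x"

text \<open>The logarithmic x-derivative of e is 2 \<theta>, so the integrand times e is the
  derivative of e * F. The extra term 2 \<theta> F is what makes an integration by parts gain a
  factor \<mu> N.\<close>

lemma I_x_deriv:
  assumes F: "moderate T F" "moderate T F'" "x_deriv T F F'"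
  shows "I (\<lambda>t x. F' t x + 2 * \<theta> t x * F t x) = 0"
proof -
  have m: "moderate T (\<lambda>t x. F' t x + 2 * \<theta> t x * F t x)"
    using F(1,2) by (intro weight_intros)
  obtain B where "\<forall>t x. 0 < t \<longrightarrow> t < T \<longrightarrow> \<bar>e t x * (F' t x + 2 * \<theta> t x * F t x)\<bar> \<le> B"
    using e_moderate_decay[OF m] by blast
  note B = this[rule_format]
  show ?thesis unfolding I_def
  proof (rule cyl_integral_x_deriv[OF e_moderate_cont[OF m] B])
    show "x_deriv T (\<lambda>t x. e t x * F t x) (\<lambda>t x. e t x * (F' t x + 2 * \<theta> t x * F t x))"
      by (rule x_deriv_cong[OF x_deriv_mult[OF e_x F(3)]]) (simp add: algebra_simps)
    show "e t (x + 2 * pi) * F t (x + 2 * pi) = e t x * F t x" if "0 < t" "t < T" for t x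
      using e_per[OF that] F(1) that by (simp add: moderate_def)
  qed
qed

text \<open>In time the logarithmic derivative of e is 2 \<rho>, and the decay of e replaces
  periodicity.\<close>

lemma I_t_deriv:
  assumes F: "moderate T F" "moderate T F'" "t_deriv T F F'"
  shows "I (\<lambda>t x. F' t x + 2 * \<rho> t x * F t x) = 0"
proof -
  have m: "moderate T (\<lambda>t x. F' t x + 2 * \<rho> t x * F t x)"
    using F(1,2) by (intro weight_intros)
  obtain B where "\<forall>t x. 0 < t \<longrightarrow> t < T \<longrightarrow> \<bar>e t x * (F' t x + 2 * \<rho> t x * F t x)\<bar> \<le> B"
    using e_moderate_decay[OF m] by blast
  note B = this[rule_format]
  obtain D where "\<forall>t x. 0 < t \<longrightarrow> t < T \<longrightarrow> \<bar>e t x * F t x\<bar> \<le> D * ell T t"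
    using e_moderate_decay[OF F(1)] by blast
  note D = this[rule_format]
  show ?thesis unfolding I_def
  proof (rule cyl_integral_t_deriv[OF T_pos e_moderate_cont[OF m] B _ D])
    show "t_deriv T (\<lambda>t x. e t x * F t x) (\<lambda>t x. e t x * (F' t x + 2 * \<rho> t x * F t x))"
      by (rule t_deriv_cong[OF t_deriv_mult[OF e_t F(3)]]) (simp add: algebra_simps)
  qed
qed

end

section \<open>Interpolation inequalities\<close>

lemma weighted_am_gm:
  fixes a b \<eta> :: real
  assumes "0 < \<eta>"
  shows "\<bar>a * b\<bar> \<le> \<eta> * a\<^sup>2 + b\<^sup>2 / (4 * \<eta>)"
proof -
  have "0 \<le> (2 * \<eta> * \<bar>a\<bar> - \<bar>b\<bar>)\<^sup>2" by simp
  then have "4 * \<eta> * \<bar>a * b\<bar> \<le> 4 * \<eta> * (\<eta> * a\<^sup>2) + b\<^sup>2"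
    by (simp add: power2_diff power_mult_distrib abs_mult power2_eq_square algebra_simps)
  then have "\<bar>a * b\<bar> \<le> (4 * \<eta> * (\<eta> * a\<^sup>2) + b\<^sup>2) / (4 * \<eta>)"
    using assms by (simp add: pos_le_divide_eq mult.commute)
  also have "\<dots> = \<eta> * a\<^sup>2 + b\<^sup>2 / (4 * \<eta>)"
    using assms by (simp add: field_simps)
  finally show ?thesis .
qed

context carleman_weight
begin

text \<open>This is how integrations by parts are used for the inequalities below: an exact
  derivative Z is added to the right side for free, and the integral inequality becomes pointwise
  algebra.\<close>

lemma I_le_if_null:
  assumes "moderate T F" "moderate T G" "moderate T Z" "I Z = 0"
    and "\<And>t x. 0 < t \<Longrightarrow> t < T \<Longrightarrow> F t x \<le> G t x + Z t x"
  shows "I F \<le> I G"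
proof -
  have "I F \<le> I (\<lambda>t x. G t x + Z t x)"
    by (rule I_mono) (use assms in \<open>auto intro!: moderate_add\<close>)
  then show ?thesis using I_add[OF assms(2,3)] assms(4) by simp
qed

lemma q_le_power: "n \<le> m \<Longrightarrow> q x ^ m \<le> q x ^ n"
  using q01 by (simp add: power_decreasing)

lemma K_eps: "K * \<epsilon> \<le> \<delta> / 2"
proof -
  have "K * 1 \<le> K * K ^ 2" using K1 by (intro mult_left_mono) auto
  then have "K * \<epsilon> \<le> K ^ 3 * \<epsilon>" using eps by (intro mult_right_mono) (auto simp: power3_eq_cube power2_eq_square)
  moreover have "\<delta> ^ 2 \<le> \<delta>" using delta by (simp add: power2_eq_square mult_left_le)
  ultimately show ?thesis using eps_small delta by linarith
qed

text \<open>The exact derivative of e p1 (\<mu> N) g^2, with additional weights, contains 2 (p1)^2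
  (\<mu> N)^2 g^2, coming from the derivative of e. Where the cutoff is small this is at least 2
  \<delta> (\<mu> N)^2 g^2 and dominates; where it is not, the term with q^n compensates.\<close>

lemma weighted_poincare:
  assumes g: "moderate T g" "moderate T g1" "x_deriv T g g1" and n: "n \<le> 8"
  shows "\<delta> ^ 2 * I (\<lambda>t x. \<mu> ^ (k + 2) * N t x ^ (l + 2) * g t x ^ 2)
    \<le> 2 * K ^ 2 * I (\<lambda>t x. \<mu> ^ k * N t x ^ l * g1 t x ^ 2)
      + 512 * I (\<lambda>t x. q x ^ n * (\<mu> ^ (k + 2) * N t x ^ (l + 2) * g t x ^ 2))"
proof -
  let ?c = "\<lambda>t x. p1 x * \<mu> ^ (k + 1) * N t x ^ (l + 1)"
  let ?c' = "\<lambda>t x. p2 x * \<mu> ^ (k + 1) * N t x ^ (l + 1) + p1 x * \<mu> ^ (k + 1) * (real (l + 1) * N t x ^ l * (\<mu> * p1 x * N t x))"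
  let ?F = "\<lambda>t x. ?c t x * (g t x * g t x)"
  let ?F' = "\<lambda>t x. ?c' t x * (g t x * g t x) + ?c t x * (g1 t x * g t x + g t x * g1 t x)"
  let ?Z = "\<lambda>t x. ?F' t x + 2 * \<theta> t x * ?F t x"
  have cd: "x_deriv T ?c ?c'"
    by (rule x_deriv_cong[OF x_deriv_mult[OF x_deriv_mult[OF x_deriv_x[OF p_deriv(1)] x_deriv_const] x_deriv_power[OF N_x]]])
      (simp add: algebra_simps)
  have "x_deriv T ?F ?F'"
    by (rule x_deriv_mult[OF cd x_deriv_mult[OF g(3) g(3)]])
  moreover have m: "moderate T ?F" "moderate T ?F'" by (intro weight_intros g(1,2))+
  ultimately have Z0: "I ?Z = 0" by (intro I_x_deriv)
  \<comment> \<open>The factor \<delta> clears the 1 / \<delta> that Young's inequality produces in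
    \<open>i3\<close>.\<close>
  have mZ: "moderate T (\<lambda>t x. \<delta> * ?Z t x)" by (intro weight_intros g(1,2))
  let ?w1 = "\<lambda>t x. \<mu> ^ k * N t x ^ l * g1 t x ^ 2"
  let ?w2 = "\<lambda>t x. \<mu> ^ (k + 2) * N t x ^ (l + 2) * g t x ^ 2"
  have "I (\<lambda>t x. \<delta> ^ 2 * ?w2 t x) \<le> I (\<lambda>t x. 2 * K ^ 2 * ?w1 t x + 512 * (q x ^ n * ?w2 t x))"
  proof (rule I_le_if_null[OF _ _ mZ])
    show "I (\<lambda>t x. \<delta> * ?Z t x) = 0" unfolding I_cmult Z0 by simp
    fix t x assume t: "0 < t" "t < T"
    note b = mu_ge1 N_ge1[OF t, of x] eps mu N_ge[OF t, of x] K1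
    define M where "M = \<mu> ^ k * N t x ^ l"
    define G where "G = g t x" define G1 where "G1 = g1 t x"
    define w where "w = \<mu> * N t x"
    have M: "0 \<le> M" using b by (simp add: M_def)
    have w: "1 \<le> \<epsilon> * w" "1 \<le> w"
    proof -
      have "1 * 1 \<le> \<mu> * (\<epsilon> * N t x)" using b by (intro mult_mono) auto
      then show "1 \<le> \<epsilon> * w" by (simp add: w_def algebra_simps)
      have "1 * 1 \<le> \<mu> * N t x" using b by (intro mult_mono) auto
      then show "1 \<le> w" by (simp add: w_def)
    qed
    have w2: "?w2 t x = M * (w ^ 2 * G ^ 2)" by (simp add: M_def w_def G_def power_mult_distrib power_add power2_eq_square algebra_simps)
    have w1: "?w1 t x = M * G1 ^ 2" by (simp add: M_def G1_def)
    have Z: "?Z t x = M * (p2 x * w * G ^ 2 + real (l + 1) * \<mu> * p1 x ^ 2 * w * G ^ 2 + 2 * p1 x * w * G * G1 + 2 * p1 x ^ 2 * w ^ 2 * G ^ 2)"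
      by (simp add: M_def w_def G_def G1_def power2_eq_square power_add algebra_simps)
    have i1: "- (\<delta> / 2) * (w ^ 2 * G ^ 2) \<le> p2 x * w * G ^ 2"
    proof -
      have "- p2 x * w \<le> K * w" using p_le(2)[of x] w by (intro mult_right_mono) auto
      also have "\<dots> \<le> K * w * (\<epsilon> * w)" using w K1 mult_left_mono[of 1 "\<epsilon> * w" "K * w"] by simp
      also have "\<dots> = (K * \<epsilon>) * w ^ 2" by (simp add: power2_eq_square)
      also have "\<dots> \<le> \<delta> / 2 * w ^ 2" using K_eps by (intro mult_right_mono) auto
      finally have "- p2 x * w * G ^ 2 \<le> \<delta> / 2 * w ^ 2 * G ^ 2" by (intro mult_right_mono) auto
      then show ?thesis by (simp add: mult.assoc)
    qed
    have i2: "0 \<le> real (l + 1) * \<mu> * p1 x ^ 2 * w * G ^ 2" using b w by (intro mult_nonneg_nonneg) auto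
    have i3: "- (\<delta> / 2 * (w ^ 2 * G ^ 2) + 2 * K ^ 2 / \<delta> * G1 ^ 2) \<le> 2 * p1 x * w * G * G1"
    proof -
      have "\<bar>(w * G) * (2 * p1 x * G1)\<bar> \<le> \<delta> / 2 * (w * G) ^ 2 + (2 * p1 x * G1) ^ 2 / (4 * (\<delta> / 2))"
        using delta by (intro weighted_am_gm) auto
      also have "(2 * p1 x * G1) ^ 2 / (4 * (\<delta> / 2)) = 2 * G1 ^ 2 / \<delta> * \<bar>p1 x\<bar> ^ 2"
        using delta by (simp add: power_mult_distrib field_simps)
      also have "\<dots> \<le> 2 * G1 ^ 2 / \<delta> * K ^ 2"
        using delta p_le(1)[of x] by (intro mult_left_mono power_mono) auto
      finally show ?thesis by (simp add: abs_le_iff power_mult_distrib mult.assoc mult.commute mult.left_commute)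
    qed
    have i4: "2 * \<delta> * (w ^ 2 * G ^ 2) - 512 * (q x ^ n * (w ^ 2 * G ^ 2)) \<le> 2 * p1 x ^ 2 * w ^ 2 * G ^ 2"
    proof -
      have "\<delta> * q x ^ 8 \<le> 1 * q x ^ n" using delta q_le_power[OF n, of x] q01 by (intro mult_mono) auto
      then have "\<delta> - 256 * q x ^ n \<le> p1 x ^ 2" using p1_lower[of x] by (simp add: algebra_simps)
      then have "(\<delta> - 256 * q x ^ n) * (2 * (w ^ 2 * G ^ 2)) \<le> p1 x ^ 2 * (2 * (w ^ 2 * G ^ 2))"
        by (intro mult_right_mono) auto
      then show ?thesis by (simp add: algebra_simps)
    qed
    \<comment> \<open>Of the 2 \<delta> supplied by \<open>i4\<close>, the terms \<open>i1\<close>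
      and \<open>i3\<close> consume \<delta> / 2 each.\<close>
    have "\<delta> * (w ^ 2 * G ^ 2) \<le> 2 * K ^ 2 / \<delta> * G1 ^ 2 + 512 * (q x ^ n * (w ^ 2 * G ^ 2))
        + (p2 x * w * G ^ 2 + real (l + 1) * \<mu> * p1 x ^ 2 * w * G ^ 2 + 2 * p1 x * w * G * G1 + 2 * p1 x ^ 2 * w ^ 2 * G ^ 2)"
(is "_ \<le> ?r1 + 512 * ?r2 + ?r3")
      using i1 i2 i3 i4 by linarith
    then have "\<delta> * M * (\<delta> * (w ^ 2 * G ^ 2)) \<le> \<delta> * M * (?r1 + 512 * ?r2 + ?r3)"
      using delta M by (intro mult_left_mono) auto
    also have "\<dots> = M * (\<delta> * ?r1) + \<delta> * (512 * (M * ?r2)) + \<delta> * (M * ?r3)"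
      by (simp add: algebra_simps)
    also have "\<delta> * ?r1 = 2 * K ^ 2 * G1 ^ 2" using delta by simp
    also have "\<delta> * (512 * (M * ?r2)) \<le> 1 * (512 * (M * ?r2))"
      using delta M q01 by (intro mult_right_mono) auto
    finally show "\<delta> ^ 2 * ?w2 t x \<le> 2 * K ^ 2 * ?w1 t x + 512 * (q x ^ n * ?w2 t x) + \<delta> * ?Z t x"
      unfolding w1 w2 Z by (simp add: power2_eq_square algebra_simps)
  qed (intro weight_intros g(1,2))+
  then show ?thesis
    by (simp add: I_add I_cmult weight_intros g(1,2))
qed

text \<open>Integrate the exact derivative of e q^n N^(m+1) g g1. It contains g1^2, a product g g2
  split by Young with the free parameter, and a product g g1 whose coefficient has only n - 1 powers
  of q because q^n was differentiated. Young pairs q^(n/2) g1 with q^(n/2-1) g, which is the loss of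
  two powers. The quotient by N in the g2 term lets m = 0 cover the weight 1 / N.\<close>

lemma local_interpolation:
  assumes g: "moderate T g" "moderate T g1" "moderate T g2" "x_deriv T g g1" "x_deriv T g1 g2"
    and n: "4 \<le> n" and \<eta>: "0 < \<eta>"
  shows "I (\<lambda>t x. q x ^ n * (\<mu> ^ (p + 2) * N t x ^ (m + 1) * g1 t x ^ 2))
    \<le> 2 * \<eta> * I (\<lambda>t x. \<mu> ^ p * N t x ^ m * g2 t x ^ 2 / N t x)
      + ((real (n + m + 3) * K) ^ 2 + 1 / (2 * \<eta>)) * I (\<lambda>t x. q x ^ (n - 2) * (\<mu> ^ (p + 4) * N t x ^ (m + 3) * g t x ^ 2))"
proof -
  let ?c = "\<lambda>t x. q x ^ n * \<mu> ^ (p + 2) * N t x ^ (m + 1)"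
  let ?c' = "\<lambda>t x. real n * q x ^ (n - 1) * q' x * \<mu> ^ (p + 2) * N t x ^ (m + 1)
    + q x ^ n * \<mu> ^ (p + 2) * (real (m + 1) * N t x ^ m * (\<mu> * p1 x * N t x))"
  let ?F = "\<lambda>t x. ?c t x * (g t x * g1 t x)"
  let ?F' = "\<lambda>t x. ?c' t x * (g t x * g1 t x) + ?c t x * (g1 t x * g1 t x + g t x * g2 t x)"
  let ?Z = "\<lambda>t x. ?F' t x + 2 * \<theta> t x * ?F t x"
  have "2 \<le> n" using n by simp
  have cd: "x_deriv T ?c ?c'"
    by (rule x_deriv_cong[OF x_deriv_mult[OF x_deriv_mult[OF x_deriv_x[OF q_deriv[OF \<open>2 \<le> n\<close>]] x_deriv_const] x_deriv_power[OF N_x]]])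
      (simp add: algebra_simps)
  have "x_deriv T ?F ?F'"
    by (rule x_deriv_mult[OF cd x_deriv_mult[OF g(4) g(5)]])
  moreover have "moderate T ?F" "moderate T ?F'" by (intro weight_intros g(1-3))+
  ultimately have Z0: "I ?Z = 0" by (intro I_x_deriv)
  have mZ: "moderate T (\<lambda>t x. 2 * ?Z t x)" by (intro weight_intros g(1-3))
  define L where "L = real (n + m + 3) * K"
  let ?w1 = "\<lambda>t x. q x ^ n * (\<mu> ^ (p + 2) * N t x ^ (m + 1) * g1 t x ^ 2)"
  let ?w2 = "\<lambda>t x. \<mu> ^ p * N t x ^ m * g2 t x ^ 2 / N t x"
  let ?w0 = "\<lambda>t x. q x ^ (n - 2) * (\<mu> ^ (p + 4) * N t x ^ (m + 3) * g t x ^ 2)"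
  have "I ?w1 \<le> I (\<lambda>t x. 2 * \<eta> * ?w2 t x + (L ^ 2 + 1 / (2 * \<eta>)) * ?w0 t x)"
  proof (rule I_le_if_null[OF _ _ mZ])
    show "I (\<lambda>t x. 2 * ?Z t x) = 0" unfolding I_cmult Z0 by simp
    fix t x assume t: "0 < t" "t < T"
    note b = mu_ge1 N_ge1[OF t, of x] eps mu N_ge[OF t, of x] K1
    obtain n2 where n2: "n = n2 + 2" "2 \<le> n2" using n by (metis add_le_cancel_right le_add_diff_inverse2 numeral_Bit0 \<open>2 \<le> n\<close>)
    define M where "M = \<mu> ^ p * N t x ^ m"
    define G where "G = g t x" define G1 where "G1 = g1 t x" define G2 where "G2 = g2 t x"
    define Q where "Q = q x" define R where "R = q x ^ n2"
    define y where "y = N t x"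
    have M: "0 \<le> M" using b by (simp add: M_def)
    have Q: "0 \<le> Q" "Q \<le> 1" "0 \<le> R" using q01 by (auto simp: Q_def R_def)
    have y: "1 \<le> y" using b by (simp add: y_def)
    have w0: "?w0 t x = M * (\<mu> ^ 4 * y ^ 3 * R * G ^ 2)"
      by (simp add: M_def y_def G_def R_def n2 power_add)
    have w1: "?w1 t x = M * (\<mu> ^ 2 * y * R * Q ^ 2 * G1 ^ 2)"
      by (simp add: M_def y_def G1_def Q_def R_def n2 power_add power2_eq_square)
    have w2: "?w2 t x = M * (G2 ^ 2 / y)" by (simp add: M_def y_def G2_def)
    \<comment> \<open>The three summands come from differentiating q^n, N^(m+1) and e; a common
      factor q has been kept outside. They are the n, m + 1 and 2 in the constant n + m + 3.\<close>
    define A where "A = real n * q' x + Q * \<mu> * real (m + 1) * p1 x + 2 * Q * \<mu> * p1 x * y"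
    have Z: "?Z t x = M * (\<mu> ^ 2 * y * R * (A * Q * G * G1 + Q ^ 2 * G1 ^ 2 + Q ^ 2 * G * G2))"
    proof -
      have e: "n - 1 = n2 + 1" using n2 by simp
      show ?thesis unfolding e A_def n2(1)
        by (simp add: M_def y_def G_def G1_def G2_def Q_def R_def power2_eq_square power_add algebra_simps)
    qed
    have A: "\<bar>A\<bar> \<le> L * (\<mu> * y)"
    proof -
      have k: "1 \<le> \<mu> * y" using mult_mono[of 1 \<mu> 1 y] b y by simp
      have "\<bar>real n * q' x\<bar> \<le> real n * K * (\<mu> * y)"
      proof -
        have "\<bar>real n * q' x\<bar> \<le> real n * K * 1" using q'_le[of x] by (simp add: abs_mult mult_left_mono)
        also have "\<dots> \<le> real n * K * (\<mu> * y)" using k K1 by (intro mult_left_mono) auto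
        finally show ?thesis .
      qed
      moreover have "\<bar>Q * \<mu> * real (m + 1) * p1 x\<bar> \<le> real (m + 1) * K * (\<mu> * y)"
      proof -
        have "\<bar>Q * \<mu> * real (m + 1) * p1 x\<bar> = Q * \<bar>p1 x\<bar> * (real (m + 1) * \<mu>)" using Q b by (simp add: abs_mult)
        also have "\<dots> \<le> 1 * K * (real (m + 1) * (\<mu> * y))"
          using Q p_le(1)[of x] b y by (intro mult_mono mult_left_mono) auto
        finally show ?thesis by (simp add: mult.assoc mult.left_commute)
      qed
      moreover have "\<bar>2 * Q * \<mu> * p1 x * y\<bar> \<le> 2 * K * (\<mu> * y)"
      proof -
        have "\<bar>2 * Q * \<mu> * p1 x * y\<bar> = Q * \<bar>p1 x\<bar> * (2 * (\<mu> * y))" using Q b y by (simp add: abs_mult)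
        also have "\<dots> \<le> 1 * K * (2 * (\<mu> * y))"
          using Q p_le(1)[of x] b y by (intro mult_mono mult_right_mono) auto
        finally show ?thesis by simp
      qed
      moreover have "L * (\<mu> * y) = real n * K * (\<mu> * y) + real (m + 1) * K * (\<mu> * y) + 2 * K * (\<mu> * y)"
        by (simp add: L_def algebra_simps)
      ultimately show ?thesis unfolding A_def by linarith
    qed
    \<comment> \<open>Twice Z contains 2 Q^2 G1^2; one copy is given up here and the other one is
      the quantity to be estimated.\<close>
    have i1: "- (Q ^ 2 * G1 ^ 2 + L ^ 2 * (\<mu> ^ 2 * y ^ 2) * G ^ 2) \<le> 2 * (A * Q * G * G1)"
    proof -
      have "\<bar>(Q * G1) * (2 * A * G)\<bar> \<le> 1 * (Q * G1) ^ 2 + (2 * A * G) ^ 2 / (4 * 1)"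
        by (rule weighted_am_gm) simp
      also have "(2 * A * G) ^ 2 / (4 * 1) = \<bar>A\<bar> ^ 2 * G ^ 2" by (simp add: power_mult_distrib)
      also have "\<dots> \<le> (L * (\<mu> * y)) ^ 2 * G ^ 2" using A by (intro mult_right_mono power_mono) auto
      finally show ?thesis by (simp add: abs_le_iff power_mult_distrib algebra_simps)
    qed
    have i2: "- (2 * \<eta> * (G2 ^ 2 / y) + 1 / (2 * \<eta>) * (\<mu> ^ 4 * y ^ 3 * R * G ^ 2)) \<le> \<mu> ^ 2 * y * R * (2 * (Q ^ 2 * G * G2))"
    proof -
      have "\<bar>G2 * (2 * \<mu> ^ 2 * y ^ 2 * R * Q ^ 2 * G)\<bar> \<le> (2 * \<eta>) * G2 ^ 2 + (2 * \<mu> ^ 2 * y ^ 2 * R * Q ^ 2 * G) ^ 2 / (4 * (2 * \<eta>))"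
        using \<eta> by (intro weighted_am_gm) simp
      also have "(2 * \<mu> ^ 2 * y ^ 2 * R * Q ^ 2 * G) ^ 2 / (4 * (2 * \<eta>)) = (\<mu> ^ 4 * y ^ 4 * R * G ^ 2) * (R * Q ^ 4) / (2 * \<eta>)"
        using \<eta> by (simp add: power_mult_distrib power2_eq_square[of R] field_simps flip: power_mult)
      also have "\<dots> \<le> (\<mu> ^ 4 * y ^ 4 * R * G ^ 2) * 1 / (2 * \<eta>)"
      proof -
        have "R * Q ^ 4 \<le> 1" using Q q01 by (intro mult_le_one) (auto simp: R_def intro!: power_le_one)
        then show ?thesis using \<eta> Q y by (intro divide_right_mono mult_left_mono) auto
      qed
      finally have "\<bar>G2 * (2 * \<mu> ^ 2 * y ^ 2 * R * Q ^ 2 * G)\<bar> / y \<le> (2 * \<eta> * G2 ^ 2 + (\<mu> ^ 4 * y ^ 4 * R * G ^ 2) * 1 / (2 * \<eta>)) / y"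
        using y by (intro divide_right_mono) auto
      also have "\<dots> = 2 * \<eta> * (G2 ^ 2 / y) + 1 / (2 * \<eta>) * (\<mu> ^ 4 * y ^ 3 * R * G ^ 2)"
        using y by (simp add: field_simps power_numeral_reduce)
      also have "\<bar>G2 * (2 * \<mu> ^ 2 * y ^ 2 * R * Q ^ 2 * G)\<bar> / y = \<bar>\<mu> ^ 2 * y * R * (2 * (Q ^ 2 * G * G2))\<bar>"
        using y by (simp add: abs_mult field_simps power2_eq_square)
      finally show ?thesis by linarith
    qed
    have "\<mu> ^ 2 * y * R * (- (Q ^ 2 * G1 ^ 2 + L ^ 2 * (\<mu> ^ 2 * y ^ 2) * G ^ 2)) \<le> \<mu> ^ 2 * y * R * (2 * (A * Q * G * G1))"
      using i1 Q y by (intro mult_left_mono) auto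
    with i2 have "\<mu> ^ 2 * y * R * Q ^ 2 * G1 ^ 2 \<le> 2 * \<eta> * (G2 ^ 2 / y) + (L ^ 2 + 1 / (2 * \<eta>)) * (\<mu> ^ 4 * y ^ 3 * R * G ^ 2)
      + 2 * (\<mu> ^ 2 * y * R * (A * Q * G * G1 + Q ^ 2 * G1 ^ 2 + Q ^ 2 * G * G2))" (is "?l \<le> ?r1 + ?r2 + 2 * ?r3")
      by (simp add: algebra_simps power_numeral_reduce)
    then have "M * ?l \<le> M * (?r1 + ?r2 + 2 * ?r3)" using M by (intro mult_left_mono)
    then show "?w1 t x \<le> 2 * \<eta> * ?w2 t x + (L ^ 2 + 1 / (2 * \<eta>)) * ?w0 t x + 2 * ?Z t x"
      unfolding w0 w1 w2 Z by (simp add: algebra_simps)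
  qed (intro weight_intros g(1-3))+
  then show ?thesis
    by (simp add: I_add I_cmult weight_intros g(1-3) L_def del: times_divide_eq_right)
qed

text \<open>The cutoff does not depend on time, so no power of it is lost to a derivative; q^n is
  only enlarged to q^2. The logarithmic derivatives of the weights are of order N^2, which is why a
  single step in time covers four powers of N.\<close>

lemma local_interpolation_t:
  assumes g: "moderate T g" "moderate T g1" "moderate T g2" "t_deriv T g g1" "t_deriv T g1 g2"
    and n: "2 \<le> n" and \<eta>: "0 < \<eta>"
  shows "I (\<lambda>t x. q x ^ n * (\<mu> ^ 4 * N t x ^ 3 * g1 t x ^ 2))
    \<le> 2 * \<eta> * I (\<lambda>t x. g2 t x ^ 2 / N t x)
      + (25 + 1 / (2 * \<eta>)) * I (\<lambda>t x. q x ^ 2 * (\<mu> ^ 8 * N t x ^ 7 * g t x ^ 2))"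
proof -
  let ?c = "\<lambda>t x. q x ^ n * \<mu> ^ 4 * N t x ^ 3"
  let ?c' = "\<lambda>t x. 3 * \<tau> t x * (q x ^ n * \<mu> ^ 4 * N t x ^ 3)"
  let ?F = "\<lambda>t x. ?c t x * (g t x * g1 t x)"
  let ?F' = "\<lambda>t x. ?c' t x * (g t x * g1 t x) + ?c t x * (g1 t x * g1 t x + g t x * g2 t x)"
  let ?Z = "\<lambda>t x. ?F' t x + 2 * \<rho> t x * ?F t x"
  have cd: "t_deriv T ?c ?c'"
    by (rule t_deriv_cong[OF t_deriv_mult[OF t_deriv_const t_deriv_power[OF N_t]]])
      (simp add: algebra_simps power2_eq_square power3_eq_cube)
  have "t_deriv T ?F ?F'"
    by (rule t_deriv_mult[OF cd t_deriv_mult[OF g(4) g(5)]])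
  moreover have "moderate T ?F" "moderate T ?F'" by (intro weight_intros g(1-3))+
  ultimately have Z0: "I ?Z = 0" by (intro I_t_deriv)
  have mZ: "moderate T (\<lambda>t x. 2 * ?Z t x)" by (intro weight_intros g(1-3))
  let ?w1 = "\<lambda>t x. q x ^ n * (\<mu> ^ 4 * N t x ^ 3 * g1 t x ^ 2)"
  let ?w2 = "\<lambda>t x. g2 t x ^ 2 / N t x"
  let ?w0 = "\<lambda>t x. q x ^ 2 * (\<mu> ^ 8 * N t x ^ 7 * g t x ^ 2)"
  have "I ?w1 \<le> I (\<lambda>t x. 2 * \<eta> * ?w2 t x + (25 + 1 / (2 * \<eta>)) * ?w0 t x)"
  proof (rule I_le_if_null[OF _ _ mZ])
    show "I (\<lambda>t x. 2 * ?Z t x) = 0" unfolding I_cmult Z0 by simp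
    fix t x assume t: "0 < t" "t < T"
    note b = mu_ge1 N_ge1[OF t, of x] eps
    define G where "G = g t x" define G1 where "G1 = g1 t x" define G2 where "G2 = g2 t x"
    define R where "R = q x ^ n"
    define y where "y = N t x"
    \<comment> \<open>Logarithmic time derivatives of N^3 and e. Their bound 5 N^2 is the origin of
      the constant 25.\<close>
    define A where "A = 3 * \<tau> t x + 2 * \<rho> t x"
    have R: "0 \<le> R" "R \<le> q x ^ 2" "R \<le> 1"
      using q01[of x] q_le_power[OF n, of x] by (auto simp: R_def power_le_one)
    have y: "1 \<le> y" using b by (simp add: y_def)
    have A: "\<bar>A\<bar> \<le> 5 * y ^ 2"
    proof -
      have "\<bar>\<tau> t x\<bar> \<le> \<epsilon> * y" "\<bar>\<rho> t x\<bar> \<le> \<epsilon> * y ^ 2"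
        using tau_le[OF t, of x] rho_le(1)[OF t, of x] by (auto simp: y_def)
      moreover have "\<epsilon> * y \<le> 1 * y ^ 2" "\<epsilon> * y ^ 2 \<le> 1 * y ^ 2"
        using b y self_le_power[of y 2] by (intro mult_mono; simp)+
      ultimately show ?thesis unfolding A_def by linarith
    qed
    have Z: "?Z t x = R * \<mu> ^ 4 * y ^ 3 * (A * G * G1 + G1 ^ 2 + G * G2)"
      by (simp add: A_def y_def G_def G1_def G2_def R_def power2_eq_square algebra_simps)
    have i1: "- (G1 ^ 2 + 25 * y ^ 4 * G ^ 2) \<le> 2 * (A * G * G1)"
    proof -
      have "\<bar>G1 * (2 * A * G)\<bar> \<le> 1 * G1 ^ 2 + (2 * A * G) ^ 2 / (4 * 1)"
        by (rule weighted_am_gm) simp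
      also have "(2 * A * G) ^ 2 / (4 * 1) = \<bar>A\<bar> ^ 2 * G ^ 2" by (simp add: power_mult_distrib)
      also have "\<dots> \<le> (5 * y ^ 2) ^ 2 * G ^ 2" using A by (intro mult_right_mono power_mono) auto
      finally show ?thesis by (simp add: abs_le_iff power_mult_distrib algebra_simps)
    qed
    have Rq: "R * X \<le> q x ^ 2 * X" if "0 \<le> X" for X
      using R that by (intro mult_right_mono)
    have i2: "- (2 * \<eta> * (G2 ^ 2 / y) + 1 / (2 * \<eta>) * (\<mu> ^ 8 * y ^ 7 * q x ^ 2 * G ^ 2)) \<le> R * \<mu> ^ 4 * y ^ 3 * (2 * (G * G2))"
    proof -
      have "\<bar>G2 * (2 * R * \<mu> ^ 4 * y ^ 4 * G)\<bar> \<le> (2 * \<eta>) * G2 ^ 2 + (2 * R * \<mu> ^ 4 * y ^ 4 * G) ^ 2 / (4 * (2 * \<eta>))"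
        using \<eta> by (intro weighted_am_gm) simp
      also have "(2 * R * \<mu> ^ 4 * y ^ 4 * G) ^ 2 / (4 * (2 * \<eta>)) = R * (R * (\<mu> ^ 8 * y ^ 8 * G ^ 2)) / (2 * \<eta>)"
        using \<eta> by (simp add: power_mult_distrib field_simps power2_eq_square flip: power_mult)
      also have "\<dots> \<le> 1 * (q x ^ 2 * (\<mu> ^ 8 * y ^ 8 * G ^ 2)) / (2 * \<eta>)"
        using \<eta> R y by (intro divide_right_mono mult_mono Rq) auto
      finally have "\<bar>G2 * (2 * R * \<mu> ^ 4 * y ^ 4 * G)\<bar> / y \<le> (2 * \<eta> * G2 ^ 2 + 1 * (q x ^ 2 * (\<mu> ^ 8 * y ^ 8 * G ^ 2)) / (2 * \<eta>)) / y"
        using y by (intro divide_right_mono) auto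
      also have "\<dots> = 2 * \<eta> * (G2 ^ 2 / y) + 1 / (2 * \<eta>) * (\<mu> ^ 8 * y ^ 7 * q x ^ 2 * G ^ 2)"
        using y by (simp add: field_simps power_numeral_reduce)
      also have "\<bar>G2 * (2 * R * \<mu> ^ 4 * y ^ 4 * G)\<bar> / y = \<bar>R * \<mu> ^ 4 * y ^ 3 * (2 * (G * G2))\<bar>"
        using y by (simp add: abs_mult field_simps power_numeral_reduce)
      finally show ?thesis by linarith
    qed
    have i3: "R * \<mu> ^ 4 * y ^ 3 * (- (G1 ^ 2 + 25 * y ^ 4 * G ^ 2)) \<le> R * \<mu> ^ 4 * y ^ 3 * (2 * (A * G * G1))"
      using i1 R y by (intro mult_left_mono) auto
    have i4: "R * (\<mu> ^ 4 * y ^ 7 * G ^ 2) \<le> q x ^ 2 * (\<mu> ^ 8 * y ^ 7 * G ^ 2)"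
      using R y b by (intro mult_mono mult_right_mono power_increasing) auto
    have "R * \<mu> ^ 4 * y ^ 3 * G1 ^ 2 \<le> 2 * \<eta> * (G2 ^ 2 / y) + 1 / (2 * \<eta>) * (\<mu> ^ 8 * y ^ 7 * q x ^ 2 * G ^ 2)
      + 25 * (R * (\<mu> ^ 4 * y ^ 7 * G ^ 2))
      + 2 * (R * \<mu> ^ 4 * y ^ 3 * (A * G * G1 + G1 ^ 2 + G * G2))"
      using i2 i3 by (simp add: algebra_simps power_numeral_reduce)
    with i4 have "R * \<mu> ^ 4 * y ^ 3 * G1 ^ 2 \<le> 2 * \<eta> * (G2 ^ 2 / y) + (25 + 1 / (2 * \<eta>)) * (q x ^ 2 * (\<mu> ^ 8 * y ^ 7 * G ^ 2))
      + 2 * (R * \<mu> ^ 4 * y ^ 3 * (A * G * G1 + G1 ^ 2 + G * G2))"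
      by (simp add: algebra_simps)
    then show "?w1 t x \<le> 2 * \<eta> * ?w2 t x + (25 + 1 / (2 * \<eta>)) * ?w0 t x + 2 * ?Z t x"
      unfolding Z by (simp add: G_def G1_def G2_def R_def y_def mult.assoc)
  qed (intro weight_intros g(1-3))+
  then show ?thesis
    by (simp add: I_add I_cmult weight_intros g(1-3) del: times_divide_eq_right)
qed

end

section \<open>The commutator\<close>

text \<open>Pointwise algebra behind the commutator. Every bracket of the last group is a product
  rule c' a b + c a1 b + c a b1 and thus has integral zero against e; constant coefficients are
  written out with factors 0 and 1 to fit this pattern literally. The sum of squares of r and sg is
  kept symbolic and becomes 1 later.\<close>

lemma cross_terms_identity:
  fixes y y1 y2 yt y1t z z1 z2 zt z1t th thx thxx tht rho rhot r sg :: real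
  shows "(- y2 - th\<^sup>2 * y - r * rho * y + sg * zt) * (2 * th * y1 + thx * y + r * yt - sg * rho * z)
      + (- z2 - th\<^sup>2 * z - r * rho * z - sg * yt) * (2 * th * z1 + thx * z + r * zt + sg * rho * y)
    = 2 * thx * (y1\<^sup>2 + z1\<^sup>2) + 2 * th\<^sup>2 * thx * (y\<^sup>2 + z\<^sup>2)
      + thxx * (y * y1 + z * z1) - 2 * sg * tht * (z * y1 - y * z1)
      + (2 * r * th * tht + (r\<^sup>2 + sg\<^sup>2) * rhot / 2) * (y\<^sup>2 + z\<^sup>2)
      + (- (thx * y1 * y1 + th * y2 * y1 + th * y1 * y2) - (thx * z1 * z1 + th * z2 * z1 + th * z1 * z2)
         - (thxx * y * y1 + thx * y1 * y1 + thx * y * y2) - (thxx * z * z1 + thx * z1 * z1 + thx * z * z2)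
         - r * (0 * y1 * yt + 1 * y2 * yt + 1 * y1 * y1t) - r * (0 * z1 * zt + 1 * z2 * zt + 1 * z1 * z1t)
         + r / 2 * (0 * y1 * y1 + 1 * y1t * y1 + 1 * y1 * y1t) + r / 2 * (0 * z1 * z1 + 1 * z1t * z1 + 1 * z1 * z1t)
         + sg * (tht * y1 * z + rho * y2 * z + rho * y1 * z1) - sg * (tht * z1 * y + rho * z2 * y + rho * z1 * y1)
         - (3 * th\<^sup>2 * thx * y * y + th^3 * y1 * y + th^3 * y * y1) - (3 * th\<^sup>2 * thx * z * z + th^3 * z1 * z + th^3 * z * z1)
         - r / 2 * (2 * th * tht * y * y + th\<^sup>2 * yt * y + th\<^sup>2 * y * yt) - r / 2 * (2 * th * tht * z * z + th\<^sup>2 * zt * z + th\<^sup>2 * z * zt)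
         - r * ((tht * th + rho * thx) * y * y + rho * th * y1 * y + rho * th * y * y1)
         - r * ((tht * th + rho * thx) * z * z + rho * th * z1 * z + rho * th * z * z1)
         - (r\<^sup>2 + sg\<^sup>2) / 2 * (rhot * y * y + rho * yt * y + rho * y * yt)
         - (r\<^sup>2 + sg\<^sup>2) / 2 * (rhot * z * z + rho * zt * z + rho * z * zt)
         + sg * (tht * z * y1 + th * zt * y1 + th * z * y1t) - sg * (tht * y * z1 + th * yt * z1 + th * y * z1t)
         + sg * (thx * y * zt + th * y1 * zt + th * y * z1t) - sg * (thx * z * yt + th * z1 * yt + th * z * y1t))"
  by (simp add: field_simps power2_eq_square power3_eq_cube)

context carleman_weight
begin

text \<open>Growth and vanishing are bundled because \<open>I\<close> is additive only on integrable
  functions; the bundle is closed under linear combinations.\<close>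

definition null :: "(real \<Rightarrow> real \<Rightarrow> real) \<Rightarrow> bool" where
  "null F \<longleftrightarrow> moderate T F \<and> I F = 0"

lemma null_intros:
  "null F \<Longrightarrow> null G \<Longrightarrow> null (\<lambda>t x. F t x + G t x)"
  "null F \<Longrightarrow> null G \<Longrightarrow> null (\<lambda>t x. F t x - G t x)"
  "null F \<Longrightarrow> null (\<lambda>t x. - F t x)"
  "null F \<Longrightarrow> null (\<lambda>t x. c * F t x)"
  using I_cmult[of "-1" F]
  by (auto simp: null_def I_add I_diff I_cmult intro!: moderate_intros)

text \<open>
  The companions of a function: the derivatives of \<open>exp (s \<phi>) * a\<close> divided by \<open>exp (s \<phi>)\<close>.
\<close>
definition x_comp :: "(real \<Rightarrow> real \<Rightarrow> real) \<Rightarrow> (real \<Rightarrow> real \<Rightarrow> real) \<Rightarrow> bool" where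
  "x_comp a a1 \<longleftrightarrow> x_deriv T a (\<lambda>t x. a1 t x - \<theta> t x * a t x)"

definition t_comp :: "(real \<Rightarrow> real \<Rightarrow> real) \<Rightarrow> (real \<Rightarrow> real \<Rightarrow> real) \<Rightarrow> bool" where
  "t_comp a a1 \<longleftrightarrow> t_deriv T a (\<lambda>t x. a1 t x - \<rho> t x * a t x)"

text \<open>For the conjugated functions exp (s \<phi>) a and exp (s \<phi>) b this is the ordinary
  product rule with coefficient c. The two exponentials multiply to e, so the 2 \<theta> of the
  weighted rule cancels against the - \<theta> of the two companions.\<close>

lemma null_x:
  assumes m: "moderate T c" "moderate T c'" "moderate T a" "moderate T a1" "moderate T b" "moderate T b1"
    and d: "x_deriv T c c'" "x_comp a a1" "x_comp b b1"
  shows "null (\<lambda>t x. c' t x * a t x * b t x + c t x * a1 t x * b t x + c t x * a t x * b1 t x)"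
proof -
  let ?F = "\<lambda>t x. c t x * (a t x * b t x)"
  let ?F' = "\<lambda>t x. c' t x * (a t x * b t x) + c t x * ((a1 t x - \<theta> t x * a t x) * b t x + a t x * (b1 t x - \<theta> t x * b t x))"
  have "x_deriv T ?F ?F'"
    using d unfolding x_comp_def by (intro x_deriv_mult)
  moreover have "moderate T ?F" "moderate T ?F'" by (intro weight_intros m)+
  ultimately have "I (\<lambda>t x. ?F' t x + 2 * \<theta> t x * ?F t x) = 0" by (intro I_x_deriv)
  moreover have "(\<lambda>t x. ?F' t x + 2 * \<theta> t x * ?F t x)
      = (\<lambda>t x. c' t x * a t x * b t x + c t x * a1 t x * b t x + c t x * a t x * b1 t x)"
    by (simp add: fun_eq_iff algebra_simps)
  ultimately show ?thesis unfolding null_def by (auto intro!: weight_intros m)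
qed

lemma null_t:
  assumes m: "moderate T c" "moderate T c'" "moderate T a" "moderate T a1" "moderate T b" "moderate T b1"
    and d: "t_deriv T c c'" "t_comp a a1" "t_comp b b1"
  shows "null (\<lambda>t x. c' t x * a t x * b t x + c t x * a1 t x * b t x + c t x * a t x * b1 t x)"
proof -
  let ?F = "\<lambda>t x. c t x * (a t x * b t x)"
  let ?F' = "\<lambda>t x. c' t x * (a t x * b t x) + c t x * ((a1 t x - \<rho> t x * a t x) * b t x + a t x * (b1 t x - \<rho> t x * b t x))"
  have "t_deriv T ?F ?F'"
    using d unfolding t_comp_def by (intro t_deriv_mult)
  moreover have "moderate T ?F" "moderate T ?F'" by (intro weight_intros m)+
  ultimately have "I (\<lambda>t x. ?F' t x + 2 * \<rho> t x * ?F t x) = 0" by (intro I_t_deriv)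
  moreover have "(\<lambda>t x. ?F' t x + 2 * \<rho> t x * ?F t x)
      = (\<lambda>t x. c' t x * a t x * b t x + c t x * a1 t x * b t x + c t x * a t x * b1 t x)"
    by (simp add: fun_eq_iff algebra_simps)
  ultimately show ?thesis unfolding null_def by (auto intro!: weight_intros m)
qed

text \<open>\<theta> is s times the x-derivative of \<phi>, and N is its own derivative up to the
  factor \<mu> p1; hence the closed forms. The leading term of \<open>\<theta>x\<close>, with
  \<mu>^2 (p1)^2, is positive away from critical points of \<psi>.\<close>

definition \<theta>x :: "real \<Rightarrow> real \<Rightarrow> real" where
  "\<theta>x t x = (\<mu>\<^sup>2 * p1 x ^ 2 + \<mu> * p2 x) * N t x"

definition \<theta>xx :: "real \<Rightarrow> real \<Rightarrow> real" where
  "\<theta>xx t x = (\<mu> ^ 3 * p1 x ^ 3 + 3 * \<mu>\<^sup>2 * p1 x * p2 x + \<mu> * p3 x) * N t x"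

definition \<theta>t :: "real \<Rightarrow> real \<Rightarrow> real" where
  "\<theta>t t x = \<mu> * p1 x * \<tau> t x * N t x"

lemma theta_moderate: "moderate T \<theta>" "moderate T \<theta>x" "moderate T \<theta>xx" "moderate T \<theta>t"
  unfolding \<theta>x_def[abs_def] \<theta>xx_def[abs_def] \<theta>t_def[abs_def] by (intro weight_intros)+

lemma theta_deriv: "x_deriv T \<theta> \<theta>x" "x_deriv T \<theta>x \<theta>xx" "t_deriv T \<theta> \<theta>t" "x_deriv T \<rho> \<theta>t"
proof -
  note p = x_deriv_x[OF p_deriv(1)] x_deriv_x[OF p_deriv(2)]
  show "x_deriv T \<theta> \<theta>x"
    by (rule x_deriv_cong[OF x_deriv_mult[OF x_deriv_mult[OF x_deriv_const p(1)] N_x]])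
       (simp add: \<theta>x_def algebra_simps power2_eq_square)
  show "x_deriv T \<theta>x \<theta>xx" unfolding \<theta>x_def[abs_def]
    by (rule x_deriv_cong[OF x_deriv_mult[OF x_deriv_add[OF x_deriv_mult[OF x_deriv_const x_deriv_power[OF p(1)]]
            x_deriv_mult[OF x_deriv_const p(2)]] N_x]])
       (simp add: \<theta>xx_def algebra_simps power2_eq_square power3_eq_cube)
  show "t_deriv T \<theta> \<theta>t"
    by (rule t_deriv_cong[OF t_deriv_mult[OF t_deriv_const N_t]])
       (simp add: \<theta>t_def algebra_simps)
  show "x_deriv T \<rho> \<theta>t" using rho_x by (simp add: \<theta>t_def[abs_def])
qed

text \<open>With Y = y + \<i> z, the factors are the components of the symmetric part (-
  \<partial>_x^2 - \<theta>^2 - r \<rho> - \<i> sg \<partial>_t) Y and of the skew part (2 \<theta>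
  \<partial>_x + \<theta>x + r \<partial>_t + \<i> sg \<rho>) Y. Second space derivatives and time
  derivatives of Y disappear from the right side. The mixed derivatives \<open>y1t\<close> and
  \<open>z1t\<close> enter only through the integrations by parts and cancel there.\<close>

lemma commutator_identity:
  assumes m: "moderate T y" "moderate T y1" "moderate T y2" "moderate T yt" "moderate T y1t"
      "moderate T z" "moderate T z1" "moderate T z2" "moderate T zt" "moderate T z1t"
    and y: "x_comp y y1" "x_comp y1 y2" "t_comp y yt" "t_comp y1 y1t" "x_comp yt y1t"
    and z: "x_comp z z1" "x_comp z1 z2" "t_comp z zt" "t_comp z1 z1t" "x_comp zt z1t"
    and rs: "r\<^sup>2 + sg\<^sup>2 = 1"
  shows "I (\<lambda>t x. (- y2 t x - (\<theta> t x)\<^sup>2 * y t x - r * \<rho> t x * y t x + sg * zt t x)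
          * (2 * \<theta> t x * y1 t x + \<theta>x t x * y t x + r * yt t x - sg * \<rho> t x * z t x)
      + (- z2 t x - (\<theta> t x)\<^sup>2 * z t x - r * \<rho> t x * z t x - sg * yt t x)
          * (2 * \<theta> t x * z1 t x + \<theta>x t x * z t x + r * zt t x + sg * \<rho> t x * y t x))
    = I (\<lambda>t x. 2 * \<theta>x t x * ((y1 t x)\<^sup>2 + (z1 t x)\<^sup>2) + 2 * (\<theta> t x)\<^sup>2 * \<theta>x t x * ((y t x)\<^sup>2 + (z t x)\<^sup>2)
      + \<theta>xx t x * (y t x * y1 t x + z t x * z1 t x) - 2 * sg * \<theta>t t x * (z t x * y1 t x - y t x * z1 t x)
      + (2 * r * \<theta> t x * \<theta>t t x + \<rho>' t x / 2) * ((y t x)\<^sup>2 + (z t x)\<^sup>2))"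
    (is "I ?L = I ?R")
proof -
  note mm = m theta_moderate weight_intros
  have one: "x_deriv T (\<lambda>t x. 1) (\<lambda>t x. 0)" "t_deriv T (\<lambda>t x. 1) (\<lambda>t x. 0)" by (rule x_deriv_const t_deriv_const)+
  have th3: "x_deriv T (\<lambda>t x. (\<theta> t x) ^ 3) (\<lambda>t x. 3 * (\<theta> t x)\<^sup>2 * \<theta>x t x)"
    using x_deriv_power[OF theta_deriv(1), of 3] by simp
  have th2: "t_deriv T (\<lambda>t x. (\<theta> t x)\<^sup>2) (\<lambda>t x. 2 * \<theta> t x * \<theta>t t x)"
    using t_deriv_power[OF theta_deriv(3), of 2] by simp
  have rth: "x_deriv T (\<lambda>t x. \<rho> t x * \<theta> t x) (\<lambda>t x. \<theta>t t x * \<theta> t x + \<rho> t x * \<theta>x t x)"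
    by (rule x_deriv_mult[OF theta_deriv(4,1)])
  let ?Z = "\<lambda>t x. - (\<theta>x t x * y1 t x * y1 t x + \<theta> t x * y2 t x * y1 t x + \<theta> t x * y1 t x * y2 t x) - (\<theta>x t x * z1 t x * z1 t x + \<theta> t x * z2 t x * z1 t x + \<theta> t x * z1 t x * z2 t x)
         - (\<theta>xx t x * y t x * y1 t x + \<theta>x t x * y1 t x * y1 t x + \<theta>x t x * y t x * y2 t x) - (\<theta>xx t x * z t x * z1 t x + \<theta>x t x * z1 t x * z1 t x + \<theta>x t x * z t x * z2 t x)
         - r * (0 * y1 t x * yt t x + 1 * y2 t x * yt t x + 1 * y1 t x * y1t t x) - r * (0 * z1 t x * zt t x + 1 * z2 t x * zt t x + 1 * z1 t x * z1t t x)
         + r / 2 * (0 * y1 t x * y1 t x + 1 * y1t t x * y1 t x + 1 * y1 t x * y1t t x) + r / 2 * (0 * z1 t x * z1 t x + 1 * z1t t x * z1 t x + 1 * z1 t x * z1t t x)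
         + sg * (\<theta>t t x * y1 t x * z t x + \<rho> t x * y2 t x * z t x + \<rho> t x * y1 t x * z1 t x) - sg * (\<theta>t t x * z1 t x * y t x + \<rho> t x * z2 t x * y t x + \<rho> t x * z1 t x * y1 t x)
         - (3 * (\<theta> t x)\<^sup>2 * \<theta>x t x * y t x * y t x + \<theta> t x^3 * y1 t x * y t x + \<theta> t x^3 * y t x * y1 t x) - (3 * (\<theta> t x)\<^sup>2 * \<theta>x t x * z t x * z t x + \<theta> t x^3 * z1 t x * z t x + \<theta> t x^3 * z t x * z1 t x)
         - r / 2 * (2 * \<theta> t x * \<theta>t t x * y t x * y t x + (\<theta> t x)\<^sup>2 * yt t x * y t x + (\<theta> t x)\<^sup>2 * y t x * yt t x) - r / 2 * (2 * \<theta> t x * \<theta>t t x * z t x * z t x + (\<theta> t x)\<^sup>2 * zt t x * z t x + (\<theta> t x)\<^sup>2 * z t x * zt t x)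
         - r * ((\<theta>t t x * \<theta> t x + \<rho> t x * \<theta>x t x) * y t x * y t x + \<rho> t x * \<theta> t x * y1 t x * y t x + \<rho> t x * \<theta> t x * y t x * y1 t x)
         - r * ((\<theta>t t x * \<theta> t x + \<rho> t x * \<theta>x t x) * z t x * z t x + \<rho> t x * \<theta> t x * z1 t x * z t x + \<rho> t x * \<theta> t x * z t x * z1 t x)
         - (r\<^sup>2 + sg\<^sup>2) / 2 * (\<rho>' t x * y t x * y t x + \<rho> t x * yt t x * y t x + \<rho> t x * y t x * yt t x)
         - (r\<^sup>2 + sg\<^sup>2) / 2 * (\<rho>' t x * z t x * z t x + \<rho> t x * zt t x * z t x + \<rho> t x * z t x * zt t x)
         + sg * (\<theta>t t x * z t x * y1 t x + \<theta> t x * zt t x * y1 t x + \<theta> t x * z t x * y1t t x) - sg * (\<theta>t t x * y t x * z1 t x + \<theta> t x * yt t x * z1 t x + \<theta> t x * y t x * z1t t x)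
         + sg * (\<theta>x t x * y t x * zt t x + \<theta> t x * y1 t x * zt t x + \<theta> t x * y t x * z1t t x) - sg * (\<theta>x t x * z t x * yt t x + \<theta> t x * z1 t x * yt t x + \<theta> t x * z t x * y1t t x)"
  have cm: "moderate T (\<lambda>t x. (\<theta> t x) ^ 3)" "moderate T (\<lambda>t x. 3 * (\<theta> t x)\<^sup>2 * \<theta>x t x)"
    "moderate T (\<lambda>t x. (\<theta> t x)\<^sup>2)" "moderate T (\<lambda>t x. 2 * \<theta> t x * \<theta>t t x)"
    "moderate T (\<lambda>t x. \<rho> t x * \<theta> t x)" "moderate T (\<lambda>t x. \<theta>t t x * \<theta> t x + \<rho> t x * \<theta>x t x)"
    by (intro mm)+
  note nulls = null_x[OF theta_moderate(1,2) m(2) m(3) m(2) m(3) theta_deriv(1) y(2) y(2)]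
    null_x[OF theta_moderate(1,2) m(7) m(8) m(7) m(8) theta_deriv(1) z(2) z(2)]
    null_x[OF theta_moderate(1,2) m(1) m(2) m(9) m(10) theta_deriv(1) y(1) z(5)]
    null_x[OF theta_moderate(1,2) m(6) m(7) m(4) m(5) theta_deriv(1) z(1) y(5)]
    null_x[OF theta_moderate(2,3) m(1) m(2) m(2) m(3) theta_deriv(2) y(1) y(2)]
    null_x[OF theta_moderate(2,3) m(6) m(7) m(7) m(8) theta_deriv(2) z(1) z(2)]
    null_x[OF moderate_const moderate_const m(2) m(3) m(4) m(5) one(1) y(2) y(5)]
    null_x[OF moderate_const moderate_const m(7) m(8) m(9) m(10) one(1) z(2) z(5)]
    null_t[OF moderate_const moderate_const m(2) m(5) m(2) m(5) one(2) y(4) y(4)]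
    null_t[OF moderate_const moderate_const m(7) m(10) m(7) m(10) one(2) z(4) z(4)]
    null_x[OF rho_mod theta_moderate(4) m(2) m(3) m(6) m(7) theta_deriv(4) y(2) z(1)]
    null_x[OF rho_mod theta_moderate(4) m(7) m(8) m(1) m(2) theta_deriv(4) z(2) y(1)]
    null_x[OF cm(1,2) m(1) m(2) m(1) m(2) th3 y(1) y(1)]
    null_x[OF cm(1,2) m(6) m(7) m(6) m(7) th3 z(1) z(1)]
    null_t[OF cm(3,4) m(1) m(4) m(1) m(4) th2 y(3) y(3)]
    null_t[OF cm(3,4) m(6) m(9) m(6) m(9) th2 z(3) z(3)]
    null_x[OF cm(5,6) m(1) m(2) m(1) m(2) rth y(1) y(1)]
    null_x[OF cm(5,6) m(6) m(7) m(6) m(7) rth z(1) z(1)]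
    null_t[OF rho_mod rho'_mod m(1) m(4) m(1) m(4) rho_t y(3) y(3)]
    null_t[OF rho_mod rho'_mod m(6) m(9) m(6) m(9) rho_t z(3) z(3)]
    null_t[OF theta_moderate(1,4) m(6) m(9) m(2) m(5) theta_deriv(3) z(3) y(4)]
    null_t[OF theta_moderate(1,4) m(1) m(4) m(7) m(10) theta_deriv(3) y(3) z(4)]
  have "null ?Z"
    by (rule nulls null_intros)+
  then have Z: "moderate T ?Z" "I ?Z = 0" by (auto simp only: null_def)
  have "?L = (\<lambda>t x. ?R t x + ?Z t x)"
  proof (intro ext)
    fix t x show "?L t x = ?R t x + ?Z t x"
      using cross_terms_identity[of "y2 t x" "\<theta> t x" "y t x" r "\<rho> t x" sg "zt t x" "y1 t x" "\<theta>x t x" "yt t x" "z t x"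
        "z2 t x" "z1 t x" "\<theta>xx t x" "\<theta>t t x" "\<rho>' t x" "y1t t x" "z1t t x"]
      by (simp only: rs mult_1)
  qed
  moreover have "I (\<lambda>t x. ?R t x + ?Z t x) = I ?R + I ?Z"
    by (rule I_add[OF _ Z(1)]) (intro mm)
  ultimately show ?thesis using Z(2) by simp
qed

end

section \<open>Lower bound for the commutator and recovery of the derivatives\<close>

lemma square_add2: "(a + b :: real)\<^sup>2 \<le> 2 * a\<^sup>2 + 2 * b\<^sup>2"
  using sum_squares_bound[of a b] by (simp add: power2_sum)

lemma square_add3: "(a + b + c :: real)\<^sup>2 \<le> 3 * a\<^sup>2 + 3 * b\<^sup>2 + 3 * c\<^sup>2"
  using sum_squares_bound[of a b] sum_squares_bound[of a c] sum_squares_bound[of b c]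
  by (simp add: power2_eq_square algebra_simps)

lemma square_add4: "(a + b + c + d :: real)\<^sup>2 \<le> 4 * a\<^sup>2 + 4 * b\<^sup>2 + 4 * c\<^sup>2 + 4 * d\<^sup>2"
  using square_add2[of "a + b" "c + d"] square_add2[of a b] square_add2[of c d]
  by (simp add: add.assoc)

lemma square_mult_le: "X \<le> Y \<Longrightarrow> (X * v\<^sup>2 :: real) \<le> Y * v\<^sup>2"
  by (rule mult_right_mono) auto

text \<open>The skew part m2 contains r yt and lower-order terms, so it yields yt and zt at the
  price of 1 / r; inserted into m1 they yield y2 and z2. The squares of the remaining terms are at
  most a multiple of n times the A and B terms in S, which explains the division by n. The squares
  on the left are the derivatives before conjugation by the exponential.\<close>

lemma jet_recovery:
  fixes r s K n A B th thx rho y y1 y2 yt z z1 z2 zt :: real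
  defines "m1y \<equiv> - y2 - th\<^sup>2 * y - r * rho * y + s * zt" and "m1z \<equiv> - z2 - th\<^sup>2 * z - r * rho * z - s * yt"
    and "m2y \<equiv> 2 * th * y1 + thx * y + r * yt - s * rho * z" and "m2z \<equiv> 2 * th * z1 + thx * z + r * zt + s * rho * y"
  defines "S \<equiv> m1y\<^sup>2 + m1z\<^sup>2 + m2y\<^sup>2 + m2z\<^sup>2 + A * (y1\<^sup>2 + z1\<^sup>2) + B * (y\<^sup>2 + z\<^sup>2)"
  assumes n: "1 \<le> n" and AB: "0 \<le> A" "0 \<le> B" and K: "1 \<le> K" and r: "0 < r" "r \<le> 1" and s: "s\<^sup>2 \<le> 1"
    and th: "th\<^sup>2 \<le> K\<^sup>2 * (A * n)" "th ^ 4 \<le> K ^ 4 * (B * n)" "thx\<^sup>2 \<le> 4 * K ^ 4 * (B * n)" "rho\<^sup>2 \<le> B * n"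
      "A * th\<^sup>2 \<le> K\<^sup>2 * B"
  shows "r\<^sup>2 * (B * (y\<^sup>2 + z\<^sup>2) + A * ((y1 - th * y)\<^sup>2 + (z1 - th * z)\<^sup>2)
      + ((yt - rho * y)\<^sup>2 + (zt - rho * z)\<^sup>2 + (y2 - 2 * th * y1 + (th\<^sup>2 - thx) * y)\<^sup>2 + (z2 - 2 * th * z1 + (th\<^sup>2 - thx) * z)\<^sup>2) / n)
    \<le> 400 * K ^ 4 * S"
proof -
  have K24: "K\<^sup>2 \<le> K ^ 4" "1 \<le> K ^ 4" "1 \<le> K\<^sup>2" using K by (auto intro: power_increasing one_le_power)
  have r1: "r\<^sup>2 \<le> 1" "0 \<le> r\<^sup>2" using r by (auto intro: power_le_one)
  have An: "0 \<le> A * n" "0 \<le> B * n" using AB n by auto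
  have th1: "th\<^sup>2 \<le> K ^ 4 * (A * n)" using th(1) K24(1) An(1) by (meson mult_right_mono order_trans)
  have rho1: "rho\<^sup>2 \<le> K ^ 4 * (B * n)" using th(4) mult_right_mono[OF K24(2) An(2)] by simp
  have sq_le: "(s * v)\<^sup>2 \<le> v\<^sup>2" "(r * v)\<^sup>2 \<le> v\<^sup>2" for v
    using square_mult_le[OF s, of v] square_mult_le[OF r1(1), of v] by (auto simp: power_mult_distrib)
  have m2: "m\<^sup>2 \<le> K ^ 4 * (n * m\<^sup>2)" for m
  proof -
    have "1 * 1 \<le> K ^ 4 * n" using K24 n by (intro mult_mono) auto
    from square_mult_le[OF this, of m] show ?thesis by (simp add: mult.assoc)
  qed
  have Xt: "(r * v)\<^sup>2 \<le> 4 * (K ^ 4 * (n * m\<^sup>2)) + 16 * (K ^ 4 * (A * n) * a\<^sup>2) + 16 * (K ^ 4 * (B * n) * b\<^sup>2) + 4 * (K ^ 4 * (B * n) * c\<^sup>2)"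
    if "r * v = m + (- 2 * th * a) + (- thx * b) + w" "w\<^sup>2 \<le> (rho * c)\<^sup>2" for v m a b c w
  proof -
    have "(r * v)\<^sup>2 \<le> 4 * m\<^sup>2 + 4 * (- 2 * th * a)\<^sup>2 + 4 * (- thx * b)\<^sup>2 + 4 * w\<^sup>2"
      unfolding that(1) by (rule square_add4)
    also have "\<dots> = 4 * m\<^sup>2 + 16 * (th\<^sup>2 * a\<^sup>2) + 4 * (thx\<^sup>2 * b\<^sup>2) + 4 * w\<^sup>2"
      by (simp add: power_mult_distrib)
    finally show ?thesis
      using m2[of m] square_mult_le[OF th1, of a] square_mult_le[OF th(3), of b] square_mult_le[OF rho1, of c] that(2)
      by (simp add: power_mult_distrib)
  qed
  have yt: "(r * yt)\<^sup>2 \<le> 4 * (K ^ 4 * (n * m2y\<^sup>2)) + 16 * (K ^ 4 * (A * n) * y1\<^sup>2) + 16 * (K ^ 4 * (B * n) * y\<^sup>2) + 4 * (K ^ 4 * (B * n) * z\<^sup>2)"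
    by (rule Xt[of _ _ _ _ "s * (rho * z)"]) (auto simp: m2y_def sq_le)
  have zt: "(r * zt)\<^sup>2 \<le> 4 * (K ^ 4 * (n * m2z\<^sup>2)) + 16 * (K ^ 4 * (A * n) * z1\<^sup>2) + 16 * (K ^ 4 * (B * n) * z\<^sup>2) + 4 * (K ^ 4 * (B * n) * y\<^sup>2)"
    using sq_le(1) by (intro Xt[of _ _ _ _ "- s * (rho * y)"]) (auto simp: m2z_def)
  define Y where "Y = K ^ 4 * (n * S)"
  have nn: "0 \<le> K ^ 4 * (n * m\<^sup>2)" "0 \<le> K ^ 4 * (A * n) * m\<^sup>2" "0 \<le> K ^ 4 * (B * n) * m\<^sup>2" for m
    using n An by auto
  define w1 w2 w3 w4 w5 w6 w7 w8 where w: "w1 = K ^ 4 * (n * m1y\<^sup>2)" "w2 = K ^ 4 * (n * m1z\<^sup>2)" "w3 = K ^ 4 * (n * m2y\<^sup>2)"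
    "w4 = K ^ 4 * (n * m2z\<^sup>2)" "w5 = K ^ 4 * (A * n) * y1\<^sup>2" "w6 = K ^ 4 * (A * n) * z1\<^sup>2"
    "w7 = K ^ 4 * (B * n) * y\<^sup>2" "w8 = K ^ 4 * (B * n) * z\<^sup>2"
  have Y: "Y = K ^ 4 * (n * m1y\<^sup>2) + K ^ 4 * (n * m1z\<^sup>2) + K ^ 4 * (n * m2y\<^sup>2) + K ^ 4 * (n * m2z\<^sup>2)
      + K ^ 4 * (A * n) * y1\<^sup>2 + K ^ 4 * (A * n) * z1\<^sup>2 + K ^ 4 * (B * n) * y\<^sup>2 + K ^ 4 * (B * n) * z\<^sup>2"
    by (simp add: Y_def S_def algebra_simps)
  note Y = Y[folded w]
  note nns = nn(1)[of m1y, folded w] nn(1)[of m1z, folded w] nn(1)[of m2y, folded w] nn(1)[of m2z, folded w]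
    nn(2)[of y1, folded w] nn(2)[of z1, folded w] nn(3)[of y, folded w] nn(3)[of z, folded w]
  note yt = yt[folded w] and zt = zt[folded w]
  have t: "(r * yt)\<^sup>2 + (r * zt)\<^sup>2 \<le> 20 * Y" using yt zt nns unfolding Y by argo
  \<comment> \<open>Here w comes from the time derivative of the other component, already controlled
    after multiplication by r.\<close>
  have X2: "(r * v)\<^sup>2 \<le> 4 * (K ^ 4 * (n * m\<^sup>2)) + 8 * (K ^ 4 * (B * n) * b\<^sup>2) + 4 * (r * c)\<^sup>2"
    if "v = (- m) + (- (th\<^sup>2) * b) + (- (r * (rho * b))) + w" "w\<^sup>2 \<le> c\<^sup>2" for v m b c w
  proof -
    have "v\<^sup>2 \<le> 4 * (- m)\<^sup>2 + 4 * (- (th\<^sup>2) * b)\<^sup>2 + 4 * (- (r * (rho * b)))\<^sup>2 + 4 * w\<^sup>2"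
      unfolding that(1) by (rule square_add4)
    also have "\<dots> = 4 * m\<^sup>2 + 4 * (th ^ 4 * b\<^sup>2) + 4 * (r * (rho * b))\<^sup>2 + 4 * w\<^sup>2"
      by (simp add: power_mult_distrib flip: power_mult)
    also have "\<dots> \<le> 4 * (K ^ 4 * (n * m\<^sup>2)) + 8 * (K ^ 4 * (B * n) * b\<^sup>2) + 4 * c\<^sup>2"
      using m2[of m] square_mult_le[OF th(2), of b] square_mult_le[OF rho1, of b] sq_le(2)[of "rho * b"] that(2)
      by (simp add: power_mult_distrib)
    finally have "r\<^sup>2 * v\<^sup>2 \<le> r\<^sup>2 * (4 * (K ^ 4 * (n * m\<^sup>2)) + 8 * (K ^ 4 * (B * n) * b\<^sup>2) + 4 * c\<^sup>2)"
      by (rule mult_left_mono) auto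
    also have "\<dots> = r\<^sup>2 * (4 * (K ^ 4 * (n * m\<^sup>2)) + 8 * (K ^ 4 * (B * n) * b\<^sup>2)) + 4 * (r * c)\<^sup>2"
      by (simp add: power_mult_distrib algebra_simps)
    also have "\<dots> \<le> 1 * (4 * (K ^ 4 * (n * m\<^sup>2)) + 8 * (K ^ 4 * (B * n) * b\<^sup>2)) + 4 * (r * c)\<^sup>2"
      using r1 nn(1)[of m] nn(3)[of b] by (intro add_right_mono mult_right_mono) auto
    finally show ?thesis by (simp add: power_mult_distrib)
  qed
  have y2: "(r * y2)\<^sup>2 \<le> 4 * (K ^ 4 * (n * m1y\<^sup>2)) + 8 * (K ^ 4 * (B * n) * y\<^sup>2) + 4 * (r * zt)\<^sup>2"
    by (rule X2[of _ _ _ "s * zt"]) (auto simp: m1y_def sq_le)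
  have z2: "(r * z2)\<^sup>2 \<le> 4 * (K ^ 4 * (n * m1z\<^sup>2)) + 8 * (K ^ 4 * (B * n) * z\<^sup>2) + 4 * (r * yt)\<^sup>2"
    using sq_le(1) by (intro X2[of _ _ _ "- s * yt"]) (auto simp: m1z_def)
  note y2 = y2[folded w] and z2 = z2[folded w]
  have x2: "(r * y2)\<^sup>2 + (r * z2)\<^sup>2 \<le> 88 * Y" using y2 z2 t nns unfolding Y by argo
  have rl: "r\<^sup>2 * v \<le> v" if "0 \<le> v" for v using mult_right_mono[OF r1(1) that] by simp
  have Ut: "r\<^sup>2 * (v - rho * b)\<^sup>2 \<le> 2 * (r * v)\<^sup>2 + 2 * (K ^ 4 * (B * n) * b\<^sup>2)" for v b
  proof -
    have "r\<^sup>2 * (v - rho * b)\<^sup>2 \<le> r\<^sup>2 * (2 * v\<^sup>2 + 2 * (- rho * b)\<^sup>2)"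
      using square_add2[of v "- rho * b"] by (intro mult_left_mono) auto
    also have "\<dots> = 2 * (r * v)\<^sup>2 + 2 * (r\<^sup>2 * (rho\<^sup>2 * b\<^sup>2))" by (simp add: power_mult_distrib algebra_simps)
    finally show ?thesis using rl[of "rho\<^sup>2 * b\<^sup>2"] square_mult_le[OF rho1, of b] by simp
  qed
  have th_thx: "(th\<^sup>2 - thx)\<^sup>2 \<le> 10 * (K ^ 4 * (B * n))"
    using square_add2[of "th\<^sup>2" "- thx"] th(2,3) by (simp flip: power_mult)
  have Uxx: "r\<^sup>2 * (v - 2 * th * a + (th\<^sup>2 - thx) * b)\<^sup>2 \<le> 3 * (r * v)\<^sup>2 + 12 * (K ^ 4 * (A * n) * a\<^sup>2) + 30 * (K ^ 4 * (B * n) * b\<^sup>2)" for v a b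
  proof -
    have "r\<^sup>2 * (v - 2 * th * a + (th\<^sup>2 - thx) * b)\<^sup>2 \<le> r\<^sup>2 * (3 * v\<^sup>2 + 3 * (- 2 * th * a)\<^sup>2 + 3 * ((th\<^sup>2 - thx) * b)\<^sup>2)"
      using square_add3[of v "- 2 * th * a" "(th\<^sup>2 - thx) * b"] by (intro mult_left_mono) auto
    also have "\<dots> = 3 * (r * v)\<^sup>2 + r\<^sup>2 * (12 * (th\<^sup>2 * a\<^sup>2) + 3 * ((th\<^sup>2 - thx)\<^sup>2 * b\<^sup>2))"
      by (simp add: power_mult_distrib distrib_left)
    also have "\<dots> \<le> 3 * (r * v)\<^sup>2 + (12 * (th\<^sup>2 * a\<^sup>2) + 3 * ((th\<^sup>2 - thx)\<^sup>2 * b\<^sup>2))"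
      by (intro add_left_mono rl) auto
    finally show ?thesis using square_mult_le[OF th1, of a] square_mult_le[OF th_thx, of b] by simp
  qed
  \<comment> \<open>The time derivatives contribute 2 * 20, the second space derivatives 3 * 88, and
    the lower-order terms at most 32.\<close>
  have div: "r\<^sup>2 * (((yt - rho * y)\<^sup>2 + (zt - rho * z)\<^sup>2 + (y2 - 2 * th * y1 + (th\<^sup>2 - thx) * y)\<^sup>2 + (z2 - 2 * th * z1 + (th\<^sup>2 - thx) * z)\<^sup>2) / n)
      \<le> 350 * (K ^ 4 * S)"
  proof -
    have "r\<^sup>2 * (yt - rho * y)\<^sup>2 + r\<^sup>2 * (zt - rho * z)\<^sup>2 + r\<^sup>2 * (y2 - 2 * th * y1 + (th\<^sup>2 - thx) * y)\<^sup>2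
        + r\<^sup>2 * (z2 - 2 * th * z1 + (th\<^sup>2 - thx) * z)\<^sup>2 \<le> 350 * Y"
      using Ut[of yt y, folded w] Ut[of zt z, folded w] Uxx[of y2 y1 y, folded w] Uxx[of z2 z1 z, folded w] t x2 nns
      unfolding Y by argo
    then have "r\<^sup>2 * ((yt - rho * y)\<^sup>2 + (zt - rho * z)\<^sup>2 + (y2 - 2 * th * y1 + (th\<^sup>2 - thx) * y)\<^sup>2
        + (z2 - 2 * th * z1 + (th\<^sup>2 - thx) * z)\<^sup>2) \<le> 350 * (K ^ 4 * S) * n"
      by (simp add: Y_def algebra_simps)
    then show ?thesis using n by (simp add: pos_divide_le_eq)
  qed
  have KS: "X \<le> K ^ 4 * X" if "0 \<le> X" for X using mult_right_mono[OF K24(2) that] by simp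
  have Ux: "r\<^sup>2 * (A * (a - th * b)\<^sup>2) \<le> 2 * (K ^ 4 * (A * a\<^sup>2)) + 2 * (K ^ 4 * (B * b\<^sup>2))" for a b
  proof -
    have "r\<^sup>2 * (A * (a - th * b)\<^sup>2) \<le> A * (a - th * b)\<^sup>2" using AB by (intro rl) auto
    also have "\<dots> \<le> A * (2 * a\<^sup>2 + 2 * (- th * b)\<^sup>2)"
      using square_add2[of a "- th * b"] AB by (intro mult_left_mono) auto
    also have "\<dots> = 2 * (A * a\<^sup>2) + 2 * ((A * th\<^sup>2) * b\<^sup>2)" by (simp add: power_mult_distrib algebra_simps)
    also have "\<dots> \<le> 2 * (K ^ 4 * (A * a\<^sup>2)) + 2 * ((K ^ 4 * B) * b\<^sup>2)"
      using th(5) mult_right_mono[OF K24(1) AB(2)] AB by (intro add_mono mult_left_mono KS square_mult_le) auto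
    finally show ?thesis by (simp add: mult.assoc)
  qed
  have U: "r\<^sup>2 * (B * b\<^sup>2) \<le> K ^ 4 * (B * b\<^sup>2)" for b
    using rl[of "B * b\<^sup>2"] KS[of "B * b\<^sup>2"] AB by simp
  have S: "K ^ 4 * S = K ^ 4 * m1y\<^sup>2 + K ^ 4 * m1z\<^sup>2 + K ^ 4 * m2y\<^sup>2 + K ^ 4 * m2z\<^sup>2
      + K ^ 4 * (A * y1\<^sup>2) + K ^ 4 * (A * z1\<^sup>2) + K ^ 4 * (B * y\<^sup>2) + K ^ 4 * (B * z\<^sup>2)"
    by (simp add: S_def algebra_simps)
  have nnS: "0 \<le> K ^ 4 * m\<^sup>2" "0 \<le> K ^ 4 * (A * m\<^sup>2)" "0 \<le> K ^ 4 * (B * m\<^sup>2)" for m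
    using AB by auto
  have "r\<^sup>2 * (B * y\<^sup>2) + r\<^sup>2 * (B * z\<^sup>2) + r\<^sup>2 * (A * (y1 - th * y)\<^sup>2) + r\<^sup>2 * (A * (z1 - th * z)\<^sup>2) \<le> 50 * (K ^ 4 * S)"
    using Ux[of y1 y] Ux[of z1 z] U[of y] U[of z] nnS(1)[of m1y] nnS(1)[of m1z] nnS(1)[of m2y] nnS(1)[of m2z]
      nnS(2)[of y1] nnS(2)[of z1] nnS(3)[of y] nnS(3)[of z] unfolding S by argo
  with div show ?thesis by (simp add: distrib_left)
qed

context carleman_weight
begin

text \<open>The two terms with \<open>\<theta>x\<close> have leading parts (p1)^2 a and (p1)^4 b,
  bounded below outside the support of the cutoff term. Each other contribution contains one factor
  \<mu> or N too few, or a time derivative of a weight, and therefore carries a factor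
  \<epsilon>.\<close>

lemma commutator_lower_bound:
  fixes t x y y1 z z1 r s :: real
  assumes t: "0 < t" "t < T" and rs: "0 \<le> r" "r \<le> 1" "\<bar>s\<bar> \<le> 1"
  defines "a \<equiv> \<mu>\<^sup>2 * N t x * (y1\<^sup>2 + z1\<^sup>2)" and "b \<equiv> \<mu> ^ 4 * N t x ^ 3 * (y\<^sup>2 + z\<^sup>2)"
  shows "2 * \<delta>\<^sup>2 * (a + b) \<le> 2 * (2 * \<theta>x t x * (y1\<^sup>2 + z1\<^sup>2) + 2 * (\<theta> t x)\<^sup>2 * \<theta>x t x * (y\<^sup>2 + z\<^sup>2)
      + \<theta>xx t x * (y * y1 + z * z1) - 2 * s * \<theta>t t x * (z * y1 - y * z1)
      + (2 * r * \<theta> t x * \<theta>t t x + \<rho>' t x / 2) * (y\<^sup>2 + z\<^sup>2)) + 2048 * (q x ^ 8 * (a + b))"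
proof -
  define n where "n = N t x"
  have n: "1 \<le> n" "1 \<le> \<epsilon> * n" using N_ge1[OF t, of x] N_ge[OF t, of x] by (auto simp: n_def)
  have m: "1 \<le> \<mu>" "1 \<le> \<epsilon> * \<mu>" "0 < \<epsilon>" "\<epsilon> \<le> 1" using mu_ge1 mu eps by auto
  define P0 where "P0 = y\<^sup>2 + z\<^sup>2" define P1 where "P1 = y1\<^sup>2 + z1\<^sup>2"
  have P: "0 \<le> P0" "0 \<le> P1" by (auto simp: P0_def P1_def)
  have a: "a = \<mu>\<^sup>2 * n * P1" and b: "b = \<mu> ^ 4 * n ^ 3 * P0" by (auto simp: a_def b_def n_def P0_def P1_def)
  have ab: "0 \<le> a" "0 \<le> b" using P m n by (auto simp: a b)
  have c: "\<bar>p1 x\<bar> \<le> K" "\<bar>p2 x\<bar> \<le> K" "\<bar>p3 x\<bar> \<le> K" "1 \<le> K" using p_le K1 by auto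
  have KK: "K \<le> K ^ 3" "K\<^sup>2 \<le> K ^ 3" "1 \<le> K ^ 3"
    using c(4) self_le_power[of K 3] by (auto intro: power_increasing)
  define Q where "Q = q x ^ 8"
  have Q: "0 \<le> Q" using q01 by (simp add: Q_def)
  have d2: "\<delta>\<^sup>2 \<le> \<delta>" using delta by (simp add: power2_eq_square mult_left_le)
  have c2: "\<delta> - 256 * Q \<le> (p1 x)\<^sup>2"
  proof -
    have "\<delta> * Q \<le> 1 * Q" using delta Q by (intro mult_right_mono) auto
    then show ?thesis using p1_lower[of x] by (simp add: Q_def algebra_simps)
  qed
  \<comment> \<open>The bound on (p1)^2 may be squared only where its left side is nonnegative; in
    the other case the claim is trivial. The cross term of the square doubles 256 to 512.\<close>
  have c4: "\<delta>\<^sup>2 - 512 * Q \<le> (p1 x) ^ 4"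
  proof (cases "\<delta> \<le> 256 * Q")
    case True
    have "(0::real) \<le> p1 x ^ 4" by simp
    with True d2 Q show ?thesis by linarith
  next
    case False
    then have "(\<delta> - 256 * Q)\<^sup>2 \<le> ((p1 x)\<^sup>2)\<^sup>2" using c2 by (intro power_mono) auto
    moreover have "\<delta> * Q \<le> 1 * Q" using delta Q by (intro mult_right_mono) auto
    moreover have "0 \<le> (256 * Q)\<^sup>2" by simp
    moreover have "(\<delta> - 256 * Q)\<^sup>2 = \<delta>\<^sup>2 - 512 * (\<delta> * Q) + (256 * Q)\<^sup>2" by (simp add: power2_diff)
    ultimately have "\<delta>\<^sup>2 - 512 * Q \<le> ((p1 x)\<^sup>2)\<^sup>2" by argo
    then show ?thesis by simp
  qed
  have T1: "4 * \<theta>x t x * P1 \<ge> 4 * \<delta>\<^sup>2 * a - 1024 * (Q * a) - 4 * (K ^ 3 * \<epsilon> * a)"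
  proof -
    have "- p2 x * (\<mu> * n * P1) \<le> K * (\<mu> * n * P1)" using c(2) m n P by (intro mult_right_mono) auto
    also have "\<dots> \<le> K * (\<epsilon> * \<mu> * (\<mu> * n * P1))"
      using m n P c(4) mult_right_mono[OF m(2), of "\<mu> * n * P1"] by (intro mult_left_mono) auto
    also have "\<dots> = K * (\<epsilon> * a)" by (simp add: a power2_eq_square)
    also have "\<dots> \<le> K ^ 3 * (\<epsilon> * a)" using KK ab m by (intro mult_right_mono) auto
    finally have 1: "- p2 x * (\<mu> * n * P1) \<le> K ^ 3 * \<epsilon> * a" by simp
    have 2: "(\<delta>\<^sup>2 - 256 * Q) * a \<le> (p1 x)\<^sup>2 * a" using c2 d2 ab by (intro mult_right_mono) auto
    have "4 * \<theta>x t x * P1 = 4 * ((p1 x)\<^sup>2 * a) + 4 * (p2 x * (\<mu> * n * P1))"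
      by (simp add: \<theta>x_def a n_def algebra_simps)
    with 1 2 show ?thesis by (simp add: algebra_simps)
  qed
  have T2: "4 * (\<theta> t x)\<^sup>2 * \<theta>x t x * P0 \<ge> 4 * \<delta>\<^sup>2 * b - 2048 * (Q * b) - 4 * (K ^ 3 * \<epsilon> * b)"
  proof -
    have "\<bar>p1 x\<bar> ^ 2 * \<bar>p2 x\<bar> \<le> K ^ 2 * K" using c by (intro mult_mono power_mono) auto
    then have "- ((p1 x)\<^sup>2 * p2 x) \<le> K ^ 3"
      by (simp add: power2_eq_square power3_eq_cube abs_mult abs_le_iff)
        (metis abs_le_D2 abs_mult abs_mult_self_eq)
    then have "- ((p1 x)\<^sup>2 * p2 x) * (\<mu> ^ 3 * n ^ 3 * P0) \<le> K ^ 3 * (\<mu> ^ 3 * n ^ 3 * P0)"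
      using m n P by (intro mult_right_mono) auto
    also have "\<dots> \<le> K ^ 3 * (\<epsilon> * \<mu> * (\<mu> ^ 3 * n ^ 3 * P0))"
      using m n P c(4) mult_right_mono[OF m(2), of "\<mu> ^ 3 * n ^ 3 * P0"] by (intro mult_left_mono) auto
    also have "\<dots> = K ^ 3 * \<epsilon> * b" by (simp add: b power_numeral_reduce)
    finally have 1: "- ((p1 x)\<^sup>2 * p2 x) * (\<mu> ^ 3 * n ^ 3 * P0) \<le> K ^ 3 * \<epsilon> * b" .
    have 2: "(\<delta>\<^sup>2 - 512 * Q) * b \<le> (p1 x) ^ 4 * b" using c4 ab by (intro mult_right_mono) auto
    have "4 * (\<theta> t x)\<^sup>2 * \<theta>x t x * P0 = 4 * ((p1 x) ^ 4 * b) + 4 * (((p1 x)\<^sup>2 * p2 x) * (\<mu> ^ 3 * n ^ 3 * P0))"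
      by (simp add: \<theta>x_def b n_def algebra_simps power_numeral_reduce)
    with 1 2 show ?thesis by (simp add: algebra_simps)
  qed
  have T3: "\<bar>2 * \<theta>xx t x * (y * y1 + z * z1)\<bar> \<le> 5 * (K ^ 3 * \<epsilon> * (a + b))"
  proof -
    \<comment> \<open>\<open>\<theta>xx\<close> has size \<mu>^3 N, whereas the geometric mean of a
      and b brings \<mu>^3 N^2; the missing factor 1 / N is at most \<epsilon>.\<close>
    have k: "2 * \<mu> * \<bar>u * v\<bar> \<le> \<epsilon> * v\<^sup>2 + \<epsilon> * (\<mu> * n * u)\<^sup>2" for u v
    proof -
      have "0 \<le> \<epsilon> * (\<bar>v\<bar> - \<mu> * n * \<bar>u\<bar>)\<^sup>2" using m by auto
      then have "2 * \<mu> * (\<epsilon> * n) * \<bar>u * v\<bar> \<le> \<epsilon> * v\<^sup>2 + \<epsilon> * (\<mu> * n * u)\<^sup>2"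
        by (simp add: power2_diff power_mult_distrib abs_mult algebra_simps)
      moreover have "2 * \<mu> * \<bar>u * v\<bar> * 1 \<le> 2 * \<mu> * \<bar>u * v\<bar> * (\<epsilon> * n)"
        using m n by (intro mult_left_mono) auto
      ultimately show ?thesis by (simp add: mult_ac)
    qed
    have W: "2 * \<mu> * \<bar>y * y1 + z * z1\<bar> \<le> \<epsilon> * P1 + \<epsilon> * (\<mu>\<^sup>2 * n\<^sup>2 * P0)"
    proof -
      have "2 * \<mu> * \<bar>y * y1 + z * z1\<bar> \<le> 2 * \<mu> * (\<bar>y * y1\<bar> + \<bar>z * z1\<bar>)"
        using m by (intro mult_left_mono abs_triangle_ineq) auto
      with k[of y y1] k[of z z1] show ?thesis
        by (simp add: P0_def P1_def power_mult_distrib algebra_simps)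
    qed
    have X: "\<bar>\<theta>xx t x\<bar> \<le> 5 * K ^ 3 * \<mu> ^ 3 * n"
    proof -
      have "\<bar>\<mu> ^ 3 * p1 x ^ 3\<bar> \<le> \<mu> ^ 3 * K ^ 3"
        using m c by (simp add: abs_mult power_abs mult_left_mono power_mono)
      moreover have "\<bar>3 * \<mu>\<^sup>2 * p1 x * p2 x\<bar> \<le> 3 * (\<mu> ^ 3 * K ^ 3)"
      proof -
        have "\<bar>3 * \<mu>\<^sup>2 * p1 x * p2 x\<bar> = 3 * (\<mu>\<^sup>2 * (\<bar>p1 x\<bar> * \<bar>p2 x\<bar>))" by (simp add: abs_mult)
        also have "\<dots> \<le> 3 * (\<mu> ^ 3 * (K * K))"
          using m c by (intro mult_left_mono mult_mono power_increasing) auto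
        also have "\<dots> \<le> 3 * (\<mu> ^ 3 * K ^ 3)" using m KK by (intro mult_left_mono) (auto simp: power2_eq_square)
        finally show ?thesis .
      qed
      moreover have "\<bar>\<mu> * p3 x\<bar> \<le> \<mu> ^ 3 * K ^ 3"
      proof -
        have "\<bar>\<mu> * p3 x\<bar> = \<mu> * \<bar>p3 x\<bar>" using m by (simp add: abs_mult)
        also have "\<dots> \<le> \<mu> ^ 3 * K ^ 3" using m c KK self_le_power[of \<mu> 3] by (intro mult_mono) auto
        finally show ?thesis .
      qed
      ultimately have "\<bar>\<mu> ^ 3 * p1 x ^ 3 + 3 * \<mu>\<^sup>2 * p1 x * p2 x + \<mu> * p3 x\<bar> \<le> 5 * (\<mu> ^ 3 * K ^ 3)" by linarith
      then have "\<bar>\<mu> ^ 3 * p1 x ^ 3 + 3 * \<mu>\<^sup>2 * p1 x * p2 x + \<mu> * p3 x\<bar> * n \<le> 5 * (\<mu> ^ 3 * K ^ 3) * n"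
        using n by (intro mult_right_mono) auto
      then show ?thesis using n by (simp add: \<theta>xx_def abs_mult n_def[symmetric] mult_ac)
    qed
    have "\<bar>2 * \<theta>xx t x * (y * y1 + z * z1)\<bar> = \<bar>\<theta>xx t x\<bar> * (2 * \<bar>y * y1 + z * z1\<bar>)" by (simp add: abs_mult)
    also have "\<dots> \<le> (5 * K ^ 3 * \<mu> ^ 3 * n) * (2 * \<bar>y * y1 + z * z1\<bar>)" using X by (intro mult_right_mono) auto
    also have "\<dots> = (5 * K ^ 3 * \<mu>\<^sup>2 * n) * (2 * \<mu> * \<bar>y * y1 + z * z1\<bar>)" by (simp add: power_numeral_reduce)
    also have "\<dots> \<le> (5 * K ^ 3 * \<mu>\<^sup>2 * n) * (\<epsilon> * P1 + \<epsilon> * (\<mu>\<^sup>2 * n\<^sup>2 * P0))"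
      using W n c(4) by (intro mult_left_mono) auto
    also have "\<dots> = 5 * (K ^ 3 * \<epsilon> * (a + b))" by (simp add: a b algebra_simps power_numeral_reduce)
    finally show ?thesis .
  qed
  have tau: "\<bar>\<theta>t t x\<bar> \<le> K * \<epsilon> * (\<mu> * n\<^sup>2)"
  proof -
    have "\<bar>\<theta>t t x\<bar> = \<bar>p1 x\<bar> * \<bar>\<tau> t x\<bar> * (\<mu> * n)" using m n by (simp add: \<theta>t_def abs_mult n_def)
    also have "\<dots> \<le> K * (\<epsilon> * n) * (\<mu> * n)"
      using c m n tau_le[OF t, of x] by (intro mult_right_mono mult_mono) (auto simp: n_def)
    finally show ?thesis by (simp add: power2_eq_square mult_ac)
  qed
  have mu24: "\<mu>\<^sup>2 \<le> \<mu> ^ 4" "1 \<le> \<mu>\<^sup>2" using m by (auto intro: power_increasing)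
  have T4: "\<bar>4 * s * \<theta>t t x * (z * y1 - y * z1)\<bar> \<le> 2 * (K ^ 3 * \<epsilon> * (a + b))"
  proof -
    have k: "2 * (\<mu> * n) * \<bar>u * v\<bar> \<le> v\<^sup>2 + (\<mu> * n * u)\<^sup>2" for u v
    proof -
      have "0 \<le> (\<bar>v\<bar> - \<mu> * n * \<bar>u\<bar>)\<^sup>2" by auto
      then show ?thesis by (simp add: power2_diff power_mult_distrib abs_mult algebra_simps)
    qed
    have V: "2 * (\<mu> * n) * \<bar>z * y1 - y * z1\<bar> \<le> P1 + \<mu>\<^sup>2 * n\<^sup>2 * P0"
    proof -
      have "2 * (\<mu> * n) * \<bar>z * y1 - y * z1\<bar> \<le> 2 * (\<mu> * n) * (\<bar>z * y1\<bar> + \<bar>y * z1\<bar>)"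
        using m n by (intro mult_left_mono abs_triangle_ineq4) auto
      with k[of y z1] k[of z y1] show ?thesis
        by (simp add: P0_def P1_def power_mult_distrib algebra_simps)
    qed
    have "\<bar>4 * s * \<theta>t t x * (z * y1 - y * z1)\<bar> = 4 * \<bar>s\<bar> * \<bar>\<theta>t t x\<bar> * \<bar>z * y1 - y * z1\<bar>" by (simp add: abs_mult)
    also have "\<dots> \<le> 4 * 1 * (K * \<epsilon> * (\<mu> * n\<^sup>2)) * \<bar>z * y1 - y * z1\<bar>"
      using rs tau c m n by (intro mult_right_mono mult_mono) auto
    also have "\<dots> = 2 * (K * \<epsilon>) * (n * (2 * (\<mu> * n) * \<bar>z * y1 - y * z1\<bar>))" by (simp add: power2_eq_square)
    also have "\<dots> \<le> 2 * (K * \<epsilon>) * (n * (P1 + \<mu>\<^sup>2 * n\<^sup>2 * P0))"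
      using V n c m by (intro mult_left_mono) auto
    also have "n * (P1 + \<mu>\<^sup>2 * n\<^sup>2 * P0) = 1 * n * P1 + \<mu>\<^sup>2 * n ^ 3 * P0" by (simp add: algebra_simps power_numeral_reduce)
    also have "2 * (K * \<epsilon>) * (1 * n * P1 + \<mu>\<^sup>2 * n ^ 3 * P0) \<le> 2 * (K * \<epsilon>) * (a + b)"
      unfolding a b using mu24 n P c m by (intro mult_left_mono add_mono mult_right_mono) auto
    also have "\<dots> \<le> 2 * (K ^ 3 * \<epsilon>) * (a + b)"
      using KK ab m by (intro mult_right_mono mult_left_mono) auto
    finally show ?thesis by simp
  qed
  have T5: "\<bar>(4 * r * \<theta> t x * \<theta>t t x + \<rho>' t x) * P0\<bar> \<le> 5 * (K ^ 3 * \<epsilon> * b)"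
  proof -
    have th: "\<bar>\<theta> t x\<bar> \<le> K * (\<mu> * n)"
      using c m n by (simp add: abs_mult n_def[symmetric] mult.left_commute mult_right_mono)
    have "\<bar>4 * r * \<theta> t x * \<theta>t t x\<bar> = 4 * r * (\<bar>\<theta> t x\<bar> * \<bar>\<theta>t t x\<bar>)" using rs by (simp add: abs_mult)
    also have "\<dots> \<le> 4 * 1 * (K * (\<mu> * n) * (K * \<epsilon> * (\<mu> * n\<^sup>2)))"
      using rs th tau c m n by (intro mult_mono) auto
    also have "\<dots> = 4 * \<epsilon> * K\<^sup>2 * (\<mu>\<^sup>2 * n ^ 3)" by (simp add: power_numeral_reduce)
    also have "\<dots> \<le> 4 * \<epsilon> * K ^ 3 * (\<mu> ^ 4 * n ^ 3)"
      using KK mu24 n m c by (intro mult_mono mult_left_mono) auto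
    finally have 1: "\<bar>4 * r * \<theta> t x * \<theta>t t x\<bar> \<le> 4 * (K ^ 3 * \<epsilon> * (\<mu> ^ 4 * n ^ 3))" by (simp add: mult_ac)
    have "\<bar>\<rho>' t x\<bar> \<le> 1 * \<epsilon> * (1 * n ^ 3)" using rho_le(2)[OF t, of x] by (simp add: n_def)
    also have "\<dots> \<le> K ^ 3 * \<epsilon> * (\<mu> ^ 4 * n ^ 3)" using KK c(4) m n by (intro mult_mono) auto
    finally have 2: "\<bar>4 * r * \<theta> t x * \<theta>t t x + \<rho>' t x\<bar> \<le> 5 * (K ^ 3 * \<epsilon> * (\<mu> ^ 4 * n ^ 3))" using 1 by linarith
    have "\<bar>(4 * r * \<theta> t x * \<theta>t t x + \<rho>' t x) * P0\<bar> = \<bar>4 * r * \<theta> t x * \<theta>t t x + \<rho>' t x\<bar> * P0" using P by (simp add: abs_mult)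
    also have "\<dots> \<le> 5 * (K ^ 3 * \<epsilon> * (\<mu> ^ 4 * n ^ 3)) * P0" using 2 P by (intro mult_right_mono)
    finally show ?thesis by (simp add: b mult.assoc)
  qed
  \<comment> \<open>The error coefficients from \<open>T1\<close> to \<open>T5\<close> add up to at
    most 11 for a and 16 for b. Half of the main term 4 \<delta>^2 (a + b) pays for them, and this
    fixes the smallness required of \<epsilon>.\<close>
  have E: "20 * (K ^ 3 * \<epsilon> * (a + b)) \<le> 2 * \<delta>\<^sup>2 * (a + b)"
  proof -
    have "0 \<le> a + b" using ab by simp
    from mult_right_mono[OF eps_small this] show ?thesis by argo
  qed
  have nn: "0 \<le> K ^ 3 * \<epsilon> * a" "0 \<le> K ^ 3 * \<epsilon> * b" "0 \<le> Q * a" using ab m c Q by auto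
  have "2 * \<delta>\<^sup>2 * (a + b) \<le> 4 * \<theta>x t x * P1 + 4 * (\<theta> t x)\<^sup>2 * \<theta>x t x * P0
      + 2 * \<theta>xx t x * (y * y1 + z * z1) - 4 * s * \<theta>t t x * (z * y1 - y * z1)
      + (4 * r * \<theta> t x * \<theta>t t x + \<rho>' t x) * P0 + 2048 * (Q * (a + b))"
    using T1 T2 T3 T4 T5 E nn by (simp add: distrib_left abs_le_iff)
  then show ?thesis unfolding P0_def P1_def Q_def by (simp add: distrib_left distrib_right right_diff_distrib)
qed

end

section \<open>The estimate for the second-order factor\<close>

text \<open>X stands for the top-order integral, F for the right-hand side integral, l0 to l3 for
  the local integrals of \<eta> and its first three space derivatives, m2 and m3 for those of
  \<partial>_t \<eta> and \<partial>_t \<partial>_x \<eta>, A0 and A1 for the global integrals of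
  \<eta> and \<partial>_x \<eta>. Stated for real numbers, it shows that C depends only on the other
  constants.\<close>

definition absorbs :: "real \<Rightarrow> real \<Rightarrow> (real \<Rightarrow> real) \<Rightarrow> real \<Rightarrow> real \<Rightarrow> real \<Rightarrow> bool" where
  "absorbs c C1 D d K C \<longleftrightarrow> (\<forall>X F l0 l1 l2 m2 l3 m3 A0 A1 :: real.
     0 \<le> X \<longrightarrow> 0 \<le> F \<longrightarrow> 0 \<le> l0 \<longrightarrow> 0 \<le> l1 \<longrightarrow> 0 \<le> l2 \<longrightarrow> 0 \<le> m2 \<longrightarrow>
     c * X \<le> C1 * (F + l3 + m3 + l2 + m2) \<longrightarrow>
     (\<forall>\<eta>>0. l3 \<le> \<eta> * X + D \<eta> * l2) \<longrightarrow> (\<forall>\<eta>>0. m3 \<le> \<eta> * X + D \<eta> * m2) \<longrightarrow>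
     (\<forall>\<eta>>0. l2 \<le> \<eta> * X + D \<eta> * l1) \<longrightarrow> (\<forall>\<eta>>0. m2 \<le> \<eta> * X + D \<eta> * l0) \<longrightarrow>
     (\<forall>\<eta>>0. l1 \<le> \<eta> * X + D \<eta> * l0) \<longrightarrow>
     d * A1 \<le> K * X + 512 * l1 \<longrightarrow> d * A0 \<le> K * A1 + 512 * l0 \<longrightarrow>
     A0 + A1 + X \<le> C * (F + l0))"

text \<open>The local terms descend along l3, l2, l1, l0 and along m3, m2, l0. Each step may spend a
  small multiple of X, chosen after the coefficient accumulated so far is known.\<close>

lemma absorbs_exists:
  fixes c C1 d K :: real and D :: "real \<Rightarrow> real"
  assumes pos: "0 < c" "0 < C1" "0 < d" "0 < K" and D: "\<And>\<eta>. 0 < \<eta> \<Longrightarrow> 0 < D \<eta>"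
  shows "\<exists>C>0. absorbs c C1 D d K C"
proof -
  \<comment> \<open>Five portions of size e1 X are spent in total, so that after multiplication by
    C1 only 5/8 of c X is lost. The later e2 and e3 are scaled so that every portion equals e1
    X.\<close>
  define e1 where "e1 = c / (8 * C1)"
  \<comment> \<open>The 1 accounts for l2 and m2, which already occur on the right of the main
    inequality.\<close>
  define D1 where "D1 = D e1 + 1"
  define e2 where "e2 = e1 / D1"
  define D2 where "D2 = D1 * D e2"
  define e3 where "e3 = e1 / D2"
  define D3 where "D3 = D e3"
  have e1: "0 < e1" using pos by (simp add: e1_def)
  have D1: "0 < D1" using D[OF e1] by (simp add: D1_def)
  have e2: "0 < e2" using e1 D1 by (simp add: e2_def)
  have D2: "0 < D2" using D[OF e2] D1 by (simp add: D2_def)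
  have e3: "0 < e3" using e1 D2 by (simp add: e3_def)
  have D3: "0 < D3" using D[OF e3] by (simp add: D3_def)
  define C' where "C' = D2 * D3 + D2"
  have C': "0 < C'" using D2 D3 by (simp add: C'_def add_pos_pos)
  define CX where "CX = 3 * C1 * (1 + C') / c"
  define CL where "CL = e3 * CX + D3"
  define CA1 where "CA1 = (K * CX + 512 * CL) / d"
  define CA0 where "CA0 = (K * CA1 + 512) / d"
  have CX: "0 < CX" using pos C' by (simp add: CX_def)
  have CL: "0 < CL" using CX e3 D3 by (simp add: CL_def add_pos_pos)
  have CA1: "0 < CA1" using pos CX CL by (simp add: CA1_def add_pos_pos)
  have CA0: "0 < CA0" using pos CA1 by (simp add: CA0_def add_pos_pos)
  have "absorbs c C1 D d K (CA0 + CA1 + CX)"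
    unfolding absorbs_def
  proof (intro allI impI)
    fix X F l0 l1 l2 m2 l3 m3 A0 A1 :: real
    assume nn: "0 \<le> X" "0 \<le> F" "0 \<le> l0" "0 \<le> l1" "0 \<le> l2" "0 \<le> m2"
      and main: "c * X \<le> C1 * (F + l3 + m3 + l2 + m2)"
      and h: "\<forall>\<eta>>0. l3 \<le> \<eta> * X + D \<eta> * l2" "\<forall>\<eta>>0. m3 \<le> \<eta> * X + D \<eta> * m2"
        "\<forall>\<eta>>0. l2 \<le> \<eta> * X + D \<eta> * l1" "\<forall>\<eta>>0. m2 \<le> \<eta> * X + D \<eta> * l0"
        "\<forall>\<eta>>0. l1 \<le> \<eta> * X + D \<eta> * l0"
      and A: "d * A1 \<le> K * X + 512 * l1" "d * A0 \<le> K * A1 + 512 * l0"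
    have 1: "l3 + m3 + l2 + m2 \<le> 2 * (e1 * X) + D1 * l2 + D1 * m2"
      using h(1)[rule_format, OF e1] h(2)[rule_format, OF e1] by (simp add: D1_def algebra_simps)
    have 2: "D1 * l2 \<le> e1 * X + D2 * l1" "D1 * m2 \<le> e1 * X + D2 * l0"
    proof -
      have "D1 * l2 \<le> D1 * (e2 * X + D e2 * l1)" "D1 * m2 \<le> D1 * (e2 * X + D e2 * l0)"
        using h(3,4)[rule_format, OF e2] D1 by (intro mult_left_mono; simp)+
      moreover have "D1 * e2 = e1" using D1 by (simp add: e2_def)
      ultimately show "D1 * l2 \<le> e1 * X + D2 * l1" "D1 * m2 \<le> e1 * X + D2 * l0"
        by (simp_all add: D2_def distrib_left flip: mult.assoc)
    qed
    have l1: "l1 \<le> e3 * X + D3 * l0" using h(5)[rule_format, OF e3] by (simp add: D3_def)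
    have 3: "D2 * l1 \<le> e1 * X + D2 * D3 * l0"
    proof -
      have "D2 * l1 \<le> D2 * (e3 * X + D3 * l0)" using l1 D2 by (intro mult_left_mono) auto
      moreover have "D2 * e3 = e1" using D2 by (simp add: e3_def)
      ultimately show ?thesis by (simp add: distrib_left flip: mult.assoc)
    qed
    \<comment> \<open>Two portions come from l3 and m3, one each from l2, m2 and l1.\<close>
    have "F + l3 + m3 + l2 + m2 \<le> F + 5 * (e1 * X) + C' * l0"
      using 1 2 3 by (simp add: C'_def algebra_simps)
    then have "C1 * (F + l3 + m3 + l2 + m2) \<le> C1 * (F + 5 * (e1 * X) + C' * l0)"
      using pos by (intro mult_left_mono) auto
    also have "\<dots> = C1 * (F + C' * l0) + 5 * (C1 * e1) * X" by (simp add: algebra_simps)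
    also have "C1 * e1 = c / 8" using pos by (simp add: e1_def)
    finally have "3 * (c * X) \<le> 8 * (C1 * (F + C' * l0))" using main by simp
    also have "\<dots> \<le> 9 * (C1 * ((1 + C') * (F + l0)))"
    proof (rule mult_mono)
      show "C1 * (F + C' * l0) \<le> C1 * ((1 + C') * (F + l0))"
        using pos nn C' by (intro mult_left_mono) (auto simp: algebra_simps)
    qed (use pos nn C' in auto)
    finally have "c * X \<le> 3 * (C1 * ((1 + C') * (F + l0)))" by linarith
    then have "c * X \<le> 3 * C1 * (1 + C') * (F + l0)" by (simp only: mult.assoc)
    then have "X \<le> 3 * C1 * (1 + C') * (F + l0) / c" using pos by (simp only: pos_le_divide_eq mult.commute)
    then have X: "X \<le> CX * (F + l0)" by (simp add: CX_def)
    have L: "l1 \<le> CL * (F + l0)"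
    proof -
      have "e3 * X \<le> e3 * (CX * (F + l0))" using X e3 by (intro mult_left_mono) auto
      moreover have "D3 * l0 \<le> D3 * (F + l0)" using D3 nn by (intro mult_left_mono) auto
      ultimately show ?thesis using l1 by (simp add: CL_def algebra_simps)
    qed
    have A1: "A1 \<le> CA1 * (F + l0)"
    proof -
      have "K * X \<le> K * (CX * (F + l0))" using X pos by (intro mult_left_mono) auto
      then have "d * A1 \<le> (K * CX + 512 * CL) * (F + l0)" using A(1) L by (simp add: algebra_simps)
      then show ?thesis using pos by (simp add: CA1_def field_simps)
    qed
    have A0: "A0 \<le> CA0 * (F + l0)"
    proof -
      have "K * A1 \<le> K * (CA1 * (F + l0))" using A1 pos by (intro mult_left_mono) auto
      then have "d * A0 \<le> (K * CA1 + 512) * (F + l0)" using A(2) nn by (simp add: algebra_simps)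
      then show ?thesis using pos by (simp add: CA0_def field_simps)
    qed
    show "A0 + A1 + X \<le> (CA0 + CA1 + CX) * (F + l0)" using X A1 A0 by (simp add: algebra_simps)
  qed
  moreover have "0 < CA0 + CA1 + CX" using CA0 CA1 CX by simp
  ultimately show ?thesis by blast
qed

context carleman_weight
begin

section \<open>From the commutator to the estimate for \<eta>\<close>

lemma x_compI: "x_deriv T a a' \<Longrightarrow> (\<And>t x. 0 < t \<Longrightarrow> t < T \<Longrightarrow> a1 t x = a' t x + \<theta> t x * a t x) \<Longrightarrow> x_comp a a1"
  unfolding x_comp_def by (erule x_deriv_cong) simp

lemma t_compI: "t_deriv T a a' \<Longrightarrow> (\<And>t x. 0 < t \<Longrightarrow> t < T \<Longrightarrow> a1 t x = a' t x + \<rho> t x * a t x) \<Longrightarrow> t_comp a a1"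
  unfolding t_comp_def by (erule t_deriv_cong) simp

text \<open>The last two companions coincide because the t-derivative of \<theta> equals the
  x-derivative of \<rho>; this is the single mixed derivative that the commutator identity
  expects.\<close>

lemma jet_comps:
  assumes d: "x_deriv T U Ux" "x_deriv T Ux Uxx" "t_deriv T U Ut" "t_deriv T Ux Uxt" "x_deriv T Ut Uxt"
  shows "x_comp U (\<lambda>t x. Ux t x + \<theta> t x * U t x)"
    and "x_comp (\<lambda>t x. Ux t x + \<theta> t x * U t x) (\<lambda>t x. Uxx t x + 2 * \<theta> t x * Ux t x + ((\<theta> t x)\<^sup>2 + \<theta>x t x) * U t x)"
    and "t_comp U (\<lambda>t x. Ut t x + \<rho> t x * U t x)"
    and "t_comp (\<lambda>t x. Ux t x + \<theta> t x * U t x)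
      (\<lambda>t x. Uxt t x + \<rho> t x * Ux t x + \<theta> t x * Ut t x + (\<theta> t x * \<rho> t x + \<theta>t t x) * U t x)"
    and "x_comp (\<lambda>t x. Ut t x + \<rho> t x * U t x)
      (\<lambda>t x. Uxt t x + \<rho> t x * Ux t x + \<theta> t x * Ut t x + (\<theta> t x * \<rho> t x + \<theta>t t x) * U t x)"
proof -
  show "x_comp U (\<lambda>t x. Ux t x + \<theta> t x * U t x)" by (rule x_compI[OF d(1)]) simp
  show "x_comp (\<lambda>t x. Ux t x + \<theta> t x * U t x) (\<lambda>t x. Uxx t x + 2 * \<theta> t x * Ux t x + ((\<theta> t x)\<^sup>2 + \<theta>x t x) * U t x)"
    by (rule x_compI[OF x_deriv_add[OF d(2) x_deriv_mult[OF theta_deriv(1) d(1)]]])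
       (simp add: algebra_simps power2_eq_square)
  show "t_comp U (\<lambda>t x. Ut t x + \<rho> t x * U t x)" by (rule t_compI[OF d(3)]) simp
  show "t_comp (\<lambda>t x. Ux t x + \<theta> t x * U t x)
      (\<lambda>t x. Uxt t x + \<rho> t x * Ux t x + \<theta> t x * Ut t x + (\<theta> t x * \<rho> t x + \<theta>t t x) * U t x)"
    by (rule t_compI[OF t_deriv_add[OF d(4) t_deriv_mult[OF theta_deriv(3) d(3)]]])
       (simp add: algebra_simps)
  show "x_comp (\<lambda>t x. Ut t x + \<rho> t x * U t x)
      (\<lambda>t x. Uxt t x + \<rho> t x * Ux t x + \<theta> t x * Ut t x + (\<theta> t x * \<rho> t x + \<theta>t t x) * U t x)"
    by (rule x_compI[OF x_deriv_add[OF d(5) x_deriv_mult[OF theta_deriv(4) d(1)]]])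
       (simp add: algebra_simps)
qed

text \<open>The sizes |\<theta>| \<le> K \<mu> N, |\<theta>x| \<le> 2 K^2 \<mu>^2 N and |\<rho>|
  \<le> N^2, in the form consumed by \<open>jet_recovery\<close>.\<close>

lemma theta_bounds:
  fixes t x :: real
  assumes t: "0 < t" "t < T"
  defines "A \<equiv> \<mu>\<^sup>2 * N t x" and "B \<equiv> \<mu> ^ 4 * N t x ^ 3"
  shows "(\<theta> t x)\<^sup>2 \<le> K\<^sup>2 * (A * N t x)" "(\<theta> t x) ^ 4 \<le> K ^ 4 * (B * N t x)" "(\<theta>x t x)\<^sup>2 \<le> 4 * K ^ 4 * (B * N t x)"
    "(\<rho> t x)\<^sup>2 \<le> B * N t x" "A * (\<theta> t x)\<^sup>2 \<le> K\<^sup>2 * B"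
proof -
  define n where "n = N t x"
  have n: "1 \<le> n" using N_ge1[OF t, of x] by (simp add: n_def)
  have m: "1 \<le> \<mu>" "0 < \<epsilon>" "\<epsilon> \<le> 1" using mu_ge1 eps by auto
  have p: "(p1 x)\<^sup>2 \<le> K\<^sup>2" "p1 x ^ 4 \<le> K ^ 4"
    using p_le(1)[of x] power_mono[of "\<bar>p1 x\<bar>" K 2] power_mono[of "\<bar>p1 x\<bar>" K 4] by auto
  have th: "\<theta> t x = p1 x * (\<mu> * n)" by (simp add: n_def)
  have "(p1 x)\<^sup>2 * (\<mu> * n)\<^sup>2 \<le> K\<^sup>2 * (\<mu> * n)\<^sup>2" using p by (intro mult_right_mono) auto
  then show 1: "(\<theta> t x)\<^sup>2 \<le> K\<^sup>2 * (A * N t x)"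
    unfolding th A_def n_def[symmetric] by (simp add: power_mult_distrib power2_eq_square mult_ac)
  have "(p1 x) ^ 4 * (\<mu> * n) ^ 4 \<le> K ^ 4 * (\<mu> * n) ^ 4" using p by (intro mult_right_mono) auto
  then show "(\<theta> t x) ^ 4 \<le> K ^ 4 * (B * N t x)"
    unfolding th B_def n_def[symmetric] by (simp add: power_mult_distrib power_numeral_reduce mult_ac)
  show "(\<theta>x t x)\<^sup>2 \<le> 4 * K ^ 4 * (B * N t x)"
  proof -
    have K2: "K \<le> K\<^sup>2" using K1 self_le_power[of K 2] by simp
    have m2: "\<mu> \<le> \<mu>\<^sup>2" using m self_le_power[of \<mu> 2] by simp
    have "\<bar>\<mu>\<^sup>2 * p1 x ^ 2 + \<mu> * p2 x\<bar> \<le> \<mu>\<^sup>2 * (p1 x)\<^sup>2 + \<mu> * \<bar>p2 x\<bar>"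
      using m by (intro order_trans[OF abs_triangle_ineq]) (simp add: abs_mult)
    also have "\<dots> \<le> \<mu>\<^sup>2 * K\<^sup>2 + \<mu>\<^sup>2 * K\<^sup>2"
      using p p_le(2)[of x] K2 m m2 by (intro add_mono mult_mono) auto
    finally have "\<bar>\<mu>\<^sup>2 * p1 x ^ 2 + \<mu> * p2 x\<bar> * n \<le> (\<mu>\<^sup>2 * K\<^sup>2 + \<mu>\<^sup>2 * K\<^sup>2) * n"
      using n by (intro mult_right_mono) auto
    then have "\<bar>\<theta>x t x\<bar> \<le> 2 * (\<mu>\<^sup>2 * K\<^sup>2) * n"
      using n by (simp add: \<theta>x_def abs_mult n_def[symmetric] mult.commute)
    then have "\<bar>\<theta>x t x\<bar>\<^sup>2 \<le> (2 * (\<mu>\<^sup>2 * K\<^sup>2) * n)\<^sup>2" by (intro power_mono) auto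
    also have "\<dots> = 4 * K ^ 4 * (\<mu> ^ 4 * n\<^sup>2)" by (simp add: power_mult_distrib flip: power_mult)
    also have "\<dots> \<le> 4 * K ^ 4 * (\<mu> ^ 4 * n ^ 4)"
      using n m by (intro mult_left_mono power_increasing) auto
    finally show ?thesis by (simp add: B_def n_def[symmetric] power_numeral_reduce mult_ac)
  qed
  show "(\<rho> t x)\<^sup>2 \<le> B * N t x"
  proof -
    have "\<bar>\<rho> t x\<bar> \<le> 1 * n\<^sup>2" using rho_le(1)[OF t, of x] mult_right_mono[OF m(3), of "n\<^sup>2"] by (simp add: n_def)
    then have "\<bar>\<rho> t x\<bar>\<^sup>2 \<le> (1 * n\<^sup>2)\<^sup>2" by (intro power_mono) auto
    also have "\<dots> \<le> \<mu> ^ 4 * n ^ 4" using m one_le_power[of \<mu> 4] n by (simp flip: power_mult)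
    finally show ?thesis by (simp add: B_def n_def[symmetric] power_numeral_reduce mult_ac)
  qed
  have "A * (\<theta> t x)\<^sup>2 \<le> A * (K\<^sup>2 * (A * N t x))" using 1 n by (intro mult_left_mono) (auto simp: A_def n_def[symmetric])
  also have "\<dots> = K\<^sup>2 * B" by (simp add: A_def B_def power_numeral_reduce)
  finally show "A * (\<theta> t x)\<^sup>2 \<le> K\<^sup>2 * B" .
qed

text \<open>With a = r + \<i> s, the functions g1 and g2 are the real and imaginary parts of cnj a
  (\<partial>_t - a \<partial>_x^2) (U + \<i> V). After conjugation this is M1 + M2, whose square is
  the sum of the two squares and twice the cross term. The lower bound for the cross term, together
  with the squares, feeds \<open>jet_recovery\<close>.\<close>

lemma pair_estimate:
  assumes m: "moderate T U" "moderate T Ux" "moderate T Uxx" "moderate T Ut" "moderate T Uxt"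
      "moderate T V" "moderate T Vx" "moderate T Vxx" "moderate T Vt" "moderate T Vxt"
      "moderate T g1" "moderate T g2"
    and dU: "x_deriv T U Ux" "x_deriv T Ux Uxx" "t_deriv T U Ut" "t_deriv T Ux Uxt" "x_deriv T Ut Uxt"
    and dV: "x_deriv T V Vx" "x_deriv T Vx Vxx" "t_deriv T V Vt" "t_deriv T Vx Vxt" "x_deriv T Vt Vxt"
    and g: "\<And>t x. 0 < t \<Longrightarrow> t < T \<Longrightarrow> g1 t x = r * Ut t x + s * Vt t x - Uxx t x"
      "\<And>t x. 0 < t \<Longrightarrow> t < T \<Longrightarrow> g2 t x = r * Vt t x - s * Ut t x - Vxx t x"
    and rs: "r\<^sup>2 + s\<^sup>2 = 1" "0 < r"
  shows "\<delta>\<^sup>2 * r\<^sup>2 * I (\<lambda>t x. \<mu> ^ 4 * N t x ^ 3 * ((U t x)\<^sup>2 + (V t x)\<^sup>2) + \<mu>\<^sup>2 * N t x * ((Ux t x)\<^sup>2 + (Vx t x)\<^sup>2)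
      + ((Ut t x)\<^sup>2 + (Vt t x)\<^sup>2 + (Uxx t x)\<^sup>2 + (Vxx t x)\<^sup>2) / N t x)
    \<le> 400 * K ^ 4 * (I (\<lambda>t x. (g1 t x)\<^sup>2 + (g2 t x)\<^sup>2)
      + 6144 * K\<^sup>2 * I (\<lambda>t x. q x ^ 8 * (\<mu>\<^sup>2 * N t x * ((Ux t x)\<^sup>2 + (Vx t x)\<^sup>2) + \<mu> ^ 4 * N t x ^ 3 * ((U t x)\<^sup>2 + (V t x)\<^sup>2))))"
proof -
  note mm = m theta_moderate weight_intros
  have rs1: "r\<^sup>2 \<le> 1" "s\<^sup>2 \<le> 1" using rs(1) zero_le_power2[of r] zero_le_power2[of s] by linarith+
  then have rs2: "r \<le> 1" "\<bar>s\<bar> \<le> 1" using rs(2) abs_square_le_1[of r] abs_square_le_1[of s] by auto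
  define y1 where "y1 = (\<lambda>t x. Ux t x + \<theta> t x * U t x)"
  define y2 where "y2 = (\<lambda>t x. Uxx t x + 2 * \<theta> t x * Ux t x + ((\<theta> t x)\<^sup>2 + \<theta>x t x) * U t x)"
  define yt where "yt = (\<lambda>t x. Ut t x + \<rho> t x * U t x)"
  define y1t where "y1t = (\<lambda>t x. Uxt t x + \<rho> t x * Ux t x + \<theta> t x * Ut t x + (\<theta> t x * \<rho> t x + \<theta>t t x) * U t x)"
  define z1 where "z1 = (\<lambda>t x. Vx t x + \<theta> t x * V t x)"
  define z2 where "z2 = (\<lambda>t x. Vxx t x + 2 * \<theta> t x * Vx t x + ((\<theta> t x)\<^sup>2 + \<theta>x t x) * V t x)"
  define zt where "zt = (\<lambda>t x. Vt t x + \<rho> t x * V t x)"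
  define z1t where "z1t = (\<lambda>t x. Vxt t x + \<rho> t x * Vx t x + \<theta> t x * Vt t x + (\<theta> t x * \<rho> t x + \<theta>t t x) * V t x)"
  have my: "moderate T y1" "moderate T y2" "moderate T yt" "moderate T y1t"
      "moderate T z1" "moderate T z2" "moderate T zt" "moderate T z1t"
    unfolding y1_def y2_def yt_def y1t_def z1_def z2_def zt_def z1t_def by (intro mm)+
  note my = my mm
  define M1y where "M1y = (\<lambda>t x. - y2 t x - (\<theta> t x)\<^sup>2 * U t x - r * \<rho> t x * U t x + s * zt t x)"
  define M1z where "M1z = (\<lambda>t x. - z2 t x - (\<theta> t x)\<^sup>2 * V t x - r * \<rho> t x * V t x - s * yt t x)"
  define M2y where "M2y = (\<lambda>t x. 2 * \<theta> t x * y1 t x + \<theta>x t x * U t x + r * yt t x - s * \<rho> t x * V t x)"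
  define M2z where "M2z = (\<lambda>t x. 2 * \<theta> t x * z1 t x + \<theta>x t x * V t x + r * zt t x + s * \<rho> t x * U t x)"
  define X where "X = (\<lambda>t x. 2 * \<theta>x t x * ((y1 t x)\<^sup>2 + (z1 t x)\<^sup>2) + 2 * (\<theta> t x)\<^sup>2 * \<theta>x t x * ((U t x)\<^sup>2 + (V t x)\<^sup>2)
      + \<theta>xx t x * (U t x * y1 t x + V t x * z1 t x) - 2 * s * \<theta>t t x * (V t x * y1 t x - U t x * z1 t x)
      + (2 * r * \<theta> t x * \<theta>t t x + \<rho>' t x / 2) * ((U t x)\<^sup>2 + (V t x)\<^sup>2))"
  have comm: "I (\<lambda>t x. M1y t x * M2y t x + M1z t x * M2z t x) = I X"
    unfolding M1y_def M1z_def M2y_def M2z_def X_def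
    by (rule commutator_identity[OF m(1) my(1-4) m(6) my(5-8) jet_comps[OF dU, folded y1_def y2_def yt_def y1t_def]
          jet_comps[OF dV, folded z1_def z2_def zt_def z1t_def] rs(1)])
  have mM: "moderate T M1y" "moderate T M1z" "moderate T M2y" "moderate T M2z" "moderate T X"
    unfolding M1y_def M1z_def M2y_def M2z_def X_def by (intro my)+
  let ?M = "\<lambda>t x. (M1y t x)\<^sup>2 + (M1z t x)\<^sup>2 + (M2y t x)\<^sup>2 + (M2z t x)\<^sup>2"
  have "I (\<lambda>t x. (g1 t x)\<^sup>2 + (g2 t x)\<^sup>2) = I (\<lambda>t x. ?M t x + 2 * (M1y t x * M2y t x + M1z t x * M2z t x))"
  proof (rule I_cong)
    fix t x assume t: "0 < t" "t < T"
    have "g1 t x = M1y t x + M2y t x" "g2 t x = M1z t x + M2z t x"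
      unfolding g[OF t] M1y_def M2y_def M1z_def M2z_def y1_def y2_def z1_def z2_def yt_def zt_def
      by (simp_all add: algebra_simps power2_eq_square)
    then show "(g1 t x)\<^sup>2 + (g2 t x)\<^sup>2 = ?M t x + 2 * (M1y t x * M2y t x + M1z t x * M2z t x)"
      by (simp add: power2_eq_square algebra_simps)
  qed
  also have "\<dots> = I ?M + 2 * I (\<lambda>t x. M1y t x * M2y t x + M1z t x * M2z t x)"
    unfolding I_cmult[symmetric] by (rule I_add) (intro mM weight_intros)+
  also have "\<dots> = I (\<lambda>t x. ?M t x + 2 * X t x)"
    unfolding comm I_cmult[symmetric] by (rule I_add[symmetric]) (intro mM weight_intros)+
  finally have f: "I (\<lambda>t x. (g1 t x)\<^sup>2 + (g2 t x)\<^sup>2) = I (\<lambda>t x. ?M t x + 2 * X t x)" .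
  let ?W = "\<lambda>t x. \<mu> ^ 4 * N t x ^ 3 * ((U t x)\<^sup>2 + (V t x)\<^sup>2) + \<mu>\<^sup>2 * N t x * ((Ux t x)\<^sup>2 + (Vx t x)\<^sup>2)
      + ((Ut t x)\<^sup>2 + (Vt t x)\<^sup>2 + (Uxx t x)\<^sup>2 + (Vxx t x)\<^sup>2) / N t x"
  let ?L = "\<lambda>t x. q x ^ 8 * (\<mu>\<^sup>2 * N t x * ((Ux t x)\<^sup>2 + (Vx t x)\<^sup>2) + \<mu> ^ 4 * N t x ^ 3 * ((U t x)\<^sup>2 + (V t x)\<^sup>2))"
  have "I (\<lambda>t x. \<delta>\<^sup>2 * r\<^sup>2 * ?W t x) \<le> I (\<lambda>t x. 400 * K ^ 4 * ((?M t x + 2 * X t x) + 6144 * K\<^sup>2 * ?L t x))"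
  proof (rule I_mono)
    fix t x assume t: "0 < t" "t < T"
    define n where "n = N t x"
    have n: "1 \<le> n" using N_ge1[OF t, of x] by (simp add: n_def)
    define A where "A = \<mu>\<^sup>2 * n" define B where "B = \<mu> ^ 4 * n ^ 3"
    have AB: "0 \<le> A" "0 \<le> B" using n mu by (auto simp: A_def B_def)
    note tb = theta_bounds[OF t, of x, folded n_def, folded A_def B_def]
    define a where "a = A * ((y1 t x)\<^sup>2 + (z1 t x)\<^sup>2)" define b where "b = B * ((U t x)\<^sup>2 + (V t x)\<^sup>2)"
    define a' where "a' = A * ((Ux t x)\<^sup>2 + (Vx t x)\<^sup>2)"
    have ab: "0 \<le> a" "0 \<le> b" "0 \<le> a'" using AB by (auto simp: a_def b_def a'_def)
    have S: "r\<^sup>2 * ?W t x \<le> 400 * K ^ 4 * (?M t x + a + b)"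
    proof -
      have th: "\<mu> * p1 x * n = \<theta> t x" by (simp add: n_def)
      have e: "y1 t x - \<theta> t x * U t x = Ux t x" "z1 t x - \<theta> t x * V t x = Vx t x"
        "yt t x - \<rho> t x * U t x = Ut t x" "zt t x - \<rho> t x * V t x = Vt t x"
        "y2 t x - 2 * \<theta> t x * y1 t x + ((\<theta> t x)\<^sup>2 - \<theta>x t x) * U t x = Uxx t x"
        "z2 t x - 2 * \<theta> t x * z1 t x + ((\<theta> t x)\<^sup>2 - \<theta>x t x) * V t x = Vxx t x"
        by (simp_all add: y1_def y2_def yt_def z1_def z2_def zt_def algebra_simps power2_eq_square)
      show ?thesis
        using jet_recovery[OF n AB K1 rs(2) rs2(1) rs1(2) tb[unfolded th],
            where ?y2.0 = "y2 t x" and y = "U t x" and zt = "zt t x" and ?z2.0 = "z2 t x" and z = "V t x" and yt = "yt t x"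
              and ?y1.0 = "y1 t x" and ?z1.0 = "z1 t x"]
        unfolding e by (simp add: M1y_def M1z_def M2y_def M2z_def a_def b_def A_def B_def n_def add.assoc mult.assoc)
    qed
    have lower: "2 * \<delta>\<^sup>2 * (a + b) \<le> 2 * X t x + 2048 * (q x ^ 8 * (a + b))"
      using commutator_lower_bound[OF t less_imp_le[OF rs(2)] rs2, of x "y1 t x" "z1 t x" "U t x" "V t x"]
      by (simp add: X_def a_def b_def A_def B_def n_def)
    \<comment> \<open>The commutator controls a + b only with the factor \<delta>^2, so the squares
      of M1 and M2 are weakened to match.\<close>
    have d: "\<delta>\<^sup>2 * v \<le> v" if "0 \<le> v" for v
      using mult_right_mono[OF power_le_one[of \<delta> 2] that] delta by simp
    have dS: "\<delta>\<^sup>2 * (?M t x + a + b) \<le> ?M t x + 2 * X t x + 2048 * (q x ^ 8 * (a + b))"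
    proof -
      have "\<delta>\<^sup>2 * ?M t x \<le> ?M t x" by (intro d add_nonneg_nonneg) auto
      moreover have "0 \<le> \<delta>\<^sup>2 * (a + b)" using ab by simp
      moreover have "\<delta>\<^sup>2 * (?M t x + a + b) = \<delta>\<^sup>2 * ?M t x + \<delta>\<^sup>2 * (a + b)" by (simp add: algebra_simps)
      ultimately show ?thesis using lower by argo
    qed
    have K2: "1 \<le> K\<^sup>2" using K1 by simp
    \<comment> \<open>The local term is moved back from the conjugated derivative y1 to Ux. The
      factor 3 K^2 turns 2048 into 6144 K^2.\<close>
    have "a + b \<le> 3 * K\<^sup>2 * (a' + b)"
    proof -
      have k: "A * (v + \<theta> t x * u)\<^sup>2 \<le> 2 * (A * v\<^sup>2) + 2 * K\<^sup>2 * (B * u\<^sup>2)" for u v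
      proof -
        have "A * (v + \<theta> t x * u)\<^sup>2 \<le> A * (2 * v\<^sup>2 + 2 * (\<theta> t x * u)\<^sup>2)"
          using AB square_add2 by (intro mult_left_mono) auto
        also have "\<dots> = 2 * (A * v\<^sup>2) + 2 * ((A * (\<theta> t x)\<^sup>2) * u\<^sup>2)" by (simp add: power_mult_distrib algebra_simps)
        also have "\<dots> \<le> 2 * (A * v\<^sup>2) + 2 * ((K\<^sup>2 * B) * u\<^sup>2)"
          using tb(5) by (intro add_left_mono mult_left_mono square_mult_le) (auto simp: n_def)
        finally show ?thesis by (simp add: mult.assoc)
      qed
      have "a \<le> 2 * a' + 2 * K\<^sup>2 * b"
        using k[of "Ux t x" "U t x"] k[of "Vx t x" "V t x"]
        by (simp add: a_def a'_def b_def y1_def z1_def distrib_left)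
      moreover have "a' \<le> K\<^sup>2 * a'" "b \<le> K\<^sup>2 * b" using mult_right_mono[OF K2] ab by (metis mult_1)+
      moreover have "0 \<le> K\<^sup>2 * a'" using ab by simp
      ultimately show ?thesis by (simp add: distrib_left)
    qed
    then have "q x ^ 8 * (a + b) \<le> q x ^ 8 * (3 * K\<^sup>2 * (a' + b))"
      using q01[of x] by (intro mult_left_mono) auto
    also have "\<dots> = 3 * K\<^sup>2 * ?L t x" by (simp add: a'_def b_def A_def B_def n_def)
    finally have q: "q x ^ 8 * (a + b) \<le> 3 * K\<^sup>2 * ?L t x" .
    have "\<delta>\<^sup>2 * (r\<^sup>2 * ?W t x) \<le> \<delta>\<^sup>2 * (400 * K ^ 4 * (?M t x + a + b))"
      using S by (intro mult_left_mono) auto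
    also have "\<dots> = 400 * K ^ 4 * (\<delta>\<^sup>2 * (?M t x + a + b))" by simp
    also have "\<dots> \<le> 400 * K ^ 4 * ((?M t x + 2 * X t x) + 6144 * K\<^sup>2 * ?L t x)"
      using dS q K1 by (intro mult_left_mono) auto
    finally show "\<delta>\<^sup>2 * r\<^sup>2 * ?W t x \<le> 400 * K ^ 4 * ((?M t x + 2 * X t x) + 6144 * K\<^sup>2 * ?L t x)"
      by (simp only: mult.assoc)
  qed (intro my mM)+
  also have "\<dots> = 400 * K ^ 4 * (I (\<lambda>t x. ?M t x + 2 * X t x) + 6144 * K\<^sup>2 * I ?L)"
  proof -
    have "I (\<lambda>t x. (?M t x + 2 * X t x) + 6144 * K\<^sup>2 * ?L t x) = I (\<lambda>t x. ?M t x + 2 * X t x) + 6144 * K\<^sup>2 * I ?L"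
      unfolding I_cmult[of "6144 * K\<^sup>2", symmetric] by (rule I_add) (intro mM my)+
    then show ?thesis unfolding I_cmult by simp
  qed
  finally show ?thesis unfolding f I_cmult .
qed

text \<open>\<open>E j i\<close> stands for the derivative of \<eta> of order j in time and i in
  space. C enters through a hypothesis that mentions neither the weights nor \<eta>, so one choice
  serves all of them.\<close>

lemma carleman_estimate:
  fixes E :: "nat \<Rightarrow> nat \<Rightarrow> real \<Rightarrow> real \<Rightarrow> real"
  assumes E: "\<And>j i. j \<le> 2 \<Longrightarrow> i \<le> 4 \<Longrightarrow> moderate T (E j i)"
      "\<And>j i. j \<le> 2 \<Longrightarrow> i < 4 \<Longrightarrow> x_deriv T (E j i) (E j (Suc i))"
      "\<And>j i. j < 2 \<Longrightarrow> i \<le> 4 \<Longrightarrow> t_deriv T (E j i) (E (Suc j) i)"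
    and rs: "r\<^sup>2 + s\<^sup>2 = 1" "0 < r" "0 < s"
    and C: "absorbs (\<delta>\<^sup>2 * r\<^sup>2 * s\<^sup>2) (1200 * K ^ 4 * (18432 * K\<^sup>2))
      (\<lambda>\<eta>. 25 + (11 * K)\<^sup>2 + 1 / \<eta>) (\<delta>\<^sup>2) (2 * K\<^sup>2) C"
  shows "I (\<lambda>t x. \<mu> ^ 8 * N t x ^ 7 * (E 0 0 t x)\<^sup>2) + I (\<lambda>t x. \<mu> ^ 6 * N t x ^ 5 * (E 0 1 t x)\<^sup>2)
      + I (\<lambda>t x. \<mu> ^ 4 * N t x ^ 3 * ((E 0 2 t x)\<^sup>2 + (E 1 0 t x)\<^sup>2)
        + \<mu>\<^sup>2 * N t x * ((E 0 3 t x)\<^sup>2 + (E 1 1 t x)\<^sup>2)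
        + ((E 0 4 t x)\<^sup>2 + (E 2 0 t x)\<^sup>2 + (E 1 2 t x)\<^sup>2) / N t x)
    \<le> C * (I (\<lambda>t x. (E 2 0 t x - 2 * r * E 1 2 t x + E 0 4 t x)\<^sup>2)
      + I (\<lambda>t x. q x ^ 2 * (\<mu> ^ 8 * N t x ^ 7 * (E 0 0 t x)\<^sup>2)))"
proof -
  have m: "moderate T (E j i)" if "j \<in> {0, 1, 2}" "i \<in> {0, 1, 2, 3, 4}" for j i
    using E(1) that by auto
  have x: "x_deriv T (E j 0) (E j 1)" "x_deriv T (E j 1) (E j 2)" "x_deriv T (E j 2) (E j 3)" "x_deriv T (E j 3) (E j 4)"
    if "j \<in> {0, 1, 2}" for j
    using E(2)[of j 0] E(2)[of j 1] E(2)[of j 2] E(2)[of j 3] that by (auto simp: numeral_eq_Suc)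
  have tt: "t_deriv T (E 0 i) (E 1 i)" "t_deriv T (E 1 i) (E 2 i)" if "i \<in> {0, 1, 2, 3, 4}" for i
    using E(3)[of 0 i] E(3)[of 1 i] that by (auto simp: numeral_eq_Suc)
  define X where "X = (\<lambda>t x. \<mu> ^ 4 * N t x ^ 3 * ((E 0 2 t x)\<^sup>2 + (E 1 0 t x)\<^sup>2)
        + \<mu>\<^sup>2 * N t x * ((E 0 3 t x)\<^sup>2 + (E 1 1 t x)\<^sup>2)
        + ((E 0 4 t x)\<^sup>2 + (E 2 0 t x)\<^sup>2 + (E 1 2 t x)\<^sup>2) / N t x)"
  define f where "f = (\<lambda>t x. E 2 0 t x - 2 * r * E 1 2 t x + E 0 4 t x)"
  have mX: "moderate T X" "moderate T f"
    unfolding X_def f_def by (intro weight_intros m; simp)+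
  have s1: "s\<^sup>2 \<le> 1" "r\<^sup>2 \<le> 1" using rs(1) zero_le_power2[of r] zero_le_power2[of s] by linarith+
  \<comment> \<open>The exponents 8, 6, 4, 2 of the cutoff leave two powers for each space
    interpolation from l3 down to l0. From m2 a single interpolation in time leads straight to
    l0.\<close>
  define l0 where "l0 = I (\<lambda>t x. q x ^ 2 * (\<mu> ^ 8 * N t x ^ 7 * (E 0 0 t x)\<^sup>2))"
  define l1 where "l1 = I (\<lambda>t x. q x ^ 4 * (\<mu> ^ 6 * N t x ^ 5 * (E 0 1 t x)\<^sup>2))"
  define l2 where "l2 = I (\<lambda>t x. q x ^ 6 * (\<mu> ^ 4 * N t x ^ 3 * (E 0 2 t x)\<^sup>2))"
  define m2 where "m2 = I (\<lambda>t x. q x ^ 6 * (\<mu> ^ 4 * N t x ^ 3 * (E 1 0 t x)\<^sup>2))"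
  define l3 where "l3 = I (\<lambda>t x. q x ^ 8 * (\<mu>\<^sup>2 * N t x * (E 0 3 t x)\<^sup>2))"
  define m3 where "m3 = I (\<lambda>t x. q x ^ 8 * (\<mu>\<^sup>2 * N t x * (E 1 1 t x)\<^sup>2))"
  have nn: "0 \<le> I X" "0 \<le> I (\<lambda>t x. (f t x)\<^sup>2)" "0 \<le> l0" "0 \<le> l1" "0 \<le> l2" "0 \<le> m2"
  proof -
    have n: "0 \<le> N t x" if "0 < t" "t < T" for t x using N_pos[OF that, of x] by simp
    note nonneg = add_nonneg_nonneg mult_nonneg_nonneg divide_nonneg_nonneg zero_le_power zero_le_power2 q01(1) n less_imp_le[OF mu(2)]
    show "0 \<le> I X" unfolding X_def by (rule I_nonneg) (intro nonneg; assumption)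
    show "0 \<le> I (\<lambda>t x. (f t x)\<^sup>2)" by (rule I_nonneg) simp
    show "0 \<le> l0" "0 \<le> l1" "0 \<le> l2" "0 \<le> m2"
      unfolding l0_def l1_def l2_def m2_def by (rule I_nonneg, (intro nonneg; assumption))+
  qed
  \<comment> \<open>U + \<i> V is the second factor applied to \<eta>; j and i count further
    derivatives in time and space.\<close>
  define U where "U = (\<lambda>j i t x. E (Suc j) i t x - r * E j (i + 2) t x)"
  define V where "V = (\<lambda>j i t x. s * E j (i + 2) t x)"
  have mUV: "moderate T (U j i)" "moderate T (V j i)" if "j \<le> 1" "i \<le> 2" for j i
    unfolding U_def V_def by (intro weight_intros E(1); use that in simp)+
  have xUV: "x_deriv T (U j i) (U j (Suc i))" "x_deriv T (V j i) (V j (Suc i))" if "j \<le> 1" "i < 2" for j i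
  proof -
    have a: "x_deriv T (E j (i + 2)) (E j (Suc i + 2))" using E(2)[of j "i + 2"] that by simp
    have b: "x_deriv T (E (Suc j) i) (E (Suc j) (Suc i))" using E(2)[of "Suc j" i] that by simp
    have c: "x_deriv T (\<lambda>t x. c * F t x) (\<lambda>t x. c * F' t x)" if "x_deriv T F F'" for c F F'
      by (rule x_deriv_cong[OF x_deriv_mult[OF x_deriv_const that]]) simp
    show "x_deriv T (U j i) (U j (Suc i))" unfolding U_def by (rule x_deriv_diff[OF b c[OF a]])
    show "x_deriv T (V j i) (V j (Suc i))" unfolding V_def by (rule c[OF a])
  qed
  have tUV: "t_deriv T (U 0 i) (U 1 i)" "t_deriv T (V 0 i) (V 1 i)" if "i \<le> 2" for i
  proof -
    have a: "t_deriv T (E 0 (i + 2)) (E 1 (i + 2))" using E(3)[of 0 "i + 2"] that by simp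
    have b: "t_deriv T (E (Suc 0) i) (E (Suc 1) i)" using E(3)[of 1 i] that by simp
    have c: "t_deriv T (\<lambda>t x. c * F t x) (\<lambda>t x. c * F' t x)" if "t_deriv T F F'" for c F F'
      by (rule t_deriv_cong[OF t_deriv_mult[OF t_deriv_const that]]) simp
    show "t_deriv T (U 0 i) (U 1 i)" unfolding U_def by (rule t_deriv_diff[OF b c[OF a]])
    show "t_deriv T (V 0 i) (V 1 i)" unfolding V_def by (rule c[OF a])
  qed
  have UV: "U 0 0 t x = E 1 0 t x - r * E 0 2 t x" "V 0 0 t x = s * E 0 2 t x"
      "U 0 1 t x = E 1 1 t x - r * E 0 3 t x" "V 0 1 t x = s * E 0 3 t x"
      "U 0 2 t x = E 1 2 t x - r * E 0 4 t x" "V 0 2 t x = s * E 0 4 t x"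
      "U 1 0 t x = E 2 0 t x - r * E 1 2 t x" "V 1 0 t x = s * E 1 2 t x" for t x
    by (simp_all add: U_def V_def numeral_eq_Suc)
  let ?W = "\<lambda>t x. \<mu> ^ 4 * N t x ^ 3 * ((U 0 0 t x)\<^sup>2 + (V 0 0 t x)\<^sup>2) + \<mu>\<^sup>2 * N t x * ((U 0 1 t x)\<^sup>2 + (V 0 1 t x)\<^sup>2)
      + ((U 1 0 t x)\<^sup>2 + (V 1 0 t x)\<^sup>2 + (U 0 2 t x)\<^sup>2 + (V 0 2 t x)\<^sup>2) / N t x"
  let ?L = "\<lambda>t x. q x ^ 8 * (\<mu>\<^sup>2 * N t x * ((U 0 1 t x)\<^sup>2 + (V 0 1 t x)\<^sup>2) + \<mu> ^ 4 * N t x ^ 3 * ((U 0 0 t x)\<^sup>2 + (V 0 0 t x)\<^sup>2))"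
  have pair: "\<delta>\<^sup>2 * r\<^sup>2 * I ?W \<le> 400 * K ^ 4 * (I (\<lambda>t x. (r * f t x)\<^sup>2 + (- s * f t x)\<^sup>2) + 6144 * K\<^sup>2 * I ?L)"
  proof (rule pair_estimate[where Uxt = "U 1 1" and Vxt = "V 1 1"])
    fix t x
    have ss: "s * s = 1 - r * r" using rs(1) by (simp add: power2_eq_square)
    have e: "s * (s * v) = (1 - r * r) * v" for v using ss by (metis mult.assoc)
    \<comment> \<open>Both components are those of (r - \<i> s) f, the full operator multiplied by
      cnj a; here s^2 = 1 - r^2 merges the two contributions to \<open>E 1 2\<close>.\<close>
    show "r * f t x = r * U 1 0 t x + s * V 1 0 t x - U 0 2 t x"
      unfolding UV f_def by (simp only: e right_diff_distrib distrib_left) (simp add: algebra_simps)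
    show "- s * f t x = r * V 1 0 t x - s * U 1 0 t x - V 0 2 t x"
      unfolding UV f_def by (simp add: algebra_simps)
  qed (use xUV[of 0 0] xUV[of 0 1] xUV[of 1 0] tUV[of 0] tUV[of 1] rs mX(2) in
      \<open>auto intro!: mUV weight_intros simp: numeral_2_eq_2\<close>)
  have "I (\<lambda>t x. (r * f t x)\<^sup>2 + (- s * f t x)\<^sup>2) = I (\<lambda>t x. (f t x)\<^sup>2)"
    by (rule I_cong) (simp add: power_mult_distrib rs(1) flip: distrib_right)
  note pair = pair[unfolded this]
  \<comment> \<open>V gives the space derivatives after division by s, and U then gives the time
    derivatives; hence the factor s^2 in front of X.\<close>
  have W: "s\<^sup>2 * I X \<le> 3 * I ?W"
    unfolding I_cmult[symmetric]
  proof (rule I_mono)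
    fix t x assume t: "0 < t" "t < T"
    have n: "0 < N t x" using N_pos[OF t] .
    have k: "s\<^sup>2 * (v\<^sup>2 + w\<^sup>2) \<le> 3 * ((w - r * v)\<^sup>2 + (s * v)\<^sup>2)" for v w
    proof -
      have "w\<^sup>2 \<le> 2 * (w - r * v)\<^sup>2 + 2 * (r * v)\<^sup>2" using square_add2[of "w - r * v" "r * v"] by simp
      then have "s\<^sup>2 * w\<^sup>2 \<le> s\<^sup>2 * (2 * (w - r * v)\<^sup>2 + 2 * (r * v)\<^sup>2)" by (rule mult_left_mono) auto
      also have "\<dots> = s\<^sup>2 * (2 * (w - r * v)\<^sup>2) + r\<^sup>2 * (2 * (s * v)\<^sup>2)" by (simp add: power_mult_distrib algebra_simps)
      also have "\<dots> \<le> 1 * (2 * (w - r * v)\<^sup>2) + 1 * (2 * (s * v)\<^sup>2)"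
        using s1 by (intro add_mono mult_right_mono) auto
      finally have "s\<^sup>2 * (v\<^sup>2 + w\<^sup>2) \<le> 2 * (w - r * v)\<^sup>2 + 3 * (s * v)\<^sup>2"
        by (simp add: distrib_left power_mult_distrib)
      moreover have "0 \<le> (w - r * v)\<^sup>2" by simp
      ultimately show ?thesis by argo
    qed
    have 1: "s\<^sup>2 * ((E 0 2 t x)\<^sup>2 + (E 1 0 t x)\<^sup>2) \<le> 3 * ((U 0 0 t x)\<^sup>2 + (V 0 0 t x)\<^sup>2)"
      unfolding UV by (rule k[of "E 0 2 t x" "E 1 0 t x"])
    have 2: "s\<^sup>2 * ((E 0 3 t x)\<^sup>2 + (E 1 1 t x)\<^sup>2) \<le> 3 * ((U 0 1 t x)\<^sup>2 + (V 0 1 t x)\<^sup>2)"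
      unfolding UV by (rule k[of "E 0 3 t x" "E 1 1 t x"])
    have 3: "s\<^sup>2 * ((E 0 4 t x)\<^sup>2 + (E 2 0 t x)\<^sup>2 + (E 1 2 t x)\<^sup>2)
        \<le> 3 * ((U 1 0 t x)\<^sup>2 + (V 1 0 t x)\<^sup>2 + (U 0 2 t x)\<^sup>2 + (V 0 2 t x)\<^sup>2)"
    proof -
      have "s\<^sup>2 * ((E 1 2 t x)\<^sup>2 + (E 2 0 t x)\<^sup>2) \<le> 3 * ((U 1 0 t x)\<^sup>2 + (V 1 0 t x)\<^sup>2)"
        unfolding UV by (rule k[of "E 1 2 t x" "E 2 0 t x"])
      moreover have "s\<^sup>2 * (E 0 4 t x)\<^sup>2 \<le> 3 * (V 0 2 t x)\<^sup>2" unfolding UV by (simp add: power_mult_distrib)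
      moreover have "0 \<le> (U 0 2 t x)\<^sup>2" by simp
      ultimately show ?thesis by argo
    qed
    have "s\<^sup>2 * X t x = \<mu> ^ 4 * N t x ^ 3 * (s\<^sup>2 * ((E 0 2 t x)\<^sup>2 + (E 1 0 t x)\<^sup>2))
        + \<mu>\<^sup>2 * N t x * (s\<^sup>2 * ((E 0 3 t x)\<^sup>2 + (E 1 1 t x)\<^sup>2))
        + s\<^sup>2 * ((E 0 4 t x)\<^sup>2 + (E 2 0 t x)\<^sup>2 + (E 1 2 t x)\<^sup>2) / N t x"
      by (simp add: X_def algebra_simps)
    also have "\<dots> \<le> \<mu> ^ 4 * N t x ^ 3 * (3 * ((U 0 0 t x)\<^sup>2 + (V 0 0 t x)\<^sup>2))
        + \<mu>\<^sup>2 * N t x * (3 * ((U 0 1 t x)\<^sup>2 + (V 0 1 t x)\<^sup>2))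
        + 3 * ((U 1 0 t x)\<^sup>2 + (V 1 0 t x)\<^sup>2 + (U 0 2 t x)\<^sup>2 + (V 0 2 t x)\<^sup>2) / N t x"
      using 1 2 3 n mu by (intro add_mono mult_left_mono divide_right_mono) auto
    also have "\<dots> = 3 * ?W t x" by (simp add: algebra_simps)
    finally show "s\<^sup>2 * X t x \<le> 3 * ?W t x" .
  qed (intro weight_intros mX mUV; simp)+
  have L: "I ?L \<le> 3 * (l3 + m3 + l2 + m2)"
  proof -
    have "I ?L \<le> I (\<lambda>t x. 3 * (q x ^ 8 * (\<mu>\<^sup>2 * N t x * (E 0 3 t x)\<^sup>2) + q x ^ 8 * (\<mu>\<^sup>2 * N t x * (E 1 1 t x)\<^sup>2)
        + q x ^ 6 * (\<mu> ^ 4 * N t x ^ 3 * (E 0 2 t x)\<^sup>2) + q x ^ 6 * (\<mu> ^ 4 * N t x ^ 3 * (E 1 0 t x)\<^sup>2)))"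
    proof (rule I_mono)
      fix t x assume t: "0 < t" "t < T"
      have n: "0 < N t x" using N_pos[OF t] .
      have k: "(w - r * v)\<^sup>2 + (s * v)\<^sup>2 \<le> 3 * (v\<^sup>2 + w\<^sup>2)" for v w
      proof -
        have "(w - r * v)\<^sup>2 \<le> 2 * w\<^sup>2 + 2 * (r * v)\<^sup>2" using square_add2[of w "- (r * v)"] by simp
        moreover have "(r * v)\<^sup>2 + (s * v)\<^sup>2 = v\<^sup>2" by (simp add: power_mult_distrib rs(1) flip: distrib_right)
        moreover have "(r * v)\<^sup>2 \<le> v\<^sup>2" using square_mult_le[OF s1(2), of v] by (simp add: power_mult_distrib)
        moreover have "0 \<le> w\<^sup>2" "0 \<le> v\<^sup>2" by auto
        ultimately show ?thesis by argo
      qed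
      have 1: "(U 0 0 t x)\<^sup>2 + (V 0 0 t x)\<^sup>2 \<le> 3 * ((E 0 2 t x)\<^sup>2 + (E 1 0 t x)\<^sup>2)"
        unfolding UV using k[of "E 1 0 t x" "E 0 2 t x"] .
      have 2: "(U 0 1 t x)\<^sup>2 + (V 0 1 t x)\<^sup>2 \<le> 3 * ((E 0 3 t x)\<^sup>2 + (E 1 1 t x)\<^sup>2)"
        unfolding UV by (rule k[of "E 1 1 t x" "E 0 3 t x"])
      have q: "q x ^ 8 \<le> q x ^ 6" "0 \<le> q x ^ 8" using q_le_power[of 6 8 x] q01 by auto
      have "?L t x = q x ^ 8 * (\<mu>\<^sup>2 * N t x * ((U 0 1 t x)\<^sup>2 + (V 0 1 t x)\<^sup>2)) + q x ^ 8 * (\<mu> ^ 4 * N t x ^ 3 * ((U 0 0 t x)\<^sup>2 + (V 0 0 t x)\<^sup>2))"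
        by (simp add: distrib_left)
      also have "\<dots> \<le> q x ^ 8 * (\<mu>\<^sup>2 * N t x * (3 * ((E 0 3 t x)\<^sup>2 + (E 1 1 t x)\<^sup>2))) + q x ^ 6 * (\<mu> ^ 4 * N t x ^ 3 * (3 * ((E 0 2 t x)\<^sup>2 + (E 1 0 t x)\<^sup>2)))"
        using 1 2 q n mu q01 by (intro add_mono mult_mono mult_left_mono) auto
      finally show "?L t x \<le> 3 * (q x ^ 8 * (\<mu>\<^sup>2 * N t x * (E 0 3 t x)\<^sup>2) + q x ^ 8 * (\<mu>\<^sup>2 * N t x * (E 1 1 t x)\<^sup>2)
        + q x ^ 6 * (\<mu> ^ 4 * N t x ^ 3 * (E 0 2 t x)\<^sup>2) + q x ^ 6 * (\<mu> ^ 4 * N t x ^ 3 * (E 1 0 t x)\<^sup>2))"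
        by (simp add: distrib_left mult.left_commute[of _ 3] add.assoc)
    qed (intro weight_intros m mUV; simp)+
    also have "\<dots> = 3 * (l3 + m3 + l2 + m2)"
      unfolding I_cmult l3_def m3_def l2_def m2_def
      by (simp add: I_add weight_intros m)
    finally show ?thesis .
  qed
  \<comment> \<open>One majorant for all interpolations: 11 is n + m + 3 for each of the pairs (8,
    0), (6, 2), (4, 4), and 25 comes from the interpolation in time. Using half of the parameter
    turns 2 \<eta> and 1 / (2 \<eta>) into \<eta> and 1 / \<eta>.\<close>
  define D where "D = (\<lambda>\<eta>. 25 + (11 * K)\<^sup>2 + 1 / \<eta>)"
  have weaken: "l \<le> \<eta> * I X + D \<eta> * l'"
    if "0 < \<eta>" "0 \<le> l'" "l \<le> 2 * (\<eta> / 2) * I G + (k + 1 / (2 * (\<eta> / 2))) * l'" "k \<le> 25 + (11 * K)\<^sup>2"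
      "moderate T G" "\<And>t x. 0 < t \<Longrightarrow> t < T \<Longrightarrow> G t x \<le> X t x"
    for l l' \<eta> G k
  proof -
    have "\<eta> * I G \<le> \<eta> * I X" using that(1) I_mono[OF that(5) mX(1) that(6)] by (intro mult_left_mono) auto
    moreover have "(k + 1 / \<eta>) * l' \<le> D \<eta> * l'" using that by (intro mult_right_mono) (auto simp: D_def)
    ultimately show ?thesis using that(3) by simp
  qed
  have Xp: "\<mu> ^ 4 * N t x ^ 3 * (E 0 2 t x)\<^sup>2 \<le> X t x" "\<mu>\<^sup>2 * N t x * (E 0 3 t x)\<^sup>2 \<le> X t x"
      "(E 0 4 t x)\<^sup>2 / N t x \<le> X t x" "(E 2 0 t x)\<^sup>2 / N t x \<le> X t x" "(E 1 2 t x)\<^sup>2 / N t x \<le> X t x"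
      if t: "0 < t" "t < T" for t x
  proof -
    have n: "0 < N t x" using N_pos[OF t] .
    have "0 \<le> \<mu> ^ 4 * N t x ^ 3 * (E 0 2 t x)\<^sup>2" "0 \<le> \<mu> ^ 4 * N t x ^ 3 * (E 1 0 t x)\<^sup>2"
      "0 \<le> \<mu>\<^sup>2 * N t x * (E 0 3 t x)\<^sup>2" "0 \<le> \<mu>\<^sup>2 * N t x * (E 1 1 t x)\<^sup>2"
      "0 \<le> (E 0 4 t x)\<^sup>2 / N t x" "0 \<le> (E 2 0 t x)\<^sup>2 / N t x" "0 \<le> (E 1 2 t x)\<^sup>2 / N t x"
      using n mu by auto
    then show "\<mu> ^ 4 * N t x ^ 3 * (E 0 2 t x)\<^sup>2 \<le> X t x" "\<mu>\<^sup>2 * N t x * (E 0 3 t x)\<^sup>2 \<le> X t x"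
      "(E 0 4 t x)\<^sup>2 / N t x \<le> X t x" "(E 2 0 t x)\<^sup>2 / N t x \<le> X t x" "(E 1 2 t x)\<^sup>2 / N t x \<le> X t x"
      unfolding X_def by (simp_all add: distrib_left add_divide_distrib)
  qed
  have c25: "25 \<le> 25 + (11 * K)\<^sup>2" "(11 * K)\<^sup>2 \<le> 25 + (11 * K)\<^sup>2" by auto
  have h3: "l3 \<le> \<eta> * I X + D \<eta> * l2" if "0 < \<eta>" for \<eta>
    using local_interpolation[of "E 0 2" "E 0 3" "E 0 4" 8 "\<eta> / 2" 0 0] that
    by (intro weaken[OF that nn(5) _ c25(2), of _ "\<lambda>t x. (E 0 4 t x)\<^sup>2 / N t x"] Xp(3) weight_intros m)
       (auto simp: l3_def l2_def m x power2_eq_square[of \<mu>] simp del: One_nat_def)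
  have k3: "m3 \<le> \<eta> * I X + D \<eta> * m2" if "0 < \<eta>" for \<eta>
    using local_interpolation[of "E 1 0" "E 1 1" "E 1 2" 8 "\<eta> / 2" 0 0] that
    by (intro weaken[OF that nn(6) _ c25(2), of _ "\<lambda>t x. (E 1 2 t x)\<^sup>2 / N t x"] Xp(5) weight_intros m)
       (auto simp: m3_def m2_def m x power2_eq_square[of \<mu>] simp del: One_nat_def)
  \<comment> \<open>The interpolation lemma carries a quotient by N in its top term; for positive
    powers of N it is cancelled here.\<close>
  have N2: "I (\<lambda>t x. \<mu> ^ p * N t x ^ (Suc k) * (F t x)\<^sup>2 / N t x) = I (\<lambda>t x. \<mu> ^ p * N t x ^ k * (F t x)\<^sup>2)" for p k F
  proof (rule I_cong)
    fix t x assume "0 < t" "t < T"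
    then have "0 < N t x" by (rule N_pos)
    then show "\<mu> ^ p * N t x ^ (Suc k) * (F t x)\<^sup>2 / N t x = \<mu> ^ p * N t x ^ k * (F t x)\<^sup>2" by simp
  qed
  have h2: "l2 \<le> \<eta> * I X + D \<eta> * l1" if "0 < \<eta>" for \<eta>
    using local_interpolation[of "E 0 1" "E 0 2" "E 0 3" 6 "\<eta> / 2" 2 2] that N2[of 2 1 "E 0 3"]
    by (intro weaken[OF that nn(4) _ c25(2), of _ "\<lambda>t x. \<mu>\<^sup>2 * N t x * (E 0 3 t x)\<^sup>2"] Xp(2) weight_intros m)
       (auto simp: l2_def l1_def m x numeral_2_eq_2[symmetric] simp del: One_nat_def)
  have h1: "l1 \<le> \<eta> * I X + D \<eta> * l0" if "0 < \<eta>" for \<eta>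
    using local_interpolation[of "E 0 0" "E 0 1" "E 0 2" 4 "\<eta> / 2" 4 4] that N2[of 4 3 "E 0 2"]
    by (intro weaken[OF that nn(3) _ c25(2), of _ "\<lambda>t x. \<mu> ^ 4 * N t x ^ 3 * (E 0 2 t x)\<^sup>2"] Xp(1) weight_intros m)
       (auto simp: l1_def l0_def m x simp del: One_nat_def)
  have k2: "m2 \<le> \<eta> * I X + D \<eta> * l0" if "0 < \<eta>" for \<eta>
    using local_interpolation_t[of "E 0 0" "E 1 0" "E 2 0" 6 "\<eta> / 2"] that
    by (intro weaken[OF that nn(3) _ c25(1), of _ "\<lambda>t x. (E 2 0 t x)\<^sup>2 / N t x"] Xp(4) weight_intros m)
       (auto simp: m2_def l0_def m tt simp del: One_nat_def)
  have p1: "\<delta>\<^sup>2 * I (\<lambda>t x. \<mu> ^ 6 * N t x ^ 5 * (E 0 1 t x)\<^sup>2) \<le> 2 * K\<^sup>2 * I X + 512 * l1"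
  proof -
    have "\<delta>\<^sup>2 * I (\<lambda>t x. \<mu> ^ 6 * N t x ^ 5 * (E 0 1 t x)\<^sup>2) \<le> 2 * K\<^sup>2 * I (\<lambda>t x. \<mu> ^ 4 * N t x ^ 3 * (E 0 2 t x)\<^sup>2) + 512 * l1"
      using weighted_poincare[of "E 0 1" "E 0 2" 4 4 3] by (simp add: m x l1_def del: One_nat_def)
    moreover have "2 * K\<^sup>2 * I (\<lambda>t x. \<mu> ^ 4 * N t x ^ 3 * (E 0 2 t x)\<^sup>2) \<le> 2 * K\<^sup>2 * I X"
      by (intro mult_left_mono I_mono mX weight_intros m Xp) auto
    ultimately show ?thesis by linarith
  qed
  have p0: "\<delta>\<^sup>2 * I (\<lambda>t x. \<mu> ^ 8 * N t x ^ 7 * (E 0 0 t x)\<^sup>2) \<le> 2 * K\<^sup>2 * I (\<lambda>t x. \<mu> ^ 6 * N t x ^ 5 * (E 0 1 t x)\<^sup>2) + 512 * l0"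
    using weighted_poincare[of "E 0 0" "E 0 1" 2 6 5] by (simp add: m x l0_def del: One_nat_def)
  have main: "\<delta>\<^sup>2 * r\<^sup>2 * s\<^sup>2 * I X \<le> 1200 * K ^ 4 * (18432 * K\<^sup>2) * (I (\<lambda>t x. (f t x)\<^sup>2) + l3 + m3 + l2 + m2)"
  proof -
    have "\<delta>\<^sup>2 * r\<^sup>2 * (s\<^sup>2 * I X) \<le> \<delta>\<^sup>2 * r\<^sup>2 * (3 * I ?W)" using W by (intro mult_left_mono) auto
    also have "\<dots> = 3 * (\<delta>\<^sup>2 * r\<^sup>2 * I ?W)" by simp
    also have "\<dots> \<le> 3 * (400 * K ^ 4 * (I (\<lambda>t x. (f t x)\<^sup>2) + 6144 * K\<^sup>2 * I ?L))"
      using pair by (intro mult_left_mono) auto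
    also have "\<dots> = 1200 * K ^ 4 * (I (\<lambda>t x. (f t x)\<^sup>2) + 6144 * K\<^sup>2 * I ?L)" by simp
    also have "\<dots> \<le> 1200 * K ^ 4 * (18432 * K\<^sup>2 * I (\<lambda>t x. (f t x)\<^sup>2) + 6144 * K\<^sup>2 * (3 * (l3 + m3 + l2 + m2)))"
    proof (intro mult_left_mono add_mono L)
      have "1 \<le> 18432 * K\<^sup>2" using K1 one_le_power[of K 2] by linarith
      from mult_right_mono[OF this nn(2)] show "I (\<lambda>t x. (f t x)\<^sup>2) \<le> 18432 * K\<^sup>2 * I (\<lambda>t x. (f t x)\<^sup>2)" by simp
    qed auto
    also have "\<dots> = 1200 * K ^ 4 * (18432 * K\<^sup>2) * (I (\<lambda>t x. (f t x)\<^sup>2) + l3 + m3 + l2 + m2)" by (simp add: algebra_simps)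
    finally show ?thesis by (simp only: mult.assoc)
  qed
  have "I (\<lambda>t x. \<mu> ^ 8 * N t x ^ 7 * (E 0 0 t x)\<^sup>2) + I (\<lambda>t x. \<mu> ^ 6 * N t x ^ 5 * (E 0 1 t x)\<^sup>2) + I X
      \<le> C * (I (\<lambda>t x. (f t x)\<^sup>2) + l0)"
    by (rule C[unfolded absorbs_def, rule_format, OF nn main])
       (fact h3[unfolded D_def] k3[unfolded D_def] h2[unfolded D_def] k2[unfolded D_def] h1[unfolded D_def] p1 p0)+
  then show ?thesis unfolding X_def f_def l0_def .
qed

end

section \<open>The weights on the torus\<close>

lemma Ck_on_deriv:
  fixes f :: "real \<Rightarrow> real"
  assumes "Ck_on (Suc n) UNIV f"
  shows "\<And>x. (f has_real_derivative deriv f x) (at x)" and "Ck_on n UNIV (deriv f)"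
proof -
  obtain f' where f0: "\<forall>x\<in>UNIV. (f has_derivative f' x) (at x within UNIV)" "\<forall>b\<in>Basis. Ck_on n UNIV (\<lambda>x. f' x b)"
    using assms unfolding Ck_on.simps by (elim exE conjE)
  have f': "\<And>x. (f has_derivative f' x) (at x)" "Ck_on n UNIV (\<lambda>x. f' x 1)" using f0 by simp_all
  have d: "(f has_real_derivative f' x 1) (at x)" for x
  proof -
    have h: "f' x h = f' x 1 * h" for h
      using linear_cmul[OF has_derivative_linear[OF f'(1)[of x]], of h 1] by simp
    have "f' x = (*) (f' x 1)" by (rule ext) (rule h)
    with f'(1)[of x] show ?thesis by (simp add: has_field_derivative_def)
  qed
  then have e: "deriv f = (\<lambda>x. f' x 1)" by (auto intro: DERIV_imp_deriv)
  show "(f has_real_derivative deriv f x) (at x)" for x using d e by simp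
  show "Ck_on n UNIV (deriv f)" using f'(2) e by simp
qed

lemma Ck_on_continuous:
  fixes f :: "real \<Rightarrow> real"
  assumes "Ck_on n UNIV f"
  shows "continuous_on UNIV f"
proof (cases n)
  case (Suc m)
  then show ?thesis
    using Ck_on_deriv(1)[of m f] assms
    by (auto intro!: continuous_at_imp_continuous_on DERIV_isCont)
qed (use assms in simp)

lemma periodic_deriv:
  assumes "periodic f" "\<And>x. (f has_real_derivative f' x) (at x)"
  shows "periodic f'"
  unfolding periodic_def
proof
  fix x
  have "((\<lambda>y. f (y + 2 * pi)) has_real_derivative f' (x + 2 * pi)) (at x)"
    using assms(2)[of "x + 2 * pi"] by (simp add: DERIV_shift)
  then have "(f has_real_derivative f' (x + 2 * pi)) (at x)"
    using assms(1) by (simp add: periodic_def)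
  then show "f' (x + 2 * pi) = f' x" using assms(2)[of x] DERIV_unique by blast
qed

text \<open>At 0 the difference quotient is bounded by |h|^(n-1), which tends to 0 for n \<ge> 2;
  the positive part itself has a corner there.\<close>

lemma DERIV_max_0_power:
  assumes "2 \<le> n"
  shows "((\<lambda>y::real. max 0 y ^ n) has_real_derivative of_nat n * max 0 y ^ (n - 1)) (at y)"
proof -
  consider "0 < y" | "y < 0" | "y = 0" by linarith
  then show ?thesis
  proof cases
    case 1
    have "((\<lambda>y. y ^ n) has_real_derivative of_nat n * max 0 y ^ (n - 1)) (at y)"
      using 1 by (auto intro!: derivative_eq_intros)
    then show ?thesis
      by (rule has_field_derivative_transform_within_open[where S = "{0<..}"]) (use 1 in auto)
  next
    case 2
    have "((\<lambda>y. 0) has_real_derivative of_nat n * max 0 y ^ (n - 1)) (at y)"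
      using 2 assms by (simp add: power_0_left)
    then show ?thesis
      by (rule has_field_derivative_transform_within_open[where S = "{..<0}"]) (use 2 assms in auto)
  next
    case 3
    have "((\<lambda>h::real. max 0 h ^ n / h) \<longlongrightarrow> 0) (at 0)"
    proof (rule Lim_null_comparison)
      show "\<forall>\<^sub>F h::real in at 0. norm (max 0 h ^ n / h) \<le> \<bar>h\<bar> ^ (n - 1)"
      proof (rule always_eventually, rule allI)
        fix h :: real
        obtain m where m: "n = Suc m" using assms by (cases n) auto
        show "norm (max 0 h ^ n / h) \<le> \<bar>h\<bar> ^ (n - 1)" by (cases "0 < h") (auto simp: m max_def)
      qed
      have "((\<lambda>h::real. \<bar>h\<bar> ^ (n - 1)) \<longlongrightarrow> \<bar>0\<bar> ^ (n - 1)) (at 0)" by (intro tendsto_intros)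
      moreover have "\<bar>0::real\<bar> ^ (n - 1) = 0" using assms by (simp add: power_0_left)
      ultimately show "((\<lambda>h::real. \<bar>h\<bar> ^ (n - 1)) \<longlongrightarrow> 0) (at 0)" by (simp only:)
    qed
    then show ?thesis using 3 assms by (simp add: DERIV_def power_0_left)
  qed
qed

text \<open>The indicator function of J is periodic, so the shift rule for periodic functions
  applies.\<close>

lemma torus_invariant_int:
  assumes "torus_invariant J"
  shows "x + 2 * pi * of_int n \<in> J \<longleftrightarrow> x \<in> J"
proof -
  have "periodic (\<lambda>x. of_bool (x \<in> J) :: real)" using assms by (auto simp: periodic_def torus_invariant_def)
  from periodic_int[OF this, of x n] show ?thesis by (simp only: of_bool_eq_iff)
qed

text \<open>On one period the complement of J0 is compact and p1 does not vanish there, so |p1|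
  \<ge> c > 0 off J0. The positive part of 1 - (p1 / c)^2 then vanishes off J0 and is close to 1
  exactly where p1 is small.\<close>

lemma torus_cutoff:
  assumes J: "open J0" "torus_invariant J0" and w: "weight_torus J0 \<psi>"
  shows "\<exists>K \<delta> p1 p2 p3 q q'. spatial_cutoff K \<delta> p1 p2 p3 q q' \<and>
    (\<forall>x. (\<psi> has_real_derivative p1 x) (at x)) \<and> (\<forall>x. x \<notin> J0 \<longrightarrow> q x = 0)"
proof -
  have Ck: "Ck_on n UNIV \<psi>" for n using w by (auto simp: weight_torus_def smooth_on_def)
  define p1 p2 p3 where p: "p1 = deriv \<psi>" "p2 = deriv p1" "p3 = deriv p2"
  have d0: "(\<psi> has_real_derivative p1 x) (at x)" and C1: "Ck_on n UNIV p1" for x n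
    using Ck_on_deriv[OF Ck[of "Suc n"]] by (auto simp: p)
  have d1: "(p1 has_real_derivative p2 x) (at x)" and C2: "Ck_on n UNIV p2" for x n
    using Ck_on_deriv[OF C1[of "Suc n"]] by (auto simp: p)
  have d2: "(p2 has_real_derivative p3 x) (at x)" and C3: "Ck_on n UNIV p3" for x n
    using Ck_on_deriv[OF C2[of "Suc n"]] by (auto simp: p)
  have per0: "periodic \<psi>" using w by (simp add: weight_torus_def)
  note per1 = periodic_deriv[OF per0 d0]
  note per2 = periodic_deriv[OF per1 d1]
  note per3 = periodic_deriv[OF per2 d2]
  note cont = C1[THEN Ck_on_continuous] C2[THEN Ck_on_continuous] C3[THEN Ck_on_continuous]
  have nz: "p1 x \<noteq> 0" if "x \<notin> J0" for x using w that by (auto simp: weight_torus_def p)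
  have "\<exists>c. 0 < c \<and> c \<le> 1 \<and> (\<forall>x. x \<notin> J0 \<longrightarrow> c \<le> \<bar>p1 x\<bar>)"
  proof -
    let ?S = "{0..2 * pi} - J0"
    have S: "compact ?S" using J(1) by (intro compact_diff) auto
    have "\<exists>c. 0 < c \<and> c \<le> 1 \<and> (\<forall>x\<in>?S. c \<le> \<bar>p1 x\<bar>)"
    proof (cases "?S = {}")
      case False
      have "continuous_on ?S (\<lambda>x. \<bar>p1 x\<bar>)"
        by (intro continuous_on_rabs continuous_on_subset[OF cont(1)]) auto
      then obtain x where x: "x \<in> ?S" "\<forall>y\<in>?S. \<bar>p1 x\<bar> \<le> \<bar>p1 y\<bar>"
        using continuous_attains_inf[OF S False] by blast
      then show ?thesis using nz[of x] by (intro exI[of _ "min 1 \<bar>p1 x\<bar>"]) (auto simp: min_le_iff_disj)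
    qed (auto intro!: exI[of _ 1])
    then obtain c where c: "0 < c" "c \<le> 1" "\<forall>x\<in>?S. c \<le> \<bar>p1 x\<bar>" by blast
    have "c \<le> \<bar>p1 x\<bar>" if "x \<notin> J0" for x
    proof -
      obtain n where n: "x + 2 * pi * of_int n \<in> {0..<2 * pi}" by (rule torus_representative)
      then have "x + 2 * pi * of_int n \<in> ?S" using that torus_invariant_int[OF J(2)] by auto
      then have "c \<le> \<bar>p1 (x + 2 * pi * of_int n)\<bar>" using c(3) by blast
      then show ?thesis by (simp only: periodic_int[OF per1])
    qed
    then show ?thesis using c by blast
  qed
  then obtain c where c: "0 < c" "c \<le> 1" "\<forall>x. x \<notin> J0 \<longrightarrow> c \<le> \<bar>p1 x\<bar>" by blast
  define q where "q = (\<lambda>x. max 0 (1 - (p1 x)\<^sup>2 / c\<^sup>2))"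
  define q' where "q' = (\<lambda>x. - 2 * p1 x * p2 x / c\<^sup>2)"
  have contq: "continuous_on UNIV q" "continuous_on UNIV q'"
    unfolding q_def q'_def using cont c by (auto intro!: continuous_intros)
  have perq: "periodic q" "periodic q'" using per1 per2 by (auto simp: periodic_def q_def q'_def)
  obtain B1 where B1: "\<forall>x. \<bar>p1 x\<bar> \<le> B1" using periodic_bounded[OF per1 cont(1)] by blast
  obtain B2 where B2: "\<forall>x. \<bar>p2 x\<bar> \<le> B2" using periodic_bounded[OF per2 cont(2)] by blast
  obtain B3 where B3: "\<forall>x. \<bar>p3 x\<bar> \<le> B3" using periodic_bounded[OF per3 cont(3)] by blast
  obtain B4 where B4: "\<forall>x. \<bar>q' x\<bar> \<le> B4" using periodic_bounded[OF perq(2) contq(2)] by blast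
  define K where "K = Max {1, B1, B2, B3, B4}"
  have K: "1 \<le> K" "B1 \<le> K" "B2 \<le> K" "B3 \<le> K" "B4 \<le> K" by (auto simp: K_def)
  have dq: "((\<lambda>y. q y ^ n) has_real_derivative of_nat n * q x ^ (n - 1) * q' x) (at x)" if "2 \<le> n" for n x
  proof -
    have "((\<lambda>x. 1 - (p1 x)\<^sup>2 / c\<^sup>2) has_real_derivative q' x) (at x)"
    proof -
      have "((\<lambda>x. 1 - (p1 x)\<^sup>2 * (1 / c\<^sup>2)) has_real_derivative 0 - of_nat 2 * (p2 x * p1 x ^ (2 - Suc 0)) * (1 / c\<^sup>2)) (at x)"
        by (intro DERIV_diff DERIV_const DERIV_cmult_right DERIV_power d1)
      then show ?thesis by (simp add: q'_def mult_ac)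
    qed
    from DERIV_chain2[OF DERIV_max_0_power[OF that] this] show ?thesis by (simp add: q_def)
  qed
  have q0: "q x = 0" if "x \<notin> J0" for x
  proof -
    have "c\<^sup>2 \<le> \<bar>p1 x\<bar>\<^sup>2" using c that by (intro power_mono) auto
    then show ?thesis using c by (simp add: q_def max_def field_simps)
  qed
  \<comment> \<open>This is where \<delta> = c^2 / 2 and the threshold 1/2 for q come from: q \<le>
    1/2 forces (p1)^2 \<ge> c^2 / 2, and otherwise 256 q^8 \<ge> 1.\<close>
  have low: "c\<^sup>2 / 2 * (1 - 256 * q x ^ 8) \<le> (p1 x)\<^sup>2" for x
  proof (cases "q x \<le> 1 / 2")
    case True
    moreover have "1 - (p1 x)\<^sup>2 / c\<^sup>2 \<le> q x" by (simp add: q_def)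
    ultimately have "1 - (p1 x)\<^sup>2 / c\<^sup>2 \<le> 1 / 2" by linarith
    then have "c\<^sup>2 / 2 \<le> (p1 x)\<^sup>2" using c by (simp add: field_simps)
    moreover have "c\<^sup>2 / 2 * (1 - 256 * q x ^ 8) \<le> c\<^sup>2 / 2 * 1" by (intro mult_left_mono) (auto simp: q_def)
    ultimately show ?thesis by simp
  next
    case False
    then have "(1 / 2) ^ 8 \<le> q x ^ 8" by (intro power_mono) auto
    then have "c\<^sup>2 / 2 * (1 - 256 * q x ^ 8) \<le> 0" by (intro mult_nonneg_nonpos) (auto simp: power_numeral_reduce)
    also have "0 \<le> (p1 x)\<^sup>2" by simp
    finally show ?thesis .
  qed
  have "0 < c\<^sup>2 / 2" "c\<^sup>2 / 2 \<le> 1" using c power_le_one[of c 2] by auto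
  have "spatial_cutoff K (c\<^sup>2 / 2) p1 p2 p3 q q'"
  proof
    show "\<bar>p1 x\<bar> \<le> K" "\<bar>p2 x\<bar> \<le> K" "\<bar>p3 x\<bar> \<le> K" "\<bar>q' x\<bar> \<le> K" for x
      using B1 B2 B3 B4 K by (meson order_trans)+
    show "0 \<le> q x" "q x \<le> 1" for x by (auto simp: q_def)
  qed fact+
  then show ?thesis using d0 q0 by blast
qed

text \<open>Degenerate cases rest on default values: the essential supremum is top for a
  nonmeasurable function and bottom on a null space, and \<open>real_of_ereal\<close> sends both to
  0.\<close>

lemma Linf_norm_nonneg: "0 \<le> Linf_norm A f"
proof -
  let ?M = "restrict_space lborel A" and ?f = "\<lambda>x. ereal \<bar>f x\<bar>"
  have "esssup ?M ?f = -\<infinity> \<or> 0 \<le> esssup ?M ?f"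
  proof (cases "?f \<in> borel_measurable ?M \<and> emeasure ?M (space ?M) \<noteq> 0")
    case True
    then have "esssup ?M (\<lambda>x. 0 :: ereal) = 0" by (intro esssup_const) simp
    moreover have "esssup ?M (\<lambda>x. 0 :: ereal) \<le> esssup ?M ?f"
      using True by (intro esssup_AE_mono) auto
    ultimately show ?thesis by simp
  next
    case False
    then show ?thesis
      using esssup_non_measurable[of ?f ?M] esssup_zero_space[of ?M ?f]
      by (cases "?f \<in> borel_measurable ?M") (simp_all add: top_ereal_def bot_ereal_def)
  qed
  then show ?thesis by (auto simp: Linf_norm_def real_of_ereal_pos)
qed

text \<open>A continuous function that exceeds its essential supremum at one point does so on an
  interval of positive measure.\<close>

lemma le_Linf_norm:
  assumes "periodic \<psi>" "continuous_on UNIV \<psi>"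
  shows "\<psi> x \<le> Linf_norm torus_fund \<psi>"
proof -
  let ?M = "restrict_space lborel torus_fund" and ?f = "\<lambda>x. ereal \<bar>\<psi> x\<bar>"
  obtain B where B: "\<forall>x. \<bar>\<psi> x\<bar> \<le> B" using periodic_bounded[OF assms] by blast
  have "\<psi> \<in> borel_measurable borel" using assms(2) by (rule borel_measurable_continuous_onI)
  then have meas: "?f \<in> borel_measurable ?M"
    by (intro borel_measurable_ereal borel_measurable_abs measurable_restrict_space1) simp
  have up: "esssup ?M ?f \<le> ereal B" using B by (intro esssup_I meas) auto
  have ae: "AE x in lborel. x \<in> torus_fund \<longrightarrow> ?f x \<le> esssup ?M ?f"
    using esssup_AE[of ?f ?M] by (subst (asm) AE_restrict_space_iff) auto
  have fin: "esssup ?M ?f = ereal (Linf_norm torus_fund \<psi>)" if "0 \<le> esssup ?M ?f"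
    using up that by (cases "esssup ?M ?f") (auto simp: Linf_norm_def)
  have key: "\<psi> y \<le> Linf_norm torus_fund \<psi>" if y: "y \<in> {0..<2 * pi}" for y
  proof (rule ccontr)
    let ?L = "Linf_norm torus_fund \<psi>"
    assume "\<not> \<psi> y \<le> ?L"
    then have "?L < \<psi> y" by simp
    moreover have "isCont \<psi> y" using assms(2) by (simp add: continuous_on_eq_continuous_at)
    ultimately have "\<forall>\<^sub>F z in at y. ?L < \<psi> z" unfolding isCont_def by (intro order_tendstoD(1))
    then obtain d where d: "0 < d" "\<forall>z. z \<noteq> y \<and> dist z y < d \<longrightarrow> ?L < \<psi> z"
      unfolding eventually_at by auto
    \<comment> \<open>The interval lies to the right of y, where the half-open fundamental domain
      leaves room even for y = 0.\<close>
    define b where "b = min (y + d) (2 * pi)"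
    have yb: "y < b" using d y by (simp add: b_def)
    have bad: "\<not> (z \<in> torus_fund \<longrightarrow> ?f z \<le> esssup ?M ?f)" if "z \<in> {y<..<b}" for z
    proof -
      have "z \<in> torus_fund" using that y by (auto simp: torus_fund_def b_def)
      have "?L < \<psi> z" using that by (intro d(2)[rule_format]) (auto simp: b_def dist_real_def)
      then have "?L < \<bar>\<psi> z\<bar>" by linarith
      have "esssup ?M ?f < ?f z"
      proof (cases "0 \<le> esssup ?M ?f")
        case True
        then show ?thesis using fin \<open>?L < \<bar>\<psi> z\<bar>\<close> by simp
      next
        case False
        moreover have "0 \<le> ?f z" by simp
        ultimately show ?thesis by (meson not_le order_less_le_trans)
      qed
      then show ?thesis using \<open>z \<in> torus_fund\<close> by simp
    qed
    have "AE z in lborel. z \<notin> {y<..<b}" using ae by eventually_elim (use bad in blast)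
    then have "emeasure lborel {y<..<b} = 0" by (rule AE_iff_measurable[THEN iffD1, rotated 2]) auto
    then show False using yb by simp
  qed
  obtain n where n: "x + 2 * pi * of_int n \<in> {0..<2 * pi}" by (rule torus_representative)
  from key[OF n] show ?thesis by (simp only: periodic_int[OF assms(1)])
qed

section \<open>Decay of the exponential weight and verification of the weight hypotheses\<close>

lemma power_le_fact_exp:
  fixes x :: real
  assumes "0 \<le> x" shows "x ^ n \<le> fact n * exp x"
proof -
  have "x ^ n /\<^sub>R fact n \<le> (\<Sum>i. x ^ i /\<^sub>R fact i)"
  proof (rule order_trans[OF _ sum_le_suminf[of _ "{n}"]])
    show "summable (\<lambda>i. x ^ i /\<^sub>R fact i)" using exp_converges[of x] by (rule sums_summable)
  qed (use assms in auto)
  then have "x ^ n / fact n \<le> exp x" using sums_unique[OF exp_converges[of x]] by (simp add: divide_inverse mult.commute)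
  then show ?thesis by (simp add: pos_divide_le_eq mult.commute)
qed

text \<open>The shift u - 1 is made for the application: u^(k/2) \<ge> u holds only for u \<ge> 1,
  whereas u^(k/2) \<ge> u - 1 holds for all u > 0.\<close>

lemma exp_decay:
  fixes c :: real
  assumes c: "0 < c" and u: "0 \<le> u"
  shows "(1 + u) ^ m * exp (- c * (u - 1)) \<le> fact m / c ^ m * exp (2 * c)"
proof -
  have "(c * (1 + u)) ^ m \<le> fact m * exp (c * (1 + u))" using assms by (intro power_le_fact_exp) auto
  then have "(1 + u) ^ m \<le> fact m / c ^ m * exp (c * (1 + u))"
    using c by (simp only: power_mult_distrib) (simp add: pos_le_divide_eq mult.commute)
  then have "(1 + u) ^ m * exp (- c * (u - 1)) \<le> fact m / c ^ m * exp (c * (1 + u)) * exp (- c * (u - 1))"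
    by (intro mult_right_mono) auto
  also have "\<dots> = fact m / c ^ m * exp (c * (1 + u) + - c * (u - 1))" unfolding exp_add by (simp only: mult.assoc)
  also have "c * (1 + u) + - c * (u - 1) = 2 * c" by (simp add: algebra_simps)
  finally show ?thesis .
qed

text \<open>\<tau> is the logarithmic time derivative of ell^(-k/2). The two powers of T have
  separate roles: T^k makes N large because ell^(k/2) \<le> T^k, and T^(k-1) makes N dominate T /
  ell, the size of \<tau>, because ell^(k/2-1) \<le> T^(k-2); the latter uses k \<ge> 2.\<close>

lemma carleman_weight_instance:
  fixes \<psi> p1 p2 p3 q q' :: "real \<Rightarrow> real" and K \<delta> \<epsilon> \<mu> lam T s \<Psi> k :: real
  assumes cutoff: "spatial_cutoff K \<delta> p1 p2 p3 q q'"
    and d0: "\<And>x. (\<psi> has_real_derivative p1 x) (at x)"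
    and \<psi>: "periodic \<psi>" "\<And>x. 0 < \<psi> x" "\<And>x. \<psi> x \<le> \<Psi>" and k: "2 \<le> k"
    and \<epsilon>: "0 < \<epsilon>" "\<epsilon> \<le> 1" "10 * K ^ 3 * \<epsilon> \<le> \<delta>\<^sup>2"
    and par: "1 / \<epsilon> \<le> \<mu>" "\<mu> \<le> lam" "0 < T" "3 * (k / 2)\<^sup>2 / \<epsilon> * (T powr k + T powr (k - 1)) \<le> s"
  defines "\<tau> \<equiv> \<lambda>t x :: real. - (k / 2) * (T - 2 * t) / ell T t"
    and "\<tau>' \<equiv> \<lambda>t x :: real. (k / 2) * (2 * ell T t + (T - 2 * t)\<^sup>2) / (ell T t)\<^sup>2"
  defines "\<rho> \<equiv> \<lambda>t x. s * phi0 \<psi> \<Psi> k T lam \<mu> t x * \<tau> t x"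
  defines "\<rho>' \<equiv> \<lambda>t x. s * phi0 \<psi> \<Psi> k T lam \<mu> t x * ((\<tau> t x)\<^sup>2 + \<tau>' t x)"
  shows "carleman_weight K \<delta> p1 p2 p3 q q' T \<mu> \<epsilon> (\<lambda>t x. exp (2 * s * phi0 \<psi> \<Psi> k T lam \<mu> t x))
    (\<lambda>t x. s * xi0 \<psi> \<Psi> k T lam \<mu> t x) \<tau> \<rho> \<rho>'"
proof -
  interpret spatial_cutoff K \<delta> p1 p2 p3 q q' by (rule cutoff)
  define \<kappa> where "\<kappa> = k / 2"
  have \<kappa>: "1 \<le> \<kappa>" using k by (simp add: \<kappa>_def)
  \<comment> \<open>The factor 3 is dictated by \<tau>^2 + \<tau>', which is at most 3 \<kappa>^2 (T
    / ell)^2; since \<kappa> \<ge> 1 the other bounds need less.\<close>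
  define s0 where "s0 = 3 * \<kappa>\<^sup>2 / \<epsilon>"
  have \<kappa>2: "\<kappa> \<le> \<kappa>\<^sup>2" "1 \<le> \<kappa>\<^sup>2" using \<kappa> self_le_power[of \<kappa> 2] by auto
  have s0: "3 * \<kappa>\<^sup>2 \<le> \<epsilon> * s0" "1 \<le> s0" "0 < s0" "1 \<le> \<epsilon> * s0" "\<kappa> \<le> \<epsilon> * s0"
  proof -
    show "3 * \<kappa>\<^sup>2 \<le> \<epsilon> * s0" using \<epsilon> by (simp add: s0_def)
    then show "1 \<le> \<epsilon> * s0" "\<kappa> \<le> \<epsilon> * s0" using \<kappa>2 by linarith+
    show "0 < s0" using \<epsilon> \<kappa> by (simp add: s0_def)
    then have "\<epsilon> * s0 \<le> 1 * s0" using \<epsilon> by (intro mult_right_mono) auto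
    then show "1 \<le> s0" using \<open>1 \<le> \<epsilon> * s0\<close> by linarith
  qed
  have mu: "1 \<le> \<epsilon> * \<mu>" "0 < \<mu>" "0 < lam"
  proof -
    show "1 \<le> \<epsilon> * \<mu>" using par(1) \<epsilon> by (simp add: pos_divide_le_eq mult.commute)
    have "0 < 1 / \<epsilon>" using \<epsilon> by simp
    then show "0 < \<mu>" "0 < lam" using par by linarith+
  qed
  have \<Psi>: "0 < \<Psi>" using \<psi>(2,3)[of 0] by linarith
  have s_ge: "s0 * T powr k \<le> s" "s0 * T powr (k - 1) \<le> s" "0 < s"
  proof -
    have "0 \<le> s0 * T powr k" "0 \<le> s0 * T powr (k - 1)" "0 < s0 * T powr k" using s0 par(3) by auto
    moreover have "s0 * T powr k + s0 * T powr (k - 1) \<le> s" using par(4) by (simp add: s0_def \<kappa>_def distrib_left)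
    ultimately show "s0 * T powr k \<le> s" "s0 * T powr (k - 1) \<le> s" "0 < s" by linarith+
  qed
  have T: "0 < T" by (rule par(3))
  define \<Lambda> where "\<Lambda> = (\<lambda>t. ell T t powr (- \<kappa>))"
  \<comment> \<open>In powers of H the weight factor g lies between H^8 and H^9, the upper bound
    because \<mu> \<psi> \<le> \<lambda> \<Psi>. Thus g - H^10 is negative, and the two spare powers
    between 8 and 10 measure how far |\<phi>| may exceed \<xi>.\<close>
  define H where "H = exp (lam * \<Psi>)"
  have H: "1 \<le> H" using mu \<Psi> by (simp add: H_def)
  have Hn: "exp (real n * lam * \<Psi>) = H ^ n" for n by (simp add: H_def exp_of_nat_mult mult.assoc)
  have H8: "exp (8 * lam * \<Psi>) = H ^ 8" "exp (10 * lam * \<Psi>) = H ^ 10" using Hn[of 8] Hn[of 10] by auto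
  define g where "g = (\<lambda>x. exp (\<mu> * \<psi> x + 8 * lam * \<Psi>))"
  define \<phi> where "\<phi> = phi0 \<psi> \<Psi> k T lam \<mu>"
  define N where "N = (\<lambda>t x. s * xi0 \<psi> \<Psi> k T lam \<mu> t x)"
  have \<phi>: "\<phi> t x = (g x - H ^ 10) * \<Lambda> t" for t x
    by (simp add: \<phi>_def phi0_def g_def H8 \<Lambda>_def \<kappa>_def powr_minus_divide)
  have N: "N t x = s * g x * \<Lambda> t" for t x
    by (simp add: N_def xi0_def g_def \<Lambda>_def \<kappa>_def powr_minus_divide)
  have g: "H ^ 8 \<le> g x" "g x \<le> H ^ 9" "0 < g x" for x
  proof -
    have "0 \<le> \<mu> * \<psi> x" using mu \<psi>(2)[of x] by simp
    then show "H ^ 8 \<le> g x" unfolding g_def H8[symmetric] by simp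
    have "\<mu> * \<psi> x \<le> lam * \<Psi>" using mu par(2) \<psi>(2,3)[of x] by (intro mult_mono) (auto intro: less_imp_le)
    then have "g x \<le> exp (9 * lam * \<Psi>)" by (simp add: g_def mult.commute)
    then show "g x \<le> H ^ 9" using Hn[of 9] by simp
    show "0 < g x" by (simp add: g_def)
  qed
  have ell_le: "ell T t \<le> T\<^sup>2 / 4" for t
  proof -
    have "0 \<le> (T - 2 * t)\<^sup>2" by simp
    then show ?thesis by (simp add: ell_def power2_eq_square algebra_simps)
  qed
  have \<Lambda>_pos: "0 < \<Lambda> t" if "0 < t" "t < T" for t using ell_pos[OF that] by (simp add: \<Lambda>_def)
  have T2: "T powr (2 * a) = (T\<^sup>2) powr a" for a
    using T by (simp add: powr_powr flip: powr_numeral)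
  have s\<Lambda>: "s0 \<le> s * \<Lambda> t" "s0 * (T / ell T t) \<le> s * \<Lambda> t" if t: "0 < t" "t < T" for t
  proof -
    have l: "0 < ell T t" "ell T t \<le> T\<^sup>2" using ell_pos[OF t] ell_le[of t] zero_le_power2[of T] by auto
    have "ell T t powr \<kappa> \<le> T powr k"
      using powr_mono2[of \<kappa> "ell T t" "T\<^sup>2"] l \<kappa> T2[of \<kappa>] by (simp add: \<kappa>_def)
    then have "s0 * (ell T t powr \<kappa>) \<le> s0 * T powr k" using s0 by (intro mult_left_mono) auto
    also have "\<dots> \<le> s" by (rule s_ge)
    finally show "s0 \<le> s * \<Lambda> t" using l by (simp add: \<Lambda>_def powr_minus field_simps)
    have "ell T t powr (\<kappa> - 1) \<le> T powr (k - 2)"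
      using powr_mono2[of "\<kappa> - 1" "ell T t" "T\<^sup>2"] l \<kappa> T2[of "\<kappa> - 1"] by (simp add: \<kappa>_def algebra_simps)
    then have "T * ell T t powr (\<kappa> - 1) \<le> T * T powr (k - 2)" using T by (intro mult_left_mono) auto
    also have "T * T powr (k - 2) = T powr (k - 1)" using T powr_mult_base[of T "k - 2"] by simp
    finally have "s0 * (T * ell T t powr (\<kappa> - 1)) \<le> s0 * T powr (k - 1)" using s0 by (intro mult_left_mono) auto
    also have "\<dots> \<le> s" by (rule s_ge)
    finally have "s0 * (T * ell T t powr (\<kappa> - 1)) * \<Lambda> t \<le> s * \<Lambda> t" using \<Lambda>_pos[OF t] by (intro mult_right_mono) auto
    moreover have "ell T t powr (\<kappa> - 1) * \<Lambda> t = 1 / ell T t"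
      unfolding \<Lambda>_def powr_add[symmetric] using l by (simp add: powr_minus_divide)
    ultimately show "s0 * (T / ell T t) \<le> s * \<Lambda> t" by (simp add: mult.assoc)
  qed
  have N8: "s * \<Lambda> t * H ^ 8 \<le> N t x" if t: "0 < t" "t < T" for t x
    using mult_left_mono[OF g(1)[of x], of "s * \<Lambda> t"] s_ge(3) \<Lambda>_pos[OF t] by (simp add: N mult_ac)
  have H1: "1 \<le> H ^ n" for n using H by simp
  have N_s0: "s0 \<le> N t x" if t: "0 < t" "t < T" for t x
  proof -
    have "s * \<Lambda> t * 1 \<le> s * \<Lambda> t * H ^ 8" using s_ge(3) \<Lambda>_pos[OF t] H1 by (intro mult_left_mono) auto
    then show ?thesis using s\<Lambda>(1)[OF t] N8[OF t, of x] by linarith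
  qed
  define R where "R = (\<lambda>t. T / ell T t)"
  have R_pos: "0 \<le> R t" if t: "0 < t" "t < T" for t using T ell_pos[OF t] by (simp add: R_def)
  have R: "s0 * R t * H ^ 8 \<le> N t x" if t: "0 < t" "t < T" for t x
  proof -
    have "s0 * R t * H ^ 8 \<le> s * \<Lambda> t * H ^ 8"
      using s\<Lambda>(2)[OF t] H by (intro mult_right_mono) (auto simp: R_def)
    then show ?thesis using N8[OF t, of x] by linarith
  qed
  have R1: "s0 * R t \<le> N t x" if t: "0 < t" "t < T" for t x
  proof -
    have "s0 * R t * 1 \<le> s0 * R t * H ^ 8" using s0 R_pos[OF t] H1 by (intro mult_left_mono) auto
    then show ?thesis using R[OF t, of x] by linarith
  qed
  have tau_R: "\<bar>\<tau> t x\<bar> \<le> \<kappa> * R t" if t: "0 < t" "t < T" for t x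
  proof -
    have "\<bar>T - 2 * t\<bar> \<le> T" using t by auto
    then have "\<kappa> * \<bar>T - 2 * t\<bar> / ell T t \<le> \<kappa> * T / ell T t"
      using \<kappa> ell_pos[OF t] by (intro divide_right_mono mult_left_mono) auto
    then show ?thesis using \<kappa> ell_pos[OF t] by (simp add: \<tau>_def R_def abs_mult \<kappa>_def)
  qed
  \<comment> \<open>H^10 is written as H^2 H^8 and H^8 is bounded by g, so |s \<phi>| exceeds N by
    at most H^2.\<close>
  have s\<phi>: "\<bar>s * \<phi> t x\<bar> \<le> H\<^sup>2 * N t x" if t: "0 < t" "t < T" for t x
  proof -
    have "H ^ 9 \<le> H ^ 10" using H by (intro power_increasing) auto
    then have "\<bar>g x - H ^ 10\<bar> \<le> H ^ 10" using g[of x] by auto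
    also have "H ^ 10 = H\<^sup>2 * H ^ 8" by (simp flip: power_add)
    also have "\<dots> \<le> H\<^sup>2 * g x" using g(1)[of x] by (intro mult_left_mono) auto
    finally have "\<bar>g x - H ^ 10\<bar> * (s * \<Lambda> t) \<le> H\<^sup>2 * g x * (s * \<Lambda> t)"
      using s_ge(3) \<Lambda>_pos[OF t] by (intro mult_right_mono) auto
    then show ?thesis using s_ge(3) \<Lambda>_pos[OF t] by (simp add: \<phi> N abs_mult mult_ac)
  qed
  have Npos: "0 < N t x" if t: "0 < t" "t < T" for t x using N_s0[OF t, of x] s0 by linarith
  have eN: "\<kappa> * N t x \<le> \<epsilon> * s0 * N t x" if t: "0 < t" "t < T" for t x
    using s0(5) Npos[OF t, of x] by (intro mult_right_mono) auto
  have tau_le: "\<bar>\<tau> t x\<bar> \<le> \<epsilon> * N t x" if t: "0 < t" "t < T" for t x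
  proof -
    have "\<kappa> * R t \<le> \<epsilon> * s0 * R t" using s0(5) R_pos[OF t] by (intro mult_right_mono) auto
    also have "\<dots> \<le> \<epsilon> * N t x" using R1[OF t, of x] \<epsilon> by (simp add: mult.assoc)
    finally show ?thesis using tau_R[OF t, of x] by linarith
  qed
  \<comment> \<open>The surplus H^8 contained in N pays for this H^2, so no constant depending on
    \<lambda> survives in the bounds for \<rho> and \<rho>'.\<close>
  have H2R: "H\<^sup>2 * (s0 * R t) \<le> N t x" "H\<^sup>2 * (s0 * R t)\<^sup>2 \<le> (N t x)\<^sup>2" if t: "0 < t" "t < T" for t x
  proof -
    have "H\<^sup>2 \<le> H ^ 8" using H by (intro power_increasing) auto
    then have "H\<^sup>2 * (s0 * R t) \<le> H ^ 8 * (s0 * R t)" using s0 R_pos[OF t] by (intro mult_right_mono) auto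
    then show 1: "H\<^sup>2 * (s0 * R t) \<le> N t x" using R[OF t, of x] by (simp add: mult_ac)
    have "H\<^sup>2 * (s0 * R t) * (s0 * R t) \<le> N t x * N t x"
      using 1 R1[OF t, of x] s0 R_pos[OF t] Npos[OF t, of x] by (intro mult_mono) auto
    then show "H\<^sup>2 * (s0 * R t)\<^sup>2 \<le> (N t x)\<^sup>2" by (simp add: power2_eq_square mult_ac)
  qed
  have rho_le: "\<bar>\<rho> t x\<bar> \<le> \<epsilon> * (N t x)\<^sup>2" if t: "0 < t" "t < T" for t x
  proof -
    have "\<bar>\<rho> t x\<bar> = \<bar>s * \<phi> t x\<bar> * \<bar>\<tau> t x\<bar>" by (simp add: \<rho>_def \<phi>_def abs_mult)
    also have "\<dots> \<le> (H\<^sup>2 * N t x) * (\<kappa> * R t)"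
      using s\<phi>[OF t, of x] tau_R[OF t, of x] Npos[OF t, of x] by (intro mult_mono) auto
    also have "\<dots> \<le> (H\<^sup>2 * N t x) * (\<epsilon> * s0 * R t)"
      using s0(5) R_pos[OF t] Npos[OF t, of x] by (intro mult_left_mono mult_right_mono) auto
    also have "\<dots> = \<epsilon> * N t x * (H\<^sup>2 * (s0 * R t))" by simp
    also have "\<dots> \<le> \<epsilon> * N t x * N t x" using H2R(1)[OF t, of x] \<epsilon> Npos[OF t, of x] by (intro mult_left_mono) auto
    finally show ?thesis by (simp add: power2_eq_square mult.assoc)
  qed
  have tau2: "\<bar>(\<tau> t x)\<^sup>2 + \<tau>' t x\<bar> \<le> 3 * \<kappa>\<^sup>2 * (R t)\<^sup>2" if t: "0 < t" "t < T" for t x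
  proof -
    have l: "0 < ell T t" using ell_pos[OF t] .
    have 1: "(\<tau> t x)\<^sup>2 \<le> \<kappa>\<^sup>2 * (R t)\<^sup>2"
      using power_mono[OF tau_R[OF t, of x], of 2] by (simp add: power_mult_distrib)
    have "\<bar>T - 2 * t\<bar>\<^sup>2 \<le> T\<^sup>2" using t by (intro power_mono) auto
    then have "2 * ell T t + (T - 2 * t)\<^sup>2 \<le> 2 * T\<^sup>2"
      using ell_le[of t] zero_le_power2[of T] unfolding power2_abs by linarith
    then have "\<kappa> * (2 * ell T t + (T - 2 * t)\<^sup>2) / (ell T t)\<^sup>2 \<le> \<kappa>\<^sup>2 * (2 * T\<^sup>2) / (ell T t)\<^sup>2"
      using \<kappa> \<kappa>2 l by (intro divide_right_mono mult_mono) auto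
    then have 2: "\<tau>' t x \<le> 2 * \<kappa>\<^sup>2 * (R t)\<^sup>2" by (simp add: \<tau>'_def R_def \<kappa>_def power_divide mult_ac)
    have 3: "0 \<le> \<tau>' t x" using \<kappa> l k by (simp add: \<tau>'_def)
    show ?thesis using 1 2 3 zero_le_power2[of "\<tau> t x"] by simp
  qed
  have rho'_le: "\<bar>\<rho>' t x\<bar> \<le> \<epsilon> * (N t x) ^ 3" if t: "0 < t" "t < T" for t x
  proof -
    have "\<bar>\<rho>' t x\<bar> = \<bar>s * \<phi> t x\<bar> * \<bar>(\<tau> t x)\<^sup>2 + \<tau>' t x\<bar>" by (simp only: \<rho>'_def \<phi>_def abs_mult)
    also have "\<dots> \<le> (H\<^sup>2 * N t x) * (3 * \<kappa>\<^sup>2 * (R t)\<^sup>2)"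
      using s\<phi>[OF t, of x] tau2[OF t, of x] Npos[OF t, of x] by (intro mult_mono) auto
    also have "\<dots> \<le> (H\<^sup>2 * N t x) * (\<epsilon> * s0\<^sup>2 * (R t)\<^sup>2)"
    proof -
      have "\<epsilon> * s0 * 1 \<le> \<epsilon> * s0 * s0" using s0 \<epsilon> by (intro mult_left_mono) auto
      then have "3 * \<kappa>\<^sup>2 \<le> \<epsilon> * s0\<^sup>2" using s0(1) by (simp add: power2_eq_square)
      then show ?thesis using Npos[OF t, of x] by (intro mult_left_mono mult_right_mono) auto
    qed
    also have "\<dots> = \<epsilon> * N t x * (H\<^sup>2 * (s0 * R t)\<^sup>2)" by (simp add: power_mult_distrib)
    also have "\<dots> \<le> \<epsilon> * N t x * (N t x)\<^sup>2" using H2R(2)[OF t, of x] \<epsilon> Npos[OF t, of x] by (intro mult_left_mono) auto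
    finally show ?thesis by (simp add: power2_eq_square power3_eq_cube mult.assoc)
  qed
  have contell: "continuous_on ({0<..<T} \<times> (UNIV::real set)) (\<lambda>p. ell T (fst p))"
    unfolding ell_def by (intro continuous_intros)
  have ell0: "0 < ell T (fst p)" if "p \<in> {0<..<T} \<times> (UNIV::real set)" for p
    using that by (intro ell_pos) auto
  have cont\<Lambda>: "continuous_on ({0<..<T} \<times> (UNIV::real set)) (\<lambda>p. \<Lambda> (fst p))"
    unfolding \<Lambda>_def using ell0 by (intro continuous_on_powr contell continuous_on_const) (metis less_irrefl)
  have cont\<psi>: "continuous_on UNIV \<psi>" using d0 by (auto intro!: continuous_at_imp_continuous_on DERIV_isCont)
  have contg: "continuous_on ({0<..<T} \<times> UNIV) (\<lambda>p. g (snd p))"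
    unfolding g_def by (intro continuous_intros continuous_on_compose2[OF cont\<psi>]) auto
  have cont\<phi>: "continuous_on ({0<..<T} \<times> UNIV) (\<lambda>p. \<phi> (fst p) (snd p))"
    unfolding \<phi> by (intro continuous_intros contg cont\<Lambda>)
  have contN: "cyl_continuous T N"
    unfolding cyl_continuous_def N by (intro continuous_intros contg cont\<Lambda>)
  have cont\<tau>: "cyl_continuous T \<tau>" "cyl_continuous T \<tau>'"
    unfolding cyl_continuous_def \<tau>_def \<tau>'_def
    by (intro continuous_intros contell; use ell0 in \<open>metis less_irrefl power_not_zero\<close>)+
  have perg: "g (x + 2 * pi) = g x" for x using \<psi>(1) by (simp add: g_def periodic_def)
  have per\<phi>: "\<phi> t (x + 2 * pi) = \<phi> t x" "N t (x + 2 * pi) = N t x" for t x by (simp_all add: \<phi> N perg)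
  have dg: "(g has_real_derivative \<mu> * p1 x * g x) (at x)" for x
    unfolding g_def using d0[of x] by (auto intro!: derivative_eq_intros)
  have dell: "(ell T has_real_derivative (T - 2 * t)) (at t)" for t
    unfolding ell_def by (auto intro!: derivative_eq_intros)
  have d\<Lambda>: "(\<Lambda> has_real_derivative \<tau> t x * \<Lambda> t) (at t)" if t: "0 < t" "t < T" for t x
  proof -
    have "(\<Lambda> has_real_derivative (- \<kappa>) * ell T t powr (- \<kappa> - of_nat 1) * (T - 2 * t)) (at t)"
      unfolding \<Lambda>_def by (rule DERIV_fun_powr[OF dell ell_pos[OF t]])
    moreover have "(- \<kappa>) * ell T t powr (- \<kappa> - of_nat 1) * (T - 2 * t) = \<tau> t x * \<Lambda> t"
      using ell_pos[OF t] by (simp add: \<Lambda>_def \<tau>_def \<kappa>_def powr_diff)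
    ultimately show ?thesis by simp
  qed
  have d\<tau>: "((\<lambda>r. \<tau> r x) has_real_derivative \<tau>' t x) (at t)" if t: "0 < t" "t < T" for t x
  proof -
    have "((\<lambda>r. - (k / 2) * (T - 2 * r) / ell T r) has_real_derivative
        ((- (k / 2) * (- 2)) * ell T t - (- (k / 2) * (T - 2 * t)) * (T - 2 * t)) / (ell T t * ell T t)) (at t)"
      by (rule DERIV_divide[OF _ dell]) (use ell_pos[OF t] in \<open>auto intro!: derivative_eq_intros\<close>)
    moreover have "((- (k / 2) * (- 2)) * ell T t - (- (k / 2) * (T - 2 * t)) * (T - 2 * t)) / (ell T t * ell T t) = \<tau>' t x"
    proof -
      have "(- (k / 2) * (- 2)) * ell T t - (- (k / 2) * (T - 2 * t)) * (T - 2 * t) = k / 2 * (2 * ell T t + (T - 2 * t)\<^sup>2)"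
        by (simp add: power2_eq_square field_simps)
      then show ?thesis by (simp only: \<tau>'_def power2_eq_square)
    qed
    ultimately show ?thesis by (simp add: \<tau>_def)
  qed
  have x\<phi>: "((\<lambda>y. s * \<phi> t y) has_real_derivative \<mu> * p1 x * N t x) (at x)" for t x
    unfolding \<phi> N by (auto intro!: derivative_eq_intros dg)
  have t\<phi>: "((\<lambda>r. s * \<phi> r x) has_real_derivative \<rho> t x) (at t)" if t: "0 < t" "t < T" for t x
    unfolding \<rho>_def \<phi>_def[symmetric] unfolding \<phi> by (auto intro!: derivative_eq_intros d\<Lambda>[OF t, of x])
  show ?thesis
    unfolding N_def[symmetric] \<phi>_def[symmetric]
  proof
    show "cyl_continuous T (\<lambda>t x. exp (2 * s * \<phi> t x))"
      unfolding cyl_continuous_def by (intro continuous_intros cont\<phi>)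
    show "exp (2 * s * \<phi> t (x + 2 * pi)) = exp (2 * s * \<phi> t x)" for t x by (simp add: per\<phi>)
    show "1 \<le> \<epsilon> * N t x" if t: "0 < t" "t < T" for t x
      using mult_left_mono[OF N_s0[OF t, of x], of \<epsilon>] \<epsilon> s0(4) by linarith
    show "\<exists>C. \<forall>t\<in>{0<..<T}. \<forall>x. exp (2 * s * \<phi> t x) * (1 + 1 / ell T t) ^ m \<le> C" for m
    proof (intro exI ballI allI)
      fix t x assume "t \<in> {0<..<T}"
      then have t: "0 < t" "t < T" by auto
      define c where "c = 2 * s * (H ^ 10 - H ^ 9)"
      have "1 < H" using mu \<Psi> by (simp add: H_def)
      then have c: "0 < c" using s_ge(3) power_strict_increasing[of 9 10 H] by (simp add: c_def)
      define u where "u = 1 / ell T t"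
      have u: "0 < u" using ell_pos[OF t] by (simp add: u_def)
      \<comment> \<open>For u < 1 the left side is negative, so no case needs more than \<kappa>
        \<ge> 1.\<close>
      have \<Lambda>u: "u - 1 \<le> \<Lambda> t"
      proof (cases "1 \<le> u")
        case True
        have "u powr 1 \<le> u powr \<kappa>" using True \<kappa> by (intro powr_mono) auto
        also have "u powr \<kappa> = \<Lambda> t" using ell_pos[OF t] by (simp add: u_def \<Lambda>_def powr_divide powr_minus_divide)
        finally show ?thesis using u by simp
      qed (use \<Lambda>_pos[OF t] in linarith)
      have "2 * s * \<phi> t x \<le> - c * \<Lambda> t"
      proof -
        have "2 * s * \<Lambda> t * (g x - H ^ 10) \<le> 2 * s * \<Lambda> t * (H ^ 9 - H ^ 10)"
          using g(2)[of x] s_ge(3) \<Lambda>_pos[OF t] by (intro mult_left_mono) auto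
        then show ?thesis by (simp add: \<phi> c_def algebra_simps)
      qed
      also have "\<dots> \<le> - c * (u - 1)" using \<Lambda>u c by simp
      finally have "exp (2 * s * \<phi> t x) * (1 + u) ^ m \<le> exp (- c * (u - 1)) * (1 + u) ^ m"
        using u by (intro mult_right_mono) auto
      also have "\<dots> \<le> fact m / c ^ m * exp (2 * c)" using exp_decay[OF c less_imp_le[OF u], of m] by (simp add: mult.commute)
      finally show "exp (2 * s * \<phi> t x) * (1 + 1 / ell T t) ^ m
          \<le> fact m / (2 * s * (H ^ 10 - H ^ 9)) ^ m * exp (2 * (2 * s * (H ^ 10 - H ^ 9)))"
        by (simp add: u_def c_def)
    qed
    show "moderate T N"
    proof (rule moderateI[OF contN per\<phi>(2)])
      fix t x assume t: "0 < t" "t < T"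
      define u where "u = 1 / ell T t"
      have u: "0 < u" using ell_pos[OF t] by (simp add: u_def)
      have "\<Lambda> t = u powr \<kappa>" using ell_pos[OF t] by (simp add: u_def \<Lambda>_def powr_divide powr_minus_divide)
      also have "\<dots> \<le> (1 + u) powr \<kappa>" using u \<kappa> by (intro powr_mono2) auto
      also have "\<dots> \<le> (1 + u) powr real (nat \<lceil>\<kappa>\<rceil>)" using u by (intro powr_mono real_nat_ceiling_ge) auto
      also have "\<dots> = (1 + u) ^ nat \<lceil>\<kappa>\<rceil>" using u by (intro powr_realpow) auto
      finally have "s * g x * \<Lambda> t \<le> s * H ^ 9 * (1 + u) ^ nat \<lceil>\<kappa>\<rceil>"
        using s_ge(3) g[of x] \<Lambda>_pos[OF t] H by (intro mult_mono) auto
      then show "\<bar>N t x\<bar> \<le> s * H ^ 9 * (1 + 1 / ell T t) ^ nat \<lceil>\<kappa>\<rceil>"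
        using Npos[OF t, of x] by (simp add: N u_def)
    qed
    show "\<tau> t (x + 2 * pi) = \<tau> t x" for t x by (simp add: \<tau>_def)
    show "cyl_continuous T \<rho>" "cyl_continuous T \<rho>'"
      using cont\<tau> unfolding cyl_continuous_def \<rho>_def \<rho>'_def \<phi>_def[symmetric]
      by - (intro continuous_intros cont\<phi>; assumption)+
    show "\<rho> t (x + 2 * pi) = \<rho> t x" "\<rho>' t (x + 2 * pi) = \<rho>' t x" for t x
      by (simp_all add: \<rho>_def \<rho>'_def \<phi>_def[symmetric] per\<phi> \<tau>_def \<tau>'_def)
    show "x_deriv T (\<lambda>t x. exp (2 * s * \<phi> t x)) (\<lambda>t x. 2 * (\<mu> * p1 x * N t x) * exp (2 * s * \<phi> t x))"
      unfolding x_deriv_def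
    proof (intro ballI allI)
      fix t x
      have "((\<lambda>y. exp (2 * (s * \<phi> t y))) has_real_derivative exp (2 * (s * \<phi> t x)) * (2 * (\<mu> * p1 x * N t x))) (at x)"
        by (intro DERIV_fun_exp DERIV_cmult x\<phi>)
      then show "((\<lambda>y. exp (2 * s * \<phi> t y)) has_real_derivative 2 * (\<mu> * p1 x * N t x) * exp (2 * s * \<phi> t x)) (at x)"
        by (simp only: mult.assoc mult.commute[of "exp _"])
    qed
    show "t_deriv T (\<lambda>t x. exp (2 * s * \<phi> t x)) (\<lambda>t x. 2 * \<rho> t x * exp (2 * s * \<phi> t x))"
      unfolding t_deriv_def
    proof (intro ballI allI)
      fix t x assume "t \<in> {0<..<T}"
      then have t: "0 < t" "t < T" by auto
      have "((\<lambda>r. exp (2 * (s * \<phi> r x))) has_real_derivative exp (2 * (s * \<phi> t x)) * (2 * \<rho> t x)) (at t)"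
        by (intro DERIV_fun_exp DERIV_cmult t\<phi>[OF t])
      then show "((\<lambda>r. exp (2 * s * \<phi> r x)) has_real_derivative 2 * \<rho> t x * exp (2 * s * \<phi> t x)) (at t)"
        by (simp only: mult.assoc mult.commute[of "exp _"])
    qed
    show "x_deriv T N (\<lambda>t x. \<mu> * p1 x * N t x)"
      unfolding x_deriv_def N by (auto intro!: derivative_eq_intros dg)
    show "t_deriv T N (\<lambda>t x. \<tau> t x * N t x)"
      unfolding t_deriv_def N
    proof (intro ballI allI)
      fix t x assume "t \<in> {0<..<T}"
      then show "((\<lambda>r. s * g x * \<Lambda> r) has_real_derivative \<tau> t x * (s * g x * \<Lambda> t)) (at t)"
        using DERIV_cmult[OF d\<Lambda>[of t x], of "s * g x"] by (simp add: mult_ac)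
    qed
    show "t_deriv T \<rho> \<rho>'"
      unfolding t_deriv_def
    proof (intro ballI allI)
      fix t x assume "t \<in> {0<..<T}"
      then have t: "0 < t" "t < T" by auto
      have "((\<lambda>r. s * \<phi> r x * \<tau> r x) has_real_derivative \<rho> t x * \<tau> t x + \<tau>' t x * (s * \<phi> t x)) (at t)"
        by (rule DERIV_mult[OF t\<phi>[OF t] d\<tau>[OF t]])
      then show "((\<lambda>r. \<rho> r x) has_real_derivative \<rho>' t x) (at t)"
        by (simp add: \<rho>_def \<rho>'_def \<phi>_def power2_eq_square algebra_simps)
    qed
    show "x_deriv T \<rho> (\<lambda>t x. \<mu> * p1 x * \<tau> t x * N t x)"
      unfolding x_deriv_def
    proof (intro ballI allI)
      fix t x
      \<comment> \<open>\<tau> does not depend on x; its value at the dummy point 0 serves as a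
        constant factor.\<close>
      have "((\<lambda>y. s * \<phi> t y * \<tau> t 0) has_real_derivative \<mu> * p1 x * N t x * \<tau> t 0) (at x)"
        by (rule DERIV_cmult_right[OF x\<phi>])
      then show "((\<lambda>y. \<rho> t y) has_real_derivative \<mu> * p1 x * \<tau> t x * N t x) (at x)"
        by (simp add: \<rho>_def \<phi>_def \<tau>_def mult_ac)
    qed
  qed (fact \<epsilon> mu T Npos cont\<tau> tau_le rho_le rho'_le | simp)+
qed

section \<open>Regularity of the solution space\<close>

lemma Ck_on_linear:
  fixes f g :: "real \<Rightarrow> real"
  assumes "Ck_on n UNIV f" "Ck_on n UNIV g"
  shows "Ck_on n UNIV (\<lambda>x. a * f x + b * g x)"
  using assms
proof (induction n arbitrary: f g)
  case 0
  then show ?case by (auto intro!: continuous_intros)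
next
  case (Suc n)
  note f = Ck_on_deriv[OF Suc.prems(1)] and g = Ck_on_deriv[OF Suc.prems(2)]
  have "((\<lambda>x. a * f x + b * g x) has_real_derivative a * deriv f x + b * deriv g x) (at x)" for x
    by (intro DERIV_add DERIV_cmult f(1) g(1))
  moreover have "Ck_on n UNIV (\<lambda>x. a * deriv f x + b * deriv g x)"
    by (rule Suc.IH[OF f(2) g(2)])
  ultimately show ?case
    unfolding Ck_on.simps
    by (intro exI[of _ "\<lambda>x h. (a * deriv f x + b * deriv g x) * h"]) (auto simp: has_field_derivative_def)
qed

lemma C4_torus_linear:
  assumes "f \<in> C4_torus" "g \<in> C4_torus"
  shows "(\<lambda>x. a * f x + b * g x) \<in> C4_torus"
  using assms Ck_on_linear[of 4 f g a b] by (auto simp: C4_torus_def periodic_def)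

lemma C4_torus_derivs:
  assumes "f \<in> C4_torus" "i \<le> 4"
  shows "periodic ((deriv ^^ i) f) \<and> Ck_on (4 - i) UNIV ((deriv ^^ i) f)"
  using assms(2)
proof (induction i)
  case 0
  then show ?case using assms(1) by (simp add: C4_torus_def)
next
  case (Suc i)
  have "4 - i = Suc (4 - Suc i)" using Suc.prems by simp
  then have IH: "periodic ((deriv ^^ i) f)" "Ck_on (Suc (4 - Suc i)) UNIV ((deriv ^^ i) f)"
    using Suc by (simp_all only: Suc_leD)
  note d = Ck_on_deriv[OF IH(2)]
  show ?case using d(2) periodic_deriv[OF IH(1) d(1)] by simp
qed

lemma C4_torus_has_deriv:
  assumes "f \<in> C4_torus" "i < 4"
  shows "((deriv ^^ i) f has_real_derivative (deriv ^^ Suc i) f x) (at x)"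
proof -
  have "4 - i = Suc (4 - Suc i)" "i \<le> 4" using assms(2) by simp_all
  then have "Ck_on (Suc (4 - Suc i)) UNIV ((deriv ^^ i) f)"
    using C4_torus_derivs[OF assms(1), of i] by (simp only:)
  from Ck_on_deriv(1)[OF this, of x] show ?thesis by simp
qed

lemma C4_torus_cont:
  assumes "f \<in> C4_torus" "i \<le> 4"
  shows "continuous_on UNIV ((deriv ^^ i) f)" "periodic ((deriv ^^ i) f)"
  using C4_torus_derivs[OF assms] Ck_on_continuous by blast+

lemma deriv_power_linear:
  assumes "f \<in> C4_torus" "g \<in> C4_torus" "i \<le> 4"
  shows "(deriv ^^ i) (\<lambda>x. a * f x + b * g x) = (\<lambda>x. a * (deriv ^^ i) f x + b * (deriv ^^ i) g x)"
  using assms(3)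
proof (induction i)
  case (Suc i)
  have "((\<lambda>x. a * (deriv ^^ i) f x + b * (deriv ^^ i) g x) has_real_derivative
      a * (deriv ^^ Suc i) f x + b * (deriv ^^ Suc i) g x) (at x)" for x
    using Suc.prems assms(1,2) by (intro DERIV_add DERIV_cmult C4_torus_has_deriv) auto
  then have "deriv (\<lambda>x. a * (deriv ^^ i) f x + b * (deriv ^^ i) g x)
      = (\<lambda>x. a * (deriv ^^ Suc i) f x + b * (deriv ^^ Suc i) g x)"
    by (intro ext DERIV_imp_deriv)
  then show ?case using Suc by simp
qed simp

text \<open>Periodicity bounds each derivative, so every supremum in the norm is a genuine least
  upper bound and is nonnegative; one summand is then at most the sum.\<close>

lemma le_C4_norm:
  assumes "f \<in> C4_torus" "i \<le> 4"
  shows "\<bar>(deriv ^^ i) f x\<bar> \<le> C4_norm f"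
proof -
  have bdd: "bdd_above (range (\<lambda>x. \<bar>(deriv ^^ j) f x\<bar>))" if "j \<le> 4" for j
    using periodic_bounded[OF C4_torus_cont(2,1)[OF assms(1) that]] by (auto simp: bdd_above_def)
  have le: "\<bar>(deriv ^^ j) f y\<bar> \<le> (SUP x. \<bar>(deriv ^^ j) f x\<bar>)" if "j \<le> 4" for j y
    by (rule cSUP_upper[OF _ bdd[OF that]]) simp
  have nonneg: "0 \<le> (SUP x. \<bar>(deriv ^^ j) f x\<bar>)" if "j \<le> 4" for j
    using le[OF that, of 0] by linarith
  have "(SUP x. \<bar>(deriv ^^ i) f x\<bar>) \<le> C4_norm f"
    unfolding C4_norm_def by (rule member_le_sum) (use assms(2) nonneg in auto)
  then show ?thesis using le[OF assms(2), of x] by linarith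
qed

text \<open>Continuity of the curve t \<mapsto> F t in the supremum norm, on the closed
  interval.\<close>

definition uniformly_cont_in_time :: "real \<Rightarrow> (real \<Rightarrow> real \<Rightarrow> real) \<Rightarrow> bool" where
  "uniformly_cont_in_time T F \<longleftrightarrow>
     (\<forall>t\<in>{0..T}. \<forall>\<epsilon>>0. \<exists>d>0. \<forall>r\<in>{0..T}. \<bar>r - t\<bar> < d \<longrightarrow> (\<forall>x. \<bar>F r x - F t x\<bar> \<le> \<epsilon>))"

text \<open>Continuity in t uniformly in x, together with continuity in x, gives joint continuity on
  the closed cylinder. Compactness of one period then bounds F, so exponent 0 suffices in the growth
  bound.\<close>

lemma moderate_if_uniformly_cont:
  assumes u: "uniformly_cont_in_time T F"
    and F: "\<And>t. t \<in> {0..T} \<Longrightarrow> periodic (F t)" "\<And>t. t \<in> {0..T} \<Longrightarrow> continuous_on UNIV (F t)"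
  shows "moderate T F"
proof -
  have cont: "continuous_on ({0..T} \<times> UNIV) (\<lambda>p. F (fst p) (snd p))"
    unfolding continuous_on_iff
  proof (intro ballI allI impI)
    fix p :: "real \<times> real" and \<epsilon> :: real assume p: "p \<in> {0..T} \<times> UNIV" and \<epsilon>: "0 < \<epsilon>"
    obtain t x where tx: "p = (t, x)" "t \<in> {0..T}" using p by auto
    have "0 < \<epsilon> / 2" using \<epsilon> by simp
    then obtain d1 where d1: "0 < d1" "\<forall>r\<in>{0..T}. \<bar>r - t\<bar> < d1 \<longrightarrow> (\<forall>y. \<bar>F r y - F t y\<bar> \<le> \<epsilon> / 2)"
      using u tx(2) unfolding uniformly_cont_in_time_def by blast
    obtain d2 where d2: "0 < d2" "\<forall>y. dist y x < d2 \<longrightarrow> dist (F t y) (F t x) < \<epsilon> / 2"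
      using F(2)[OF tx(2)] \<open>0 < \<epsilon> / 2\<close> unfolding continuous_on_iff by blast
    show "\<exists>d>0. \<forall>p'\<in>{0..T} \<times> UNIV. dist p' p < d \<longrightarrow> dist (F (fst p') (snd p')) (F (fst p) (snd p)) < \<epsilon>"
    proof (intro exI[of _ "min d1 d2"] conjI ballI impI)
      fix p' :: "real \<times> real" assume p': "p' \<in> {0..T} \<times> UNIV" "dist p' p < min d1 d2"
      obtain r y where ry: "p' = (r, y)" "r \<in> {0..T}" using p' by auto
      have "dist r t < d1" "dist y x < d2"
        using p'(2) dist_fst_le[of p' p] dist_snd_le[of p' p] unfolding ry tx by auto
      then have "\<bar>F r y - F t y\<bar> \<le> \<epsilon> / 2" "dist (F t y) (F t x) < \<epsilon> / 2"
        using d1(2) d2(2) ry(2) by (auto simp: dist_real_def)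
      then show "dist (F (fst p') (snd p')) (F (fst p) (snd p)) < \<epsilon>"
        unfolding ry tx dist_real_def fst_conv snd_conv by linarith
    qed (use d1 d2 in auto)
  qed
  have "compact ((\<lambda>p. F (fst p) (snd p)) ` ({0..T} \<times> {0..2 * pi}))"
    by (intro compact_continuous_image continuous_on_subset[OF cont] compact_Times) auto
  then obtain B where B: "\<forall>y\<in>(\<lambda>p. F (fst p) (snd p)) ` ({0..T} \<times> {0..2 * pi}). norm y \<le> B"
    using compact_imp_bounded bounded_iff by metis
  show ?thesis
  proof (rule moderateI[where C = B and m = 0])
    show "cyl_continuous T F"
      unfolding cyl_continuous_def by (rule continuous_on_subset[OF cont]) auto
    show "F t (x + 2 * pi) = F t x" if "0 < t" "t < T" for t x
      using F(1)[of t] that by (simp add: periodic_def)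
    show "\<bar>F t x\<bar> \<le> B * (1 + 1 / ell T t) ^ 0" if t: "0 < t" "t < T" for t x
    proof -
      obtain n where n: "x + 2 * pi * of_int n \<in> {0..<2 * pi}" by (rule torus_representative)
      have "(t, x + 2 * pi * of_int n) \<in> {0..T} \<times> {0..2 * pi}" using n t by auto
      from bspec[OF B imageI[OF this]] have "\<bar>F t (x + 2 * pi * of_int n)\<bar> \<le> B" by simp
      moreover have "periodic (F t)" using F(1)[of t] t by simp
      ultimately show ?thesis by (simp only: periodic_int power_0 mult_1_right)
    qed
  qed
qed

text \<open>\<open>E j i\<close> plays the role of the derivative of order j in time and i in space,
  with all mixed derivatives shared between the two directions.\<close>

definition space_time_jet :: "real \<Rightarrow> (nat \<Rightarrow> nat \<Rightarrow> real \<Rightarrow> real \<Rightarrow> real) \<Rightarrow> bool" where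
  "space_time_jet T E \<longleftrightarrow>
     (\<forall>j\<le>2. \<forall>i\<le>4. moderate T (E j i)) \<and>
     (\<forall>j\<le>2. \<forall>i<4. x_deriv T (E j i) (E j (Suc i))) \<and>
     (\<forall>j<2. \<forall>i\<le>4. t_deriv T (E j i) (E (Suc j) i))"

text \<open>The C^4 norm of a difference quotient dominates each of its x-derivatives up to order 4,
  so a time derivative in C^4 commutes with them. Values of \<open>dt\<close> are claimed only for 0
  < t < T, since \<open>dt\<close> uses the two-sided derivative of a curve controlled only on
  [0,T].\<close>

lemma C2_C4_jet:
  assumes T: "0 < T" and \<eta>: "\<eta> \<in> C2_C4 T"
  shows "\<exists>E. space_time_jet T E \<and> (\<forall>i t x. (dx ^^ i) \<eta> t x = E 0 i t x) \<and>
    (\<forall>i t x. 0 < t \<longrightarrow> t < T \<longrightarrow> i \<le> 4 \<longrightarrow>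
      dt ((dx ^^ i) \<eta>) t x = E 1 i t x \<and> (dx ^^ i) (dt \<eta>) t x = E 1 i t x) \<and>
    (\<forall>t x. 0 < t \<longrightarrow> t < T \<longrightarrow> (dt ^^ 2) \<eta> t x = E 2 0 t x)"
proof -
  obtain \<eta>1 \<eta>2 where \<eta>12: "\<forall>t\<in>{0..T}. \<eta> t \<in> C4_torus \<and> \<eta>1 t \<in> C4_torus \<and> \<eta>2 t \<in> C4_torus"
      "C4_has_deriv T \<eta> \<eta>1" "C4_has_deriv T \<eta>1 \<eta>2" "C4_continuous T \<eta>2"
    using \<eta> unfolding C2_C4_def by blast
  \<comment> \<open>Indices above 2 repeat the second time derivative; only h 0 and h 1 are claimed
    to be differentiable in time.\<close>
  define h where "h = (\<lambda>j::nat. if j = 0 then \<eta> else if j = 1 then \<eta>1 else \<eta>2)"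
  have h: "h j t \<in> C4_torus" if "t \<in> {0..T}" for j t
    using \<eta>12(1) that by (auto simp: h_def)
  have hd: "C4_has_deriv T (h j) (h (Suc j))" if "j < 2" for j
    using \<eta>12(2,3) that by (auto simp: h_def less_2_cases_iff)
  define E where "E = (\<lambda>j i t. (deriv ^^ i) (h j t))"
  have quot: "((\<lambda>r. C4_norm (\<lambda>x. (h j r x - h j t x) / (r - t) - h (Suc j) t x)) \<longlongrightarrow> 0) (at t within {0..T})"
    if "j < 2" "t \<in> {0..T}" for j t
    using hd[OF that(1)] that(2) by (auto simp: C4_has_deriv_def)
  have quot_le: "\<bar>(E j i r x - E j i t x) / (r - t) - E (Suc j) i t x\<bar>
      \<le> C4_norm (\<lambda>x. (h j r x - h j t x) / (r - t) - h (Suc j) t x)"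
    if "i \<le> 4" "t \<in> {0..T}" "r \<in> {0..T}" for j i t r x
  proof -
    \<comment> \<open>For r = t both this factor and the quotient are 0 by the convention for
      division, so the bound needs no case distinction.\<close>
    define c where "c = 1 / (r - t)"
    let ?g = "\<lambda>x. 1 * h j r x + (-1) * h j t x"
    have g: "?g \<in> C4_torus" using h that by (intro C4_torus_linear) auto
    have e: "(\<lambda>x. (h j r x - h j t x) / (r - t) - h (Suc j) t x) = (\<lambda>x. c * ?g x + (-1) * h (Suc j) t x)"
      by (simp add: c_def fun_eq_iff diff_divide_distrib)
    have m: "(\<lambda>x. c * ?g x + (-1) * h (Suc j) t x) \<in> C4_torus"
      using g h that by (intro C4_torus_linear) auto
    have "(deriv ^^ i) (\<lambda>x. c * ?g x + (-1) * h (Suc j) t x) x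
        = c * (1 * E j i r x + (-1) * E j i t x) + (-1) * E (Suc j) i t x"
      unfolding deriv_power_linear[OF g h[OF that(2)] that(1)]
        deriv_power_linear[OF h[OF that(3)] h[OF that(2)] that(1)] E_def ..
    also have "\<dots> = (E j i r x - E j i t x) / (r - t) - E (Suc j) i t x"
      by (simp add: c_def diff_divide_distrib)
    finally show ?thesis using le_C4_norm[OF m that(1), of x] unfolding e by simp
  qed
  have cont: "continuous_on UNIV (E j i t)" "periodic (E j i t)" if "i \<le> 4" "t \<in> {0..T}" for j i t
    using C4_torus_cont[OF h[OF that(2)] that(1)] by (auto simp: E_def)
  have unif: "uniformly_cont_in_time T (E j i)" if ji: "j \<le> 2" "i \<le> 4" for j i
    unfolding uniformly_cont_in_time_def
  proof (intro ballI allI impI)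
    fix t \<epsilon> :: real assume t: "t \<in> {0..T}" and \<epsilon>: "0 < \<epsilon>"
    show "\<exists>d>0. \<forall>r\<in>{0..T}. \<bar>r - t\<bar> < d \<longrightarrow> (\<forall>x. \<bar>E j i r x - E j i t x\<bar> \<le> \<epsilon>)"
    \<comment> \<open>For j < 2 continuity in time follows from differentiability, with the local
      Lipschitz constant 1 + B; for j = 2 it is the assumed continuity.\<close>
    proof (cases "j < 2")
      case True
      obtain B where B: "\<forall>x. \<bar>E (Suc j) i t x\<bar> \<le> B"
        using periodic_bounded[OF cont(2,1)[OF ji(2) t]] by blast
      have B0: "0 \<le> B" using B[rule_format, of 0] by linarith
      have "\<forall>\<^sub>F r in at t within {0..T}. C4_norm (\<lambda>x. (h j r x - h j t x) / (r - t) - h (Suc j) t x) < 1"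
        using quot[OF True t] by (rule order_tendstoD) simp
      then obtain d where d: "0 < d" "\<forall>r\<in>{0..T}. r \<noteq> t \<and> dist r t < d \<longrightarrow>
          C4_norm (\<lambda>x. (h j r x - h j t x) / (r - t) - h (Suc j) t x) < 1"
        unfolding eventually_at by blast
      show ?thesis
      proof (intro exI[of _ "min d (\<epsilon> / (1 + B))"] conjI ballI impI allI)
        fix r x assume r: "r \<in> {0..T}" "\<bar>r - t\<bar> < min d (\<epsilon> / (1 + B))"
        show "\<bar>E j i r x - E j i t x\<bar> \<le> \<epsilon>"
        proof (cases "r = t")
          case False
          have "\<bar>(E j i r x - E j i t x) / (r - t) - E (Suc j) i t x\<bar> < 1"
            using quot_le[OF ji(2) t r(1), of j x] d(2) r False by (auto simp: dist_real_def)
          then have "\<bar>(E j i r x - E j i t x) / (r - t)\<bar> \<le> 1 + B" using B[rule_format, of x] by linarith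
          then have "\<bar>E j i r x - E j i t x\<bar> \<le> (1 + B) * \<bar>r - t\<bar>"
            using False by (simp add: abs_divide pos_divide_le_eq)
          also have "\<dots> \<le> (1 + B) * (\<epsilon> / (1 + B))" using r(2) B0 by (intro mult_left_mono) auto
          also have "\<dots> = \<epsilon>" using B0 by simp
          finally show ?thesis .
        qed (use \<epsilon> in simp)
      qed (use d(1) \<epsilon> B0 in auto)
    next
      case False
      then have j: "h j = \<eta>2" using ji by (simp add: h_def)
      have "((\<lambda>r. C4_norm (\<lambda>x. \<eta>2 r x - \<eta>2 t x)) \<longlongrightarrow> 0) (at t within {0..T})"
        using \<eta>12(4) t by (auto simp: C4_continuous_def)
      then have "\<forall>\<^sub>F r in at t within {0..T}. C4_norm (\<lambda>x. \<eta>2 r x - \<eta>2 t x) < \<epsilon>"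
        using \<epsilon> by (rule order_tendstoD)
      then obtain d where d: "0 < d" "\<forall>r\<in>{0..T}. r \<noteq> t \<and> dist r t < d \<longrightarrow> C4_norm (\<lambda>x. \<eta>2 r x - \<eta>2 t x) < \<epsilon>"
        unfolding eventually_at by blast
      show ?thesis
      proof (intro exI[of _ d] conjI ballI impI allI)
        fix r x assume r: "r \<in> {0..T}" "\<bar>r - t\<bar> < d"
        show "\<bar>E j i r x - E j i t x\<bar> \<le> \<epsilon>"
        proof (cases "r = t")
          case False
          let ?g = "\<lambda>x. 1 * h j r x + (-1) * h j t x"
          have g: "?g \<in> C4_torus" using h t r by (intro C4_torus_linear) auto
          have e: "?g = (\<lambda>x. \<eta>2 r x - \<eta>2 t x)" by (simp add: j)
          have "(deriv ^^ i) ?g x = 1 * E j i r x + (-1) * E j i t x"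
            unfolding deriv_power_linear[OF h[OF r(1)] h[OF t] ji(2)] E_def ..
          then have "\<bar>E j i r x - E j i t x\<bar> \<le> C4_norm ?g" using le_C4_norm[OF g ji(2), of x] by simp
          then show ?thesis using d(2) r False unfolding e by (fastforce simp: dist_real_def)
        qed (use \<epsilon> in simp)
      qed (rule d(1))
    qed
  qed
  have td: "((\<lambda>r. E j i r x) has_real_derivative E (Suc j) i t x) (at t)"
    if "j < 2" "i \<le> 4" "0 < t" "t < T" for j i t x
  proof -
    have t: "t \<in> {0..T}" using that by auto
    have "((\<lambda>r. (E j i r x - E j i t x) / (r - t) - E (Suc j) i t x) \<longlongrightarrow> 0) (at t within {0..T})"
    proof (rule Lim_null_comparison[OF _ quot[OF that(1) t]])
      show "\<forall>\<^sub>F r in at t within {0..T}. norm ((E j i r x - E j i t x) / (r - t) - E (Suc j) i t x)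
          \<le> C4_norm (\<lambda>x. (h j r x - h j t x) / (r - t) - h (Suc j) t x)"
        using quot_le[OF that(2) t] by (auto simp: eventually_at_filter)
    qed
    then have "((\<lambda>r. E j i r x) has_real_derivative E (Suc j) i t x) (at t within {0..T})"
      unfolding has_field_derivative_iff by (subst (asm) LIM_zero_iff)
    moreover have "at t within {0..T} = at t"
      using that by (intro at_within_interior) (auto simp: interior_atLeastAtMost_real)
    ultimately show ?thesis by simp
  qed
  have dxp: "(dx ^^ i) F t = (deriv ^^ i) (F t)" for i F t
  proof (induction i)
    case (Suc i)
    have "(dx ^^ Suc i) F t = deriv ((dx ^^ i) F t)" by (simp add: dx_def[of "(dx ^^ i) F"])
    then show ?case by (simp add: Suc)
  qed simp
  have dt1: "dt \<eta> t x = E 1 0 t x" if "0 < t" "t < T" for t x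
    using DERIV_imp_deriv[OF td[of 0 0 t x]] that by (simp add: dt_def E_def h_def)
  show ?thesis
  proof (intro exI[of _ E] conjI allI impI)
    have "moderate T (E j i)" if "j \<le> 2" "i \<le> 4" for j i
      by (rule moderate_if_uniformly_cont[OF unif[OF that] cont(2,1)[OF that(2)]])
    moreover have "x_deriv T (E j i) (E j (Suc i))" if "j \<le> 2" "i < 4" for j i
      unfolding x_deriv_def E_def using C4_torus_has_deriv[OF h that(2)] by auto
    moreover have "t_deriv T (E j i) (E (Suc j) i)" if "j < 2" "i \<le> 4" for j i
      unfolding t_deriv_def using td[OF that] by auto
    ultimately show "space_time_jet T E" by (simp add: space_time_jet_def)
    show dx0: "(dx ^^ i) \<eta> t x = E 0 i t x" for i t x by (simp add: dxp E_def h_def)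
    show "dt ((dx ^^ i) \<eta>) t x = E 1 i t x" if "0 < t" "t < T" "i \<le> 4" for i t x
      using DERIV_imp_deriv[OF td[of 0 i t x]] that by (simp add: dt_def dx0)
    show "(dx ^^ i) (dt \<eta>) t x = E 1 i t x" if "0 < t" "t < T" "i \<le> 4" for i t x
    proof -
      have "dt \<eta> t = h 1 t" using dt1[OF that(1,2)] by (auto simp: E_def)
      then show ?thesis by (simp add: dxp E_def)
    qed
    show "(dt ^^ 2) \<eta> t x = E 2 0 t x" if t: "0 < t" "t < T" for t x
    proof -
      have "((\<lambda>r. E 1 0 r x) has_real_derivative E 2 0 t x) (at t)"
        using td[of 1 0 t x] t by (simp add: numeral_2_eq_2)
      then have "((\<lambda>r. dt \<eta> r x) has_real_derivative E 2 0 t x) (at t)"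
        by (rule has_field_derivative_transform_within_open[where S = "{0<..<T}"]) (use t dt1 in auto)
      then show ?thesis by (simp add: numeral_2_eq_2 dt_def[of "dt \<eta>"] DERIV_imp_deriv)
    qed
  qed
qed

section \<open>The Carleman estimate\<close>

text \<open>The square of \<open>alpha_star\<close> is below 4 as soon as \<open>beta_star\<close> >
  -2/5, so positivity of the root is enough.\<close>

lemma alpha_star_less_2: "alpha_star < 2"
proof -
  let ?p = "\<lambda>b::real. 36 * b ^ 3 + 111 * b ^ 2 + 77 * b - 58"
  have root: "?p beta_star = 0"
    unfolding beta_star_def by (rule theI'[OF beta_star_ex1])
  have "0 < beta_star"
  proof (rule ccontr)
    assume "\<not> 0 < beta_star"
    define y where "y = - beta_star"
    have y: "0 \<le> y" using \<open>\<not> 0 < beta_star\<close> by (simp add: y_def)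
    have eq: "y * (36 * y\<^sup>2 - 111 * y + 77) = - 58"
      using root by (simp add: y_def power2_eq_square power3_eq_cube algebra_simps)
    \<comment> \<open>Completing the square keeps the quadratic factor above -9, so for y \<le> 6
      the product is at least -54 and cannot be -58. For y > 6 the factor is nonnegative.\<close>
    have "0 \<le> (6 * y - 37 / 4)\<^sup>2" by simp
    then have low: "- 9 \<le> 36 * y\<^sup>2 - 111 * y + 77" by (simp add: power2_eq_square algebra_simps)
    show False
    proof (cases "y \<le> 6")
      case True
      have "y * (- 9) \<le> y * (36 * y\<^sup>2 - 111 * y + 77)" using low y by (intro mult_left_mono)
      then show False using True eq by linarith
    next
      case False
      then have "6 * y \<le> y\<^sup>2" by (simp add: power2_eq_square)
      then have "0 \<le> 36 * y\<^sup>2 - 111 * y + 77" using False by linarith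
      then have "0 \<le> y * (36 * y\<^sup>2 - 111 * y + 77)" using y by simp
      then show False using eq by simp
    qed
  qed
  then have "6 * (2 - beta_star) / (4 + beta_star) < 4" by (simp add: pos_divide_less_eq)
  then have "alpha_star < sqrt 4" unfolding alpha_star_def by (rule real_sqrt_less_mono)
  then show ?thesis by simp
qed

section \<open>Passage to the integrals of the theorem\<close>

lemma cyl_integral_cong:
  "(\<And>t x. 0 < t \<Longrightarrow> t < T \<Longrightarrow> F t x = G t x) \<Longrightarrow> cyl_integral T J F = cyl_integral T J G"
  unfolding cyl_integral_def set_lebesgue_integral_def
  by (rule Bochner_Integration.integral_cong) (auto simp: indicator_def)

lemma cyl_integral_cmult: "c * cyl_integral T J F = cyl_integral T J (\<lambda>t x. c * F t x)"
  unfolding cyl_integral_def by (simp add: case_prod_unfold)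

context carleman_weight
begin

text \<open>Here the last two powers of the cutoff are given up: q^2 is at most the indicator of
  J.\<close>

lemma I_cutoff_le:
  assumes G: "moderate T G" "\<And>t x. 0 < t \<Longrightarrow> t < T \<Longrightarrow> 0 \<le> G t x"
    and J: "open J" "\<And>x. x \<notin> J \<Longrightarrow> q x = 0"
  shows "I (\<lambda>t x. q x ^ 2 * G t x) \<le> cyl_integral T J (\<lambda>t x. e t x * G t x)"
proof -
  let ?S = "{0<..<T} \<times> (J \<inter> torus_fund)"
  have m: "moderate T (\<lambda>t x. q x ^ 2 * G t x)" by (intro weight_intros G)
  have B: "J \<in> sets borel" using J(1) by simp
  have qJ: "x \<in> J" if "q x \<noteq> 0" for x using J(2) that by blast
  have "I (\<lambda>t x. q x ^ 2 * G t x) = set_lebesgue_integral lborel ?S (\<lambda>(t, x). e t x * (q x ^ 2 * G t x))"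
    unfolding I_def cyl_integral_def set_lebesgue_integral_def
    by (rule Bochner_Integration.integral_cong) (auto simp: indicator_def dest: qJ)
  also have "\<dots> \<le> set_lebesgue_integral lborel ?S (\<lambda>(t, x). e t x * G t x)"
  proof (rule set_integral_mono[OF I_integrable[OF m B] I_integrable[OF G(1) B]])
    fix p :: "real \<times> real" assume "p \<in> ?S"
    then obtain t x where p: "p = (t, x)" and t: "0 < t" "t < T" by auto
    have "q x ^ 2 \<le> 1" using q01[of x] by (simp add: power_le_one)
    then have "q x ^ 2 * G t x \<le> 1 * G t x" using G(2)[OF t, of x] by (intro mult_right_mono)
    then show "(case p of (t, x) \<Rightarrow> e t x * (q x ^ 2 * G t x)) \<le> (case p of (t, x) \<Rightarrow> e t x * G t x)"
      using e_pos[OF t, of x] by (simp add: p)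
  qed
  also have "\<dots> = cyl_integral T J (\<lambda>t x. e t x * G t x)" by (simp add: cyl_integral_def)
  finally show ?thesis .
qed

end

theorem theorem1p11:
  fixes \<omega> \<omega>0 :: "(real \<times> real) set" and J J0 :: "real set"
    and \<psi>\<Omega> :: "real \<times> real \<Rightarrow> real" and \<psi>I :: "real \<Rightarrow> real"
    and \<alpha> k :: real
  assumes "open \<omega>" "\<omega> \<noteq> {}" "\<omega> \<subseteq> strip" "strip_invariant \<omega>"
    and "open \<omega>0" "\<omega>0 \<noteq> {}" "strip_invariant \<omega>0" "compactly_in \<omega>0 \<omega>"
    and "open J" "J \<noteq> {}" "torus_invariant J"
    and "open J0" "J0 \<noteq> {}" "torus_invariant J0" "compactly_in J0 J"
    and "weight_Omega \<omega>0 \<psi>\<Omega>" "weight_torus J0 \<psi>I"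
    and "0 < \<alpha>" "\<alpha> < alpha_star" "k \<ge> 2"
  shows "\<exists>c0 \<mu>0 s0 :: real. c0 > 0 \<and> \<mu>0 \<ge> 1 \<and> s0 \<ge> 1 \<and>
    (\<forall>\<mu> \<ge> \<mu>0. \<forall>lam \<ge> \<mu>. \<forall>T > 0. \<forall>s \<ge> s0 * (T powr k + T powr (k - 1)). \<forall>\<eta> \<in> C2_C4 T.
      (let \<phi> = phi0 \<psi>I (Psi \<psi>\<Omega> \<psi>I) k T lam \<mu>; \<xi> = xi0 \<psi>I (Psi \<psi>\<Omega> \<psi>I) k T lam \<mu> in
        cyl_integral T UNIV (\<lambda>t x. exp (2 * s * \<phi> t x) *
          (s ^ 7 * \<mu> ^ 8 * \<xi> t x ^ 7 * \<bar>\<eta> t x\<bar>\<^sup>2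
           + s ^ 5 * \<mu> ^ 6 * \<xi> t x ^ 5 * \<bar>dx \<eta> t x\<bar>\<^sup>2
           + s ^ 3 * \<mu> ^ 4 * \<xi> t x ^ 3 * \<bar>(dx ^^ 2) \<eta> t x\<bar>\<^sup>2
           + s ^ 3 * \<mu> ^ 4 * \<xi> t x ^ 3 * \<bar>dt \<eta> t x\<bar>\<^sup>2
           + s * \<mu> ^ 2 * \<xi> t x * \<bar>(dx ^^ 3) \<eta> t x\<bar>\<^sup>2
           + s * \<mu> ^ 2 * \<xi> t x * \<bar>dt (dx \<eta>) t x\<bar>\<^sup>2))
        + 1 / s * cyl_integral T UNIV (\<lambda>t x. 1 / \<xi> t x * exp (2 * s * \<phi> t x) *
          (\<bar>(dx ^^ 4) \<eta> t x\<bar>\<^sup>2 + \<bar>(dt ^^ 2) \<eta> t x\<bar>\<^sup>2 + \<bar>dt ((dx ^^ 2) \<eta>) t x\<bar>\<^sup>2))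
        \<le> c0 * (cyl_integral T J (\<lambda>t x.
                  s ^ 7 * \<mu> ^ 8 * \<xi> t x ^ 7 * exp (2 * s * \<phi> t x) * \<bar>\<eta> t x\<bar>\<^sup>2)
               + cyl_integral T UNIV (\<lambda>t x. exp (2 * s * \<phi> t x) *
                  \<bar>(dt ^^ 2) \<eta> t x - \<alpha> * (dx ^^ 2) (dt \<eta>) t x + (dx ^^ 4) \<eta> t x\<bar>\<^sup>2))))"
proof -
  let ?\<Psi> = "Psi \<psi>\<Omega> \<psi>I"
  obtain p1 p2 p3 q q' :: "real \<Rightarrow> real" and K \<delta> :: real where
    cutoff: "spatial_cutoff K \<delta> p1 p2 p3 q q'"
    and "\<forall>x. (\<psi>I has_real_derivative p1 x) (at x)" "\<forall>x. x \<notin> J0 \<longrightarrow> q x = 0"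
    using torus_cutoff[OF assms(12,14,17)] by blast
  note d0 = this(2)[rule_format] and q0 = this(3)[rule_format]
  interpret spatial_cutoff K \<delta> p1 p2 p3 q q' by (rule cutoff)
  have qJ: "q x = 0" if "x \<notin> J" for x
    using q0[of x] that assms(15) closure_subset[of J0] by (auto simp: compactly_in_def)
  have \<psi>: "periodic \<psi>I" "\<And>x. 0 < \<psi>I x" using assms(17) by (auto simp: weight_torus_def)
  have cont\<psi>: "continuous_on UNIV \<psi>I" using d0 by (auto intro!: continuous_at_imp_continuous_on DERIV_isCont)
  have \<psi>le: "\<psi>I x \<le> ?\<Psi>" for x
    using le_Linf_norm[OF \<psi>(1) cont\<psi>, of x] Linf_norm_nonneg[of "torus_fund \<times> {0<..<1}" \<psi>\<Omega>]
    unfolding Psi_def by linarith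
  define r where "r = \<alpha> / 2"
  define \<sigma> where "\<sigma> = sqrt (1 - r\<^sup>2)"
  have r: "0 < r" "r < 1" using assms(18,19) alpha_star_less_2 by (auto simp: r_def)
  have r2: "r\<^sup>2 < 1" using r by (simp add: abs_square_less_1)
  have rs: "r\<^sup>2 + \<sigma>\<^sup>2 = 1" "0 < r" "0 < \<sigma>" using r r2 by (auto simp: \<sigma>_def)
  have \<alpha>: "\<alpha> = 2 * r" by (simp add: r_def)
  \<comment> \<open>The largest value that the commutator bound allows. It depends only on \<psi>I
    and J0, through K and \<delta>.\<close>
  define \<epsilon> where "\<epsilon> = \<delta>\<^sup>2 / (10 * K ^ 3)"
  have K3: "1 \<le> K ^ 3" using K1 by simp
  have d2: "0 < \<delta>\<^sup>2" "\<delta>\<^sup>2 \<le> 1" using delta by (auto intro: power_le_one)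
  have \<epsilon>: "0 < \<epsilon>" "\<epsilon> \<le> 1" "10 * K ^ 3 * \<epsilon> \<le> \<delta>\<^sup>2"
  proof -
    have pos: "0 < 10 * K ^ 3" using K3 by linarith
    then show "0 < \<epsilon>" unfolding \<epsilon>_def using d2 by (intro divide_pos_pos)
    show "\<epsilon> \<le> 1" unfolding \<epsilon>_def pos_divide_le_eq[OF pos] using d2 K3 by linarith
    show "10 * K ^ 3 * \<epsilon> \<le> \<delta>\<^sup>2" using K3 by (simp add: \<epsilon>_def)
  qed
  \<comment> \<open>Obtained before \<mu>, \<lambda>, T, s and \<eta> are introduced, hence uniform
    in them.\<close>
  obtain C where C: "0 < C" "absorbs (\<delta>\<^sup>2 * r\<^sup>2 * \<sigma>\<^sup>2) (1200 * K ^ 4 * (18432 * K\<^sup>2))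
      (\<lambda>\<eta>. 25 + (11 * K)\<^sup>2 + 1 / \<eta>) (\<delta>\<^sup>2) (2 * K\<^sup>2) C"
    using absorbs_exists[of "\<delta>\<^sup>2 * r\<^sup>2 * \<sigma>\<^sup>2" "1200 * K ^ 4 * (18432 * K\<^sup>2)" "\<delta>\<^sup>2" "2 * K\<^sup>2" "\<lambda>\<eta>. 25 + (11 * K)\<^sup>2 + 1 / \<eta>"]
      d2 rs K1 by (auto simp: add_pos_pos)
  have est: "cyl_integral T UNIV (\<lambda>t x. exp (2 * s * phi0 \<psi>I ?\<Psi> k T lam \<mu> t x) *
          (s ^ 7 * \<mu> ^ 8 * xi0 \<psi>I ?\<Psi> k T lam \<mu> t x ^ 7 * \<bar>\<eta> t x\<bar>\<^sup>2
           + s ^ 5 * \<mu> ^ 6 * xi0 \<psi>I ?\<Psi> k T lam \<mu> t x ^ 5 * \<bar>dx \<eta> t x\<bar>\<^sup>2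
           + s ^ 3 * \<mu> ^ 4 * xi0 \<psi>I ?\<Psi> k T lam \<mu> t x ^ 3 * \<bar>(dx ^^ 2) \<eta> t x\<bar>\<^sup>2
           + s ^ 3 * \<mu> ^ 4 * xi0 \<psi>I ?\<Psi> k T lam \<mu> t x ^ 3 * \<bar>dt \<eta> t x\<bar>\<^sup>2
           + s * \<mu> ^ 2 * xi0 \<psi>I ?\<Psi> k T lam \<mu> t x * \<bar>(dx ^^ 3) \<eta> t x\<bar>\<^sup>2
           + s * \<mu> ^ 2 * xi0 \<psi>I ?\<Psi> k T lam \<mu> t x * \<bar>dt (dx \<eta>) t x\<bar>\<^sup>2))
        + 1 / s * cyl_integral T UNIV (\<lambda>t x. 1 / xi0 \<psi>I ?\<Psi> k T lam \<mu> t x * exp (2 * s * phi0 \<psi>I ?\<Psi> k T lam \<mu> t x) *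
          (\<bar>(dx ^^ 4) \<eta> t x\<bar>\<^sup>2 + \<bar>(dt ^^ 2) \<eta> t x\<bar>\<^sup>2 + \<bar>dt ((dx ^^ 2) \<eta>) t x\<bar>\<^sup>2))
        \<le> C * (cyl_integral T J (\<lambda>t x.
                  s ^ 7 * \<mu> ^ 8 * xi0 \<psi>I ?\<Psi> k T lam \<mu> t x ^ 7 * exp (2 * s * phi0 \<psi>I ?\<Psi> k T lam \<mu> t x) * \<bar>\<eta> t x\<bar>\<^sup>2)
               + cyl_integral T UNIV (\<lambda>t x. exp (2 * s * phi0 \<psi>I ?\<Psi> k T lam \<mu> t x) *
                  \<bar>(dt ^^ 2) \<eta> t x - \<alpha> * (dx ^^ 2) (dt \<eta>) t x + (dx ^^ 4) \<eta> t x\<bar>\<^sup>2))"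
    if par: "1 / \<epsilon> \<le> \<mu>" "\<mu> \<le> lam" "0 < T" "3 * (k / 2)\<^sup>2 / \<epsilon> * (T powr k + T powr (k - 1)) \<le> s"
      and \<eta>: "\<eta> \<in> C2_C4 T" for \<mu> lam T s \<eta>
  proof -
    interpret W: carleman_weight K \<delta> p1 p2 p3 q q' T \<mu> \<epsilon>
      "\<lambda>t x. exp (2 * s * phi0 \<psi>I ?\<Psi> k T lam \<mu> t x)" "\<lambda>t x. s * xi0 \<psi>I ?\<Psi> k T lam \<mu> t x"
      "\<lambda>t x. - (k / 2) * (T - 2 * t) / ell T t"
      "\<lambda>t x. s * phi0 \<psi>I ?\<Psi> k T lam \<mu> t x * (- (k / 2) * (T - 2 * t) / ell T t)"
      "\<lambda>t x. s * phi0 \<psi>I ?\<Psi> k T lam \<mu> t x * ((- (k / 2) * (T - 2 * t) / ell T t)\<^sup>2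
         + (k / 2) * (2 * ell T t + (T - 2 * t)\<^sup>2) / (ell T t)\<^sup>2)"
      by (rule carleman_weight_instance[OF cutoff d0 \<psi> \<psi>le assms(20) \<epsilon> par])
    obtain E where jet: "space_time_jet T E" and "\<forall>i t x. (dx ^^ i) \<eta> t x = E 0 i t x"
        "\<forall>i t x. 0 < t \<longrightarrow> t < T \<longrightarrow> i \<le> 4 \<longrightarrow>
          dt ((dx ^^ i) \<eta>) t x = E 1 i t x \<and> (dx ^^ i) (dt \<eta>) t x = E 1 i t x"
        "\<forall>t x. 0 < t \<longrightarrow> t < T \<longrightarrow> (dt ^^ 2) \<eta> t x = E 2 0 t x"
      using C2_C4_jet[OF par(3) \<eta>] by blast
    note Eq = this(2)[rule_format] this(3)[rule_format, THEN conjunct1] this(3)[rule_format, THEN conjunct2]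
      this(4)[rule_format]
    have E: "moderate T (E j i)" if "j \<le> 2" "i \<le> 4" for j i
      using jet that by (simp add: space_time_jet_def)
    have Eq0: "\<eta> t x = E 0 0 t x" "dx \<eta> t x = E 0 1 t x" for t x
      using Eq(1)[of 0 t x] Eq(1)[of 1 t x] by simp_all
    have Eq1: "dt \<eta> t x = E 1 0 t x" "dt (dx \<eta>) t x = E 1 1 t x" if "0 < t" "t < T" for t x
      using Eq(2)[OF that, of 0 x] Eq(2)[OF that, of 1 x] by simp_all
    define \<xi> where "\<xi> = xi0 \<psi>I ?\<Psi> k T lam \<mu>"
    define w where "w = (\<lambda>t x. exp (2 * s * phi0 \<psi>I ?\<Psi> k T lam \<mu> t x))"
    define N where "N = (\<lambda>t x. s * \<xi> t x)"
    have I: "W.I F = cyl_integral T UNIV (\<lambda>t x. w t x * F t x)" for F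
      by (simp add: W.I_def w_def)
    define P0 where "P0 = (\<lambda>t x. \<mu> ^ 8 * N t x ^ 7 * (E 0 0 t x)\<^sup>2)"
    define P1 where "P1 = (\<lambda>t x. \<mu> ^ 6 * N t x ^ 5 * (E 0 1 t x)\<^sup>2)"
    define P2 where "P2 = (\<lambda>t x. \<mu> ^ 4 * N t x ^ 3 * ((E 0 2 t x)\<^sup>2 + (E 1 0 t x)\<^sup>2)
        + \<mu>\<^sup>2 * N t x * ((E 0 3 t x)\<^sup>2 + (E 1 1 t x)\<^sup>2))"
    define P3 where "P3 = (\<lambda>t x. ((E 0 4 t x)\<^sup>2 + (E 2 0 t x)\<^sup>2 + (E 1 2 t x)\<^sup>2) / N t x)"
    define f where "f = (\<lambda>t x. E 2 0 t x - 2 * r * E 1 2 t x + E 0 4 t x)"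
    have m: "moderate T P0" "moderate T P1" "moderate T P2" "moderate T P3"
      unfolding P0_def P1_def P2_def P3_def N_def \<xi>_def by (intro W.weight_intros E; simp)+
    have "W.I P0 + W.I P1 + W.I (\<lambda>t x. P2 t x + P3 t x) \<le> C * (W.I (\<lambda>t x. (f t x)\<^sup>2) + W.I (\<lambda>t x. q x ^ 2 * P0 t x))"
      using W.carleman_estimate[of E r \<sigma> C, OF _ _ _ rs C(2)] jet unfolding space_time_jet_def P0_def P1_def P2_def P3_def f_def N_def \<xi>_def by simp
    also have "W.I P0 + W.I P1 + W.I (\<lambda>t x. P2 t x + P3 t x) = W.I (\<lambda>t x. P0 t x + P1 t x + P2 t x) + W.I P3"
      by (simp add: W.I_add m moderate_add)
    finally have main: "W.I (\<lambda>t x. P0 t x + P1 t x + P2 t x) + W.I P3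
      \<le> C * (W.I (\<lambda>t x. (f t x)\<^sup>2) + W.I (\<lambda>t x. q x ^ 2 * P0 t x))" .
    have Npos: "0 < N t x" if "0 < t" "t < T" for t x using W.N_pos[OF that] by (simp add: N_def \<xi>_def)
    have "W.I (\<lambda>t x. q x ^ 2 * P0 t x) \<le> cyl_integral T J (\<lambda>t x. w t x * P0 t x)"
      unfolding w_def
    proof (rule W.I_cutoff_le[OF m(1) _ assms(9) qJ])
      show "0 \<le> P0 t x" if "0 < t" "t < T" for t x
        using Npos[OF that, of x] W.mu(2) by (simp add: P0_def)
    qed
    then have main': "W.I (\<lambda>t x. P0 t x + P1 t x + P2 t x) + W.I P3
      \<le> C * (cyl_integral T J (\<lambda>t x. w t x * P0 t x) + W.I (\<lambda>t x. (f t x)\<^sup>2))"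
      using main mult_left_mono[of _ _ C] C(1) by (smt (verit, ccfv_SIG))
    have e1: "cyl_integral T UNIV (\<lambda>t x. w t x *
          (s ^ 7 * \<mu> ^ 8 * \<xi> t x ^ 7 * \<bar>\<eta> t x\<bar>\<^sup>2 + s ^ 5 * \<mu> ^ 6 * \<xi> t x ^ 5 * \<bar>dx \<eta> t x\<bar>\<^sup>2
           + s ^ 3 * \<mu> ^ 4 * \<xi> t x ^ 3 * \<bar>(dx ^^ 2) \<eta> t x\<bar>\<^sup>2 + s ^ 3 * \<mu> ^ 4 * \<xi> t x ^ 3 * \<bar>dt \<eta> t x\<bar>\<^sup>2
           + s * \<mu> ^ 2 * \<xi> t x * \<bar>(dx ^^ 3) \<eta> t x\<bar>\<^sup>2 + s * \<mu> ^ 2 * \<xi> t x * \<bar>dt (dx \<eta>) t x\<bar>\<^sup>2))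
        = W.I (\<lambda>t x. P0 t x + P1 t x + P2 t x)"
      unfolding I
    proof (rule cyl_integral_cong)
      fix t x assume t: "0 < t" "t < T"
      show "w t x * (s ^ 7 * \<mu> ^ 8 * \<xi> t x ^ 7 * \<bar>\<eta> t x\<bar>\<^sup>2 + s ^ 5 * \<mu> ^ 6 * \<xi> t x ^ 5 * \<bar>dx \<eta> t x\<bar>\<^sup>2
           + s ^ 3 * \<mu> ^ 4 * \<xi> t x ^ 3 * \<bar>(dx ^^ 2) \<eta> t x\<bar>\<^sup>2 + s ^ 3 * \<mu> ^ 4 * \<xi> t x ^ 3 * \<bar>dt \<eta> t x\<bar>\<^sup>2
           + s * \<mu> ^ 2 * \<xi> t x * \<bar>(dx ^^ 3) \<eta> t x\<bar>\<^sup>2 + s * \<mu> ^ 2 * \<xi> t x * \<bar>dt (dx \<eta>) t x\<bar>\<^sup>2)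
        = w t x * (P0 t x + P1 t x + P2 t x)"
        unfolding Eq Eq0 Eq1[OF t] P0_def P1_def P2_def N_def power_mult_distrib power2_abs
        by (simp only: distrib_left distrib_right mult_ac add_ac)
    qed
    have e2: "1 / s * cyl_integral T UNIV (\<lambda>t x. 1 / \<xi> t x * w t x *
          (\<bar>(dx ^^ 4) \<eta> t x\<bar>\<^sup>2 + \<bar>(dt ^^ 2) \<eta> t x\<bar>\<^sup>2 + \<bar>dt ((dx ^^ 2) \<eta>) t x\<bar>\<^sup>2)) = W.I P3"
      unfolding I cyl_integral_cmult
    proof (rule cyl_integral_cong)
      fix t x assume t: "0 < t" "t < T"
      have e: "dt ((dx ^^ 2) \<eta>) t x = E 1 2 t x" using Eq(2)[OF t, of 2 x] by simp
      show "1 / s * (1 / \<xi> t x * w t x * (\<bar>(dx ^^ 4) \<eta> t x\<bar>\<^sup>2 + \<bar>(dt ^^ 2) \<eta> t x\<bar>\<^sup>2 + \<bar>dt ((dx ^^ 2) \<eta>) t x\<bar>\<^sup>2))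
        = w t x * P3 t x"
        unfolding e Eq(4)[OF t] Eq(1) P3_def N_def power2_abs by simp
    qed
    have e3: "cyl_integral T J (\<lambda>t x. s ^ 7 * \<mu> ^ 8 * \<xi> t x ^ 7 * w t x * \<bar>\<eta> t x\<bar>\<^sup>2)
        = cyl_integral T J (\<lambda>t x. w t x * P0 t x)"
      by (rule cyl_integral_cong) (simp add: Eq0 P0_def N_def power_mult_distrib mult_ac)
    have e4: "cyl_integral T UNIV (\<lambda>t x. w t x * \<bar>(dt ^^ 2) \<eta> t x - \<alpha> * (dx ^^ 2) (dt \<eta>) t x + (dx ^^ 4) \<eta> t x\<bar>\<^sup>2)
        = W.I (\<lambda>t x. (f t x)\<^sup>2)"
      unfolding I
    proof (rule cyl_integral_cong)
      fix t x assume t: "0 < t" "t < T"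
      have e: "(dx ^^ 2) (dt \<eta>) t x = E 1 2 t x" using Eq(3)[OF t, of 2 x] by simp
      show "w t x * \<bar>(dt ^^ 2) \<eta> t x - \<alpha> * (dx ^^ 2) (dt \<eta>) t x + (dx ^^ 4) \<eta> t x\<bar>\<^sup>2 = w t x * (f t x)\<^sup>2"
        unfolding e Eq(4)[OF t] Eq(1) f_def \<alpha> power2_abs ..
    qed
    show ?thesis
      using main'[folded e1 e2 e3 e4] unfolding w_def \<xi>_def .
  qed
  \<comment> \<open>The thresholds are 1 / \<epsilon> for \<mu> and 3 (k/2)^2 / \<epsilon> for s;
    both are at least 1 because \<epsilon> \<le> 1 and k \<ge> 2.\<close>
  have one: "1 \<le> 1 / \<epsilon>" using \<epsilon> by simp
  have "1 \<le> (k / 2)\<^sup>2" using assms(20) by simp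
  then have "1 * 1 \<le> 3 * (k / 2)\<^sup>2 * (1 / \<epsilon>)" using one by (intro mult_mono) auto
  then have s0: "1 \<le> 3 * (k / 2)\<^sup>2 / \<epsilon>" by simp
  show ?thesis
    unfolding Let_def
    by (intro exI[of _ C] exI[of _ "1 / \<epsilon>"] exI[of _ "3 * (k / 2)\<^sup>2 / \<epsilon>"] conjI allI impI ballI C(1) one s0 est)
qed

end
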